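(* Let $(\epsilon_n)_{n\ge1}$ and $(\delta_n)_{n\ge1}$ be decreasing sequences in $]0,\varphi^{-1}]$ with $\delta_n\le\epsilon_n$ for all $n\geq 1$ and $\sum_{n\ge1}\epsilon_n<\infty$. Then there exist integers $k_n\ge2$ ($n\ge2$), a real number $\alpha>0$, vectors $z_n\in\mathbb{Z}^2$ and vectors $w_n=u_ne_u+\bar v_ne_s\in\mathbb{R}^2$ ($n\ge1$) such that, with $M(n)=A^{k_n}$ for $n\ge2$, $P(1)=I$, $P(n)=M(n)\cdots M(2)$ and $H(1)=(1,1)^T$: (a) $\alpha P(n)H(1)=w_n+z_n$ and $0<u_n\le\delta_n\bar v_n$ for all $n\ge1$, and $\|w_n\|\le4\epsilon_n$ for all $n\ge2$; (b) $\alpha H(1)\notin\mathbb{Z}^2+E^s$; (c) $|(w_n)_1|/|(w_n)_2|<M_{j,2}(n+1)/M_{j,1}(n+1)$ for all $n\ge1$ and $j\in\{1,2\}$; and such that the following holds. Consider the ordered Bratteli diagram with $V_n=\{1,2\}$ for $n\ge1$, one edge from $v_0$ to each vertex of $V_1$, incidence matrices $M(n)$, $n\ge2$, in which for $n\ge1$ and $j\in\{1,2\}$ the edges of $E_{n+1}$ ending at $j$ are ordered according to the best ordering associated to $(w_n,(M_{j,1}(n+1),M_{j,2}(n+1))^T)$. The associated Bratteli-Vershik system $(X,T)$ is a uniquely ergodic Cantor minimal system with unique invariant probability measure $\mu$, and the complex number $\exp(2i\pi\alpha)$ is an eigenvalue of $(X,T,\mu)$ that is not a continuous eigenvalue of 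$(X,T)$.
   Context: $A=\begin{pmatrix}1&1\\1&0\end{pmatrix}$, $\varphi=\frac{1+\sqrt5}{2}$ is its Perron eigenvalue, and $\{e_u,e_s\}$ is an orthonormal basis of $\mathbb{R}^2$ with $e_u$ an eigenvector of $A$ for $\varphi$ with positive coordinates and $e_s$ an eigenvector of $A$ for the other eigenvalue, with $\langle e_s,(0,1)^T\rangle>0$. $E^s=\mathbb{R}e_s=\{v\in\mathbb{R}^2: A^nv\to0\}$. Norm: $\|v\|=\max_i|v_i|$. Best ordering. Let $w=(w_1,w_2)^T\in\mathbb{R}^2$ with $w_2>0$ and $h=(h_1,h_2)^T\in\mathbb{N}^2$ with positive coordinates, such that $|w_1|/|w_2|<h_2/h_1$. With $e_1,e_2$ the canonical basis, the best ordering associated to $(w,h)$ is the word $p=p_1\cdots p_l\in\{1,2\}^l$, $l=h_1+h_2$, defined recursively for $0\le i\le l-1$ by $p_{i+1}=1$ if $\langle\sum_{r=1}^{i}e_{p_r}-h,w\rangle>0$ and $p_{i+1}=2$ otherwise. Ordering the edges ending at a vertex $j$ according to $p$ means that the $i$-th edge, in increasing order, has initial vertex $p_i$. Bratteli-Vershik systems. A Bratteli diagram is an infinite graph with vertex set $V=\bigsqcup_{n\ge0}V_n$ and edge set $E=\bigsqcup_{n\ge1}E_n$, $V_0=\{v_0\}$, edges in $E_n$ going from $V_{n-1}$ (initial point) to $V_n$ (end-point); for $n\ge2$ the incidence matrix $M(n)$ has as $(i,j)$ entry $M_{i,j}(n)$ the number of edges of $E_n$ from $j\in V_{n-1}$ to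 $i\in V_n$. An order $\preceq$ is a partial order on $E$ for which two edges are comparable iff they have the same end-point. $X$ is the compact space of infinite paths $(e_1,e_2,\dots)$, $e_n\in E_n$, starting at $v_0$, with the topology generated by cylinder sets. When there are exactly one path $x_{\max}$ with all edges maximal and exactly one path $x_{\min}$ with all edges minimal, the Vershik map $T$ sends $x_{\max}$ to $x_{\min}$ and, for $x\neq x_{\max}$, if $k$ is least with $x_k$ not maximal, $T(x)=(y_1,\dots,y_{k-1},y_k,x_{k+1},\dots)$, where $y_k$ is the successor of $x_k$ and $(y_1,\dots,y_{k-1})$ is the path of minimal edges from $v_0$ to the initial point of $y_k$. $\lambda$ is an eigenvalue of $(X,T,\mu)$ if there is $f\in L^2(X,\mu)$, $f\ne0$, with $f\circ T=\lambda f$ $\mu$-a.e.; it is a continuous eigenvalue of $(X,T)$ if there is such a nonzero $f$ that is continuous with $f\circ T=\lambda f$ everywhere. *)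

theory Defs
  imports "HOL-Probability.Probability"
begin

section \<open>Matrices\<close>

text \<open>The type class power on \<^typ>\<open>'a^'n^'n\<close> is the entrywise one, hence a separate matrix power.\<close>

definition mat_power :: "'a::semiring_1^'n^'n \<Rightarrow> nat \<Rightarrow> 'a^'n^'n" where
  "mat_power A k = (((**) A) ^^ k) (mat 1)"

text \<open>\<open>mat_product M n = M n ** \<dots> ** M 2\<close>, which is the identity for \<open>n = 1\<close>; the value at
  \<open>n = 0\<close> is never used.\<close>

fun mat_product :: "(nat \<Rightarrow> 'a::semiring_1^'n^'n) \<Rightarrow> nat \<Rightarrow> 'a^'n^'n" where
  "mat_product M 0 = mat 1"
| "mat_product M (Suc n) = (if n = 0 then mat 1 else M (Suc n) ** mat_product M n)"

definition fib_mat :: "'a::semiring_1^2^2" where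
  "fib_mat = vector [vector [1, 1], vector [1, 0]]"

definition golden_ratio :: real where
  "golden_ratio = (1 + sqrt 5) / 2"

definition real_vec :: "nat^'n \<Rightarrow> real^'n" where
  "real_vec h = (\<chi> i. real (h $ i))"

definition real_ivec :: "int^'n \<Rightarrow> real^'n" where
  "real_ivec z = (\<chi> i. real_of_int (z $ i))"

section \<open>Best orderings\<close>

text \<open>\<open>best_prefix w h i\<close> is the word \<open>p\<^sub>1 \<dots> p\<^sub>i\<close>; \<open>axis j 1\<close> is the canonical basis vector \<open>e\<^sub>j\<close>.\<close>

fun best_prefix :: "real^2 \<Rightarrow> nat^2 \<Rightarrow> nat \<Rightarrow> 2 list" where
  "best_prefix w h 0 = []"
| "best_prefix w h (Suc i) =
     (let p = best_prefix w h i in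
      p @ [if (sum_list (map (\<lambda>j. axis j 1) p) - real_vec h) \<bullet> w > 0 then 1 else 2])"

definition best_ordering :: "real^2 \<Rightarrow> nat^2 \<Rightarrow> 2 list" where
  "best_ordering w h = best_prefix w h (h $ 1 + h $ 2)"

section \<open>Ordered Bratteli diagrams and Vershik maps\<close>

text \<open>All components are indexed by the level \<open>n\<close>. The unions over \<open>n\<close> are disjoint unions by virtue
  of this indexing, so the same element may be used to represent vertices (or edges) of different
  levels. The edges of level \<open>n \<ge> 1\<close> go from level \<open>n - 1\<close> to level \<open>n\<close>; level \<open>0\<close> of the
  edge-related components is never used.\<close>

record ('v, 'e) bratteli =
  vertices :: "nat \<Rightarrow> 'v set"
  edges :: "nat \<Rightarrow> 'e set"
  initial :: "nat \<Rightarrow> 'e \<Rightarrow> 'v"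
  endpoint :: "nat \<Rightarrow> 'e \<Rightarrow> 'v"
  edge_order :: "nat \<Rightarrow> ('e \<times> 'e) set"

definition ordered_bratteli_diagram :: "('v, 'e) bratteli \<Rightarrow> bool" where
  "ordered_bratteli_diagram B \<longleftrightarrow>
     (\<exists>v0. vertices B 0 = {v0}) \<and>
     (\<forall>n. finite (vertices B n) \<and> vertices B n \<noteq> {}) \<and>
     (\<forall>n\<ge>1. finite (edges B n) \<and>
        initial B n ` edges B n = vertices B (n - 1) \<and>
        endpoint B n ` edges B n = vertices B n \<and>
        partial_order_on (edges B n) (edge_order B n) \<and>
        (\<forall>e\<in>edges B n. \<forall>f\<in>edges B n.
           ((e, f) \<in> edge_order B n \<or> (f, e) \<in> edge_order B n) \<longleftrightarrow>
           endpoint B n e = endpoint B n f))"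

definition incidence :: "('v, 'e) bratteli \<Rightarrow> nat \<Rightarrow> 'v \<Rightarrow> 'v \<Rightarrow> nat" where
  "incidence B n i j = card {e \<in> edges B n. initial B n e = j \<and> endpoint B n e = i}"

definition max_edge :: "('v, 'e) bratteli \<Rightarrow> nat \<Rightarrow> 'e \<Rightarrow> bool" where
  "max_edge B n e \<longleftrightarrow> e \<in> edges B n \<and> (\<forall>f\<in>edges B n. (e, f) \<in> edge_order B n \<longrightarrow> f = e)"

definition min_edge :: "('v, 'e) bratteli \<Rightarrow> nat \<Rightarrow> 'e \<Rightarrow> bool" where
  "min_edge B n e \<longleftrightarrow> e \<in> edges B n \<and> (\<forall>f\<in>edges B n. (f, e) \<in> edge_order B n \<longrightarrow> f = e)"

definition succ_edge :: "('v, 'e) bratteli \<Rightarrow> nat \<Rightarrow> 'e \<Rightarrow> 'e" where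
  "succ_edge B n e = (THE f. f \<in> edges B n \<and> (e, f) \<in> edge_order B n \<and> f \<noteq> e \<and>
     (\<forall>g\<in>edges B n. (e, g) \<in> edge_order B n \<and> g \<noteq> e \<longrightarrow> (f, g) \<in> edge_order B n))"

text \<open>A path is a function on the levels \<open>n \<ge> 1\<close>, made extensional so that equality of paths is
  equality of functions.\<close>

definition paths :: "('v, 'e) bratteli \<Rightarrow> (nat \<Rightarrow> 'e) set" where
  "paths B = {x \<in> (\<Pi>\<^sub>E n\<in>{1..}. edges B n).
     \<forall>n\<ge>1. endpoint B n (x n) = initial B (Suc n) (x (Suc n))}"

definition cylinder :: "('v, 'e) bratteli \<Rightarrow> (nat \<Rightarrow> 'e) \<Rightarrow> nat \<Rightarrow> (nat \<Rightarrow> 'e) set" where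
  "cylinder B x n = {y \<in> paths B. \<forall>i\<in>{1..n}. y i = x i}"

definition path_space :: "('v, 'e) bratteli \<Rightarrow> (nat \<Rightarrow> 'e) topology" where
  "path_space B = topology_generated_by {cylinder B x n |x n. x \<in> paths B}"

definition max_path :: "('v, 'e) bratteli \<Rightarrow> (nat \<Rightarrow> 'e) \<Rightarrow> bool" where
  "max_path B x \<longleftrightarrow> x \<in> paths B \<and> (\<forall>n\<ge>1. max_edge B n (x n))"

definition min_path :: "('v, 'e) bratteli \<Rightarrow> (nat \<Rightarrow> 'e) \<Rightarrow> bool" where
  "min_path B x \<longleftrightarrow> x \<in> paths B \<and> (\<forall>n\<ge>1. min_edge B n (x n))"

definition properly_ordered :: "('v, 'e) bratteli \<Rightarrow> bool" where
  "properly_ordered B \<longleftrightarrow> (\<exists>!x. max_path B x) \<and> (\<exists>!x. min_path B x)"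

definition vershik :: "('v, 'e) bratteli \<Rightarrow> (nat \<Rightarrow> 'e) \<Rightarrow> (nat \<Rightarrow> 'e)" where
  "vershik B x =
     (if max_path B x then (THE y. min_path B y)
      else let k = (LEAST k. k \<ge> 1 \<and> \<not> max_edge B k (x k)) in
        (THE y. y \<in> paths B \<and> (\<forall>i\<in>{1..<k}. min_edge B i (y i)) \<and>
                y k = succ_edge B k (x k) \<and> (\<forall>i>k. y i = x i)))"

text \<open>For \<open>n \<ge> 2\<close> the edge \<open>(j, i)\<close> of level \<open>n\<close> is the \<open>i\<close>-th edge (counted from \<open>0\<close>) with end-point
  \<open>j\<close>; its initial vertex is the \<open>i\<close>-th letter of the best ordering. Row \<open>j\<close> of \<open>M n\<close> is
  \<open>(M\<^sub>j\<^sub>1, M\<^sub>j\<^sub>2)\<close>. \<open>None\<close> is the vertex \<open>v\<^sub>0\<close>.\<close>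

definition best_ordering_diagram ::
    "(nat \<Rightarrow> nat^2^2) \<Rightarrow> (nat \<Rightarrow> real^2) \<Rightarrow> (2 option, 2 \<times> nat) bratteli" where
  "best_ordering_diagram M w =
     (let word = (\<lambda>n j. best_ordering (w (n - 1)) (M n $ j));
          E = (\<lambda>n. if n = 0 then {} else if n = 1 then {(j, i). i = 0}
                   else {(j, i). i < length (word n j)})
      in \<lparr> vertices = (\<lambda>n. if n = 0 then {None} else {Some 1, Some 2}),
           edges = E,
           initial = (\<lambda>n (j, i). if n = 1 then None else Some (word n j ! i)),
           endpoint = (\<lambda>n (j, i). Some j),
           edge_order = (\<lambda>n. {(e, f). e \<in> E n \<and> f \<in> E n \<and> fst e = fst f \<and> snd e \<le> snd f}) \<rparr>)"

section \<open>Dynamical systems\<close>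

definition cantor_space :: "'a topology \<Rightarrow> bool" where
  "cantor_space X \<longleftrightarrow>
     topspace X \<noteq> {} \<and> compact_space X \<and> metrizable_space X \<and>
     (\<exists>\<B>. countable \<B> \<and> (\<forall>V\<in>\<B>. openin X V \<and> closedin X V) \<and>
          (\<forall>U x. openin X U \<and> x \<in> U \<longrightarrow> (\<exists>V\<in>\<B>. x \<in> V \<and> V \<subseteq> U))) \<and>
     (\<forall>x\<in>topspace X. \<not> openin X {x})"

text \<open>The two-sided orbit of \<open>x\<close> under a bijection \<open>T\<close> of the space.\<close>

definition orbit_of :: "'a topology \<Rightarrow> ('a \<Rightarrow> 'a) \<Rightarrow> 'a \<Rightarrow> 'a set" where
  "orbit_of X T x = {y \<in> topspace X. \<exists>n. (T ^^ n) x = y \<or> (T ^^ n) y = x}"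

definition cantor_minimal_system :: "'a topology \<Rightarrow> ('a \<Rightarrow> 'a) \<Rightarrow> bool" where
  "cantor_minimal_system X T \<longleftrightarrow>
     cantor_space X \<and> homeomorphic_map X X T \<and>
     (\<forall>x\<in>topspace X. X closure_of (orbit_of X T x) = topspace X)"

definition borel_of :: "'a topology \<Rightarrow> 'a measure" where
  "borel_of X = sigma (topspace X) {U. openin X U}"

definition invariant_probability :: "'a topology \<Rightarrow> ('a \<Rightarrow> 'a) \<Rightarrow> 'a measure \<Rightarrow> bool" where
  "invariant_probability X T \<mu> \<longleftrightarrow>
     prob_space \<mu> \<and> sets \<mu> = sets (borel_of X) \<and> T \<in> measurable \<mu> \<mu> \<and> distr \<mu> \<mu> T = \<mu>"

definition uniquely_ergodic :: "'a topology \<Rightarrow> ('a \<Rightarrow> 'a) \<Rightarrow> bool" where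
  "uniquely_ergodic X T \<longleftrightarrow> (\<exists>!\<mu>. invariant_probability X T \<mu>)"

definition measurable_eigenvalue :: "('a \<Rightarrow> 'a) \<Rightarrow> 'a measure \<Rightarrow> complex \<Rightarrow> bool" where
  "measurable_eigenvalue T \<mu> c \<longleftrightarrow>
     (\<exists>f. f \<in> borel_measurable \<mu> \<and> integrable \<mu> (\<lambda>x. (cmod (f x))\<^sup>2) \<and>
          \<not> (AE x in \<mu>. f x = 0) \<and> (AE x in \<mu>. f (T x) = c * f x))"

definition continuous_eigenvalue :: "'a topology \<Rightarrow> ('a \<Rightarrow> 'a) \<Rightarrow> complex \<Rightarrow> bool" where
  "continuous_eigenvalue X T c \<longleftrightarrow>
     (\<exists>f. continuous_map X euclidean f \<and> (\<exists>x\<in>topspace X. f x \<noteq> 0) \<and>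
          (\<forall>x\<in>topspace X. f (T x) = c * f x))"

end

theory Submission
  imports Defs
begin

text \<open>Write vectors in the basis \<open>(e_u, e_s)\<close>. With even exponents, \<open>w (n + 1)\<close> is obtained from
  \<open>w n\<close> by applying a high power of the Fibonacci matrix and subtracting the integer vector
  \<open>A\<^sup>m (1, 0)\<close>, which lies close to the expanding line. Subtraction cancels the large expanding
  coordinate and leaves a small positive contracting one, so \<open>v\<close> solves a forward and \<open>u\<close> a backward
  linear recursion, the latter by a convergent series.

  For the best ordering associated to \<open>w\<close>, the pairing of \<open>w\<close> with the remainder of the word lies
  between \<open>w\<^sub>1\<close> and \<open>w\<^sub>2\<close>, hence is small, except along an initial run of the letter \<open>2\<close>. That run
  occupies a proportion \<open>O(\<delta> n)\<close> of a tower, so by Borel--Cantelli almost every path avoids it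
  eventually and the phases of the exit times converge to a measurable eigenfunction. Along the run,
  however, the phase increases by small steps from \<open>0\<close> to at least \<open>2/5\<close>. Two paths near the minimal
  path then have return times whose phase lies in \<open>[1/4, 2/5]\<close>, and no eigenfunction is continuous.\<close>

section \<open>Diagrams given by words\<close>

text \<open>One number has to be bounded below and yet negligible. Let \<open>T\<close> be the
  pairing of \<open>w n\<close> with row \<open>j\<close> of the next matrix \<open>A^k\<close>,
  that is, coordinate \<open>j\<close> of \<open>A^k w n\<close>. Each letter \<open>2\<close> of
  the initial run adds \<open>w n $ 2\<close> to the phase, so the run has about
  \<open>T / w n $ 2\<close> letters. By the recursion, \<open>A^k w n\<close> is a small vector
  plus a nonzero integer vector. Hence for \<open>j = 1\<close> the number \<open>T\<close> stays
  away from \<open>0\<close>: modulo \<open>1\<close> the whole word is almost neutral, but its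
  beginning sweeps through a fixed arc, which rules out continuity. On the other hand,
  \<open>T\<close> is mainly \<open>u n\<close> times the expansion factor of \<open>A^k\<close>,
  and the length of the word is comparable with the same factor. The run therefore fills a
  proportion of order \<open>u n / v n\<close> of the word. This is why \<open>u n\<close> is kept
  below \<open>\<delta> n * v n\<close>, and summability of \<open>\<delta>\<close> is what
  Borel--Cantelli uses. Finally, \<open>\<alpha> P(n) H(1)\<close> equals \<open>w n\<close> modulo
  integer vectors, and \<open>w n\<close> tends to \<open>0\<close> without ever lying on the
  contracting line. This keeps \<open>\<alpha> H(1)\<close> out of
  \<open>\<int>^2 + E^s\<close>.\<close>

definition word_diagram :: "(nat \<Rightarrow> 'v \<Rightarrow> 'v list) \<Rightarrow> ('v option, 'v \<times> nat) bratteli" where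
  "word_diagram W =
     (let E = (\<lambda>n. if n = 0 then {} else if n = 1 then {(j, i). i = 0}
                   else {(j, i). i < length (W n j)})
      in \<lparr> vertices = (\<lambda>n. if n = 0 then {None} else range Some),
           edges = E,
           initial = (\<lambda>n (j, i). if n = 1 then None else Some (W n j ! i)),
           endpoint = (\<lambda>n (j, i). Some j),
           edge_order = (\<lambda>n. {(e, f). e \<in> E n \<and> f \<in> E n \<and> fst e = fst f \<and> snd e \<le> snd f}) \<rparr>)"

section \<open>Suffix sums of lists\<close>

lemma sum_list_drop_nth:
  fixes f :: "'a \<Rightarrow> nat"
  assumes "q < length xs"
  shows "sum_list (map f (drop q xs)) = f (xs ! q) + sum_list (map f (drop (Suc q) xs))"
  using assms by (metis Cons_nth_drop_Suc list.simps(9) sum_list.Cons)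

lemma sum_list_drop_mono:
  fixes f :: "'a \<Rightarrow> nat"
  assumes "p \<le> q"
  shows "sum_list (map f (drop q xs)) \<le> sum_list (map f (drop p xs))"
proof -
  have "drop q xs = drop (q - p) (drop p xs)" using assms by simp
  then show ?thesis
    by (metis append_take_drop_id le_add2 map_append sum_list.append)
qed

text \<open>Suffix sums descend from the total to \<open>0\<close>, so \<open>t\<close> falls into
  exactly one step. With \<open>f\<close> the tower heights, that step is the edge taken by a path
  with exit time \<open>t\<close>.\<close>

lemma sum_list_drop_split:
  fixes f :: "'a \<Rightarrow> nat"
  assumes "t < sum_list (map f xs)"
  obtains q where "q < length xs" "sum_list (map f (drop (Suc q) xs)) \<le> t"
    "t < sum_list (map f (drop q xs))"
  using assms
proof (induction xs arbitrary: thesis)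
  case (Cons x xs)
  show ?case
  proof (cases "t < sum_list (map f xs)")
    case True
    then obtain q where "q < length xs" "sum_list (map f (drop (Suc q) xs)) \<le> t"
      "t < sum_list (map f (drop q xs))" using Cons.IH by blast
    then show ?thesis by (intro Cons.prems(1)[of "Suc q"]) auto
  next
    case False
    then show ?thesis using Cons.prems(2) by (intro Cons.prems(1)[of 0]) auto
  qed
qed simp

text \<open>A common first letter and a common last letter leave no choice for minimal and maximal
  paths; full letter sets give minimality; two distinct letters exclude isolated points. Full letter
  sets also make the words nonempty, so that \<open>hd\<close> and \<open>last\<close> are
  meaningful.\<close>

locale proper_words =
  fixes W :: "nat \<Rightarrow> 'v::finite \<Rightarrow> 'v list" and a b :: 'v
  assumes hd_word: "n \<ge> 2 \<Longrightarrow> hd (W n j) = a"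
    and last_word: "n \<ge> 2 \<Longrightarrow> last (W n j) = b"
    and set_word: "n \<ge> 2 \<Longrightarrow> set (W n j) = UNIV"
    and first_neq_last: "a \<noteq> b"
begin

abbreviation "B \<equiv> word_diagram W"

definition width :: "nat \<Rightarrow> 'v \<Rightarrow> nat" where
  "width n j = (if n = 1 then 1 else length (W n j))"

text \<open>\<open>height n j\<close> is the number of paths from the root to the vertex \<open>j\<close> of level \<open>n\<close>, and
  \<open>exit_time n x\<close> the number of those that come after the initial segment of \<open>x\<close>.\<close>

fun height :: "nat \<Rightarrow> 'v \<Rightarrow> nat" where
  "height 0 j = 1"
| "height (Suc n) j = (if n = 0 then 1 else sum_list (map (height n) (W (Suc n) j)))"

fun exit_time :: "nat \<Rightarrow> (nat \<Rightarrow> 'v \<times> nat) \<Rightarrow> nat" where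
  "exit_time 0 x = 0"
| "exit_time (Suc n) x = (if n = 0 then 0 else exit_time n x +
     sum_list (map (height n) (drop (Suc (snd (x (Suc n)))) (W (Suc n) (fst (x (Suc n)))))))"

lemma word_nonempty: "n \<ge> 2 \<Longrightarrow> W n j \<noteq> []"
  using set_word[of n j] by auto

lemma width_pos: "n \<ge> 1 \<Longrightarrow> width n j > 0"
  using word_nonempty[of n j] by (auto simp: width_def)

lemma word_first: "n \<ge> 2 \<Longrightarrow> W n j ! 0 = a"
  using hd_word[of n j] word_nonempty[of n j] by (simp add: hd_conv_nth)

lemma word_last: "n \<ge> 2 \<Longrightarrow> Suc i = length (W n j) \<Longrightarrow> W n j ! i = b"
  using last_word[of n j] word_nonempty[of n j] by (metis diff_Suc_1 last_conv_nth)

lemma edges_word: "n \<ge> 1 \<Longrightarrow> edges B n = {(j, i). i < width n j}"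
  by (auto simp: word_diagram_def width_def Let_def)

lemma vertices_word: "vertices B n = (if n = 0 then {None} else range Some)"
  by (simp add: word_diagram_def Let_def)

lemma initial_word: "initial B n e = (if n = 1 then None else Some (W n (fst e) ! snd e))"
  by (cases e) (simp add: word_diagram_def Let_def)

lemma endpoint_word: "endpoint B n e = Some (fst e)"
  by (cases e) (simp add: word_diagram_def Let_def)

lemma edge_order_word:
  "n \<ge> 1 \<Longrightarrow> edge_order B n =
    {(e, f). snd e < width n (fst e) \<and> snd f < width n (fst f) \<and> fst e = fst f \<and> snd e \<le> snd f}"
  by (auto simp: word_diagram_def width_def Let_def)

lemma finite_edges: "n \<ge> 1 \<Longrightarrow> finite (edges B n)"
proof -
  assume "n \<ge> 1"
  then have "edges B n = (SIGMA j:UNIV. {..<width n j})" by (auto simp: edges_word)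
  then show ?thesis by simp
qed

lemma ordered_bratteli_diagram_word: "ordered_bratteli_diagram B"
proof -
  have "initial B n ` edges B n = vertices B (n - 1)" if n: "n \<ge> 1" for n
  proof (cases "n = 1")
    case True
    then show ?thesis using width_pos[of n] by (auto simp: edges_word initial_word vertices_word image_iff)
  next
    case False
    have "\<exists>i<length (W n a). v = W n a ! i" for v
      using set_word[of n a] n False by (metis UNIV_I in_set_conv_nth One_nat_def Suc_leI
          le_neq_implies_less numeral_2_eq_2)
    then have "Some v \<in> initial B n ` edges B n" for v
      using False n unfolding edges_word[OF n] initial_word width_def
      by (simp add: image_iff) metis
    then show ?thesis using False n by (auto simp: vertices_word initial_word)
  qed
  moreover have "endpoint B n ` edges B n = vertices B n" if n: "n \<ge> 1" for n
  proof -
    have "Some v \<in> endpoint B n ` edges B n" for v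
      using width_pos[OF n, of v] by (intro image_eqI[of _ _ "(v, 0)"]) (auto simp: endpoint_word edges_word[OF n])
    then show ?thesis using n by (auto simp: vertices_word endpoint_word)
  qed
  moreover have "partial_order_on (edges B n) (edge_order B n)" if n: "n \<ge> 1" for n
    unfolding partial_order_on_def preorder_on_def edge_order_word[OF n] edges_word[OF n]
    by (auto simp: refl_on_def trans_def antisym_def)
  moreover have "((e, f) \<in> edge_order B n \<or> (f, e) \<in> edge_order B n) \<longleftrightarrow>
     endpoint B n e = endpoint B n f" if "n \<ge> 1" "e \<in> edges B n" "f \<in> edges B n" for n e f
    using that by (auto simp: edge_order_word edges_word endpoint_word)
  ultimately show ?thesis
    unfolding ordered_bratteli_diagram_def
    using finite_edges by (auto simp: vertices_word)
qed

lemma max_edge_word: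
  assumes n: "n \<ge> 1"
  shows "max_edge B n e \<longleftrightarrow> Suc (snd e) = width n (fst e)"
proof
  assume "max_edge B n e"
  then have e: "snd e < width n (fst e)"
    and "\<And>f. snd f < width n (fst f) \<Longrightarrow> fst e = fst f \<Longrightarrow> snd e \<le> snd f \<Longrightarrow> f = e"
    unfolding max_edge_def edges_word[OF n] edge_order_word[OF n] by (force, force)
  from this(2)[of "(fst e, Suc (snd e))"] show "Suc (snd e) = width n (fst e)"
    using e by (cases e) (fastforce simp: Suc_le_eq order.order_iff_strict)
next
  assume *: "Suc (snd e) = width n (fst e)"
  then have "snd e < width n (fst e)" by simp
  then show "max_edge B n e"
    unfolding max_edge_def edges_word[OF n] edge_order_word[OF n]
    using * by (cases e) auto
qed

lemma min_edge_word:
  assumes n: "n \<ge> 1"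
  shows "min_edge B n e \<longleftrightarrow> snd e = 0"
proof
  assume "min_edge B n e"
  then have e: "snd e < width n (fst e)"
    and "\<And>f. snd f < width n (fst f) \<Longrightarrow> fst e = fst f \<Longrightarrow> snd f \<le> snd e \<Longrightarrow> f = e"
    unfolding min_edge_def edges_word[OF n] edge_order_word[OF n] by (force, force)
  from this(2)[of "(fst e, 0)"] show "snd e = 0"
    using e by (cases e) auto
next
  assume *: "snd e = 0"
  then have "snd e < width n (fst e)" using width_pos n by simp
  then show "min_edge B n e"
    unfolding min_edge_def edges_word[OF n] edge_order_word[OF n]
    using * by (cases e) auto
qed

lemma succ_edge_word:
  assumes n: "n \<ge> 1" and e: "Suc q < width n j"
  shows "succ_edge B n (j, q) = (j, Suc q)"
  unfolding succ_edge_def edges_word[OF n] edge_order_word[OF n]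
proof (rule the_equality, goal_cases)
  case 1
  then show ?case using e by auto
next
  case (2 f)
  moreover have "(j, Suc q) \<in> {(j, i). i < width n j}" using e by simp
  ultimately show ?case using e by (cases f) fastforce
qed

lemma incidence_word:
  assumes "n \<ge> 2"
  shows "incidence B n (Some i) (Some j) = count_list (W n i) j"
proof -
  have "{e \<in> edges B n. initial B n e = Some j \<and> endpoint B n e = Some i} =
      Pair i ` {q. q < length (W n i) \<and> W n i ! q = j}"
    using assms by (auto simp: edges_word initial_word endpoint_word width_def)
  then show ?thesis
    unfolding incidence_def
    by (simp add: card_image inj_on_def count_list_eq_length_filter length_filter_conv_card)
      (metis (mono_tags))
qed

subsection \<open>Paths\<close>

lemma paths_iff:
  "x \<in> paths B \<longleftrightarrow> x 0 = undefined \<and> (\<forall>n\<ge>1. snd (x n) < width n (fst (x n))) \<and>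
     (\<forall>n\<ge>1. W (Suc n) (fst (x (Suc n))) ! snd (x (Suc n)) = fst (x n))" (is "_ \<longleftrightarrow> ?R")
proof -
  have "x \<in> (\<Pi>\<^sub>E n\<in>{1..}. edges B n) \<longleftrightarrow> x 0 = undefined \<and> (\<forall>n\<ge>1. snd (x n) < width n (fst (x n)))"
  proof -
    have "x \<in> (\<Pi>\<^sub>E n\<in>{1..}. edges B n) \<longleftrightarrow> x 0 = undefined \<and> (\<forall>n\<ge>1. x n \<in> edges B n)"
      by (auto simp: PiE_def Pi_def extensional_def) (metis One_nat_def not_less_eq_eq le_0_eq)
    moreover have "x n \<in> edges B n \<longleftrightarrow> snd (x n) < width n (fst (x n))" if "n \<ge> 1" for n
      unfolding edges_word[OF that] by (cases "x n") auto
    ultimately show ?thesis by auto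
  qed
  then show ?thesis unfolding paths_def mem_Collect_eq initial_word endpoint_word
    by (auto simp: eq_commute)
qed

lemma pathsD:
  assumes "x \<in> paths B"
  shows "x 0 = undefined" and "n \<ge> 1 \<Longrightarrow> snd (x n) < width n (fst (x n))"
    and "n \<ge> 1 \<Longrightarrow> W (Suc n) (fst (x (Suc n))) ! snd (x (Suc n)) = fst (x n)"
    and "n \<ge> 1 \<Longrightarrow> snd (x (Suc n)) < length (W (Suc n) (fst (x (Suc n))))"
    and "snd (x (Suc 0)) = 0"
proof -
  note * = assms[unfolded paths_iff]
  show "x 0 = undefined" "n \<ge> 1 \<Longrightarrow> snd (x n) < width n (fst (x n))"
    "n \<ge> 1 \<Longrightarrow> W (Suc n) (fst (x (Suc n))) ! snd (x (Suc n)) = fst (x n)"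
    using * by auto
  from * have "snd (x (Suc n)) < width (Suc n) (fst (x (Suc n)))" for n by auto
  from this[of n] this[of 0] show "n \<ge> 1 \<Longrightarrow> snd (x (Suc n)) < length (W (Suc n) (fst (x (Suc n))))"
    "snd (x (Suc 0)) = 0" by (auto simp: width_def)
qed

lemma paths_eqI:
  assumes "x \<in> paths B" "y \<in> paths B" "\<And>m. m \<ge> 1 \<Longrightarrow> x m = y m"
  shows "x = y"
proof
  fix m show "x m = y m"
    using assms pathsD(1)[of x] pathsD(1)[of y] by (cases "m = 0") auto
qed

text \<open>The basic way to make new paths: an initial segment of \<open>y\<close> is glued below
  the tail of \<open>x\<close>. The two parts meet at an occurrence \<open>q\<close> of the vertex
  \<open>fst (y n)\<close> in a word of level \<open>Suc n\<close>, and such an occurrence always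
  exists because every letter occurs in every word.\<close>

definition splice :: "nat \<Rightarrow> (nat \<Rightarrow> 'v \<times> nat) \<Rightarrow> nat \<Rightarrow> (nat \<Rightarrow> 'v \<times> nat) \<Rightarrow> nat \<Rightarrow> 'v \<times> nat" where
  "splice n y q x m = (if m \<le> n then y m else if m = Suc n then (fst (x m), q) else x m)"

lemma splice_in_paths:
  assumes x: "x \<in> paths B" and y: "y \<in> paths B" and n: "n \<ge> 1"
    and q: "q < length (W (Suc n) (fst (x (Suc n))))"
    and v: "W (Suc n) (fst (x (Suc n))) ! q = fst (y n)"
  shows "splice n y q x \<in> paths B"
  unfolding paths_iff
proof (intro conjI allI impI)
  show "splice n y q x 0 = undefined" using pathsD(1)[OF y] by (simp add: splice_def)
next
  fix m :: nat assume m: "1 \<le> m"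
  show "snd (splice n y q x m) < width m (fst (splice n y q x m))"
    using pathsD(2)[OF x m] pathsD(2)[OF y m] q m n by (auto simp: splice_def width_def)
  consider "Suc m \<le> n" | "m = n" | "m = Suc n" | "m > Suc n" by linarith
  then show "W (Suc m) (fst (splice n y q x (Suc m))) ! snd (splice n y q x (Suc m)) = fst (splice n y q x m)"
    by cases (use pathsD(3)[OF x m] pathsD(3)[OF y m] v in \<open>auto simp: splice_def\<close>)
qed

lemma letter_position:
  assumes "n \<ge> 2"
  obtains q where "q < length (W n j)" "W n j ! q = i"
  using set_word[OF assms, of j] by (metis UNIV_I in_set_conv_nth)

lemma bottom_path_exists:
  assumes n: "n \<ge> 1"
  shows "\<exists>x\<in>paths B. fst (x n) = i \<and> (\<forall>m\<in>{1..n}. snd (x m) = 0) \<and> (\<forall>m\<in>{1..<n}. fst (x m) = a)"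
proof -
  obtain q where q: "q < length (W (Suc n) a)" "W (Suc n) a ! q = i"
    using letter_position[of "Suc n" a i] n by auto
  \<comment> \<open>Below level \<open>n\<close> a bottom path is forced through \<open>a\<close>;
    above it, position \<open>q\<close> in the word of \<open>a\<close> leads from \<open>i\<close>
    back to the minimal path.\<close>
  define x where "x m = (if m = 0 then undefined else if m < n then (a, 0) else if m = n then (i, 0)
    else if m = Suc n then (a, q) else (a, 0))" for m
  have "x \<in> paths B"
    unfolding paths_iff
  proof (intro conjI allI impI)
    show "x 0 = undefined" by (simp add: x_def)
  next
    fix m :: nat assume m: "m \<ge> 1"
    show "snd (x m) < width m (fst (x m))"
      using width_pos[OF m] q n m by (auto simp: x_def width_def)
    consider "Suc m \<le> n" | "m = n" | "m \<ge> Suc n" by linarith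
    then show "W (Suc m) (fst (x (Suc m))) ! snd (x (Suc m)) = fst (x m)"
      by cases (use q n m word_first[of "Suc m"] in \<open>auto simp: x_def\<close>)
  qed
  then show ?thesis by (intro bexI[of _ x]) (use n in \<open>auto simp: x_def\<close>)
qed

lemma path_through:
  assumes "n \<ge> 1"
  obtains x where "x \<in> paths B" "fst (x n) = i"
  using bottom_path_exists[OF assms, of i] by auto

section \<open>Towers: heights and exit times\<close>

lemma height_pos: "height n j > 0"
proof (induction n arbitrary: j)
  case (Suc n)
  show ?case
  proof (cases "n = 0")
    case False
    then obtain v vs where "W (Suc n) j = v # vs"
      using word_nonempty[of "Suc n" j] by (cases "W (Suc n) j") auto
    then show ?thesis using Suc[of v] False by simp
  qed simp
qed simp

text \<open>The paths through position \<open>q\<close> of a word have exit times in the block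
  between the suffix sums at \<open>Suc q\<close> and at \<open>q\<close>. Blocks of different
  positions are disjoint, which is what makes exit times injective.\<close>

lemma exit_time_less_drop:
  assumes x: "x \<in> paths B" and n: "n \<ge> 1" and lt: "exit_time n x < height n (fst (x n))"
  shows "exit_time (Suc n) x < sum_list (map (height n) (drop (snd (x (Suc n))) (W (Suc n) (fst (x (Suc n))))))"
  using assms sum_list_drop_nth[OF pathsD(4)[OF x n], of "height n"] pathsD(3)[OF x n] by simp

lemma exit_time_less:
  assumes x: "x \<in> paths B" and n: "n \<ge> 1"
  shows "exit_time n x < height n (fst (x n))"
  using n
proof (induction n rule: dec_induct)
  case (step n)
  have "exit_time (Suc n) x < sum_list (map (height n) (drop (snd (x (Suc n))) (W (Suc n) (fst (x (Suc n))))))"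
    using exit_time_less_drop[OF x] step by simp
  also have "\<dots> \<le> sum_list (map (height n) (drop 0 (W (Suc n) (fst (x (Suc n))))))"
    by (rule sum_list_drop_mono) simp
  finally show ?case using step by simp
qed simp

lemma exit_time_cong:
  "(\<And>m. 1 \<le> m \<Longrightarrow> m \<le> n \<Longrightarrow> x m = y m) \<Longrightarrow> exit_time n x = exit_time n y"
  by (induction n) auto

text \<open>A mixed-radix expansion is unique: a smaller position means a strictly larger exit time,
  so equal exit times force the same edge at the top level, and then the same vertex and remainder
  one level below.\<close>

lemma exit_time_inj:
  assumes x: "x \<in> paths B" and y: "y \<in> paths B" and n: "n \<ge> 1"
    and "fst (x n) = fst (y n)" "exit_time n x = exit_time n y"
  shows "\<forall>m\<in>{1..n}. x m = y m"
  using n assms(4,5)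
proof (induction n rule: dec_induct)
  case base
  then show ?case using pathsD(5)[OF x] pathsD(5)[OF y] by (auto intro: prod_eqI)
next
  case (step n)
  have key: "snd (u (Suc n)) \<ge> snd (v (Suc n))" if "u \<in> paths B" "v \<in> paths B"
      "fst (u (Suc n)) = fst (v (Suc n))" "exit_time (Suc n) u = exit_time (Suc n) v" for u v
  proof (rule ccontr)
    assume *: "\<not> snd (u (Suc n)) \<ge> snd (v (Suc n))"
    let ?S = "\<lambda>q. sum_list (map (height n) (drop q (W (Suc n) (fst (u (Suc n))))))"
    have "exit_time (Suc n) v < ?S (snd (v (Suc n)))"
      using exit_time_less_drop[OF that(2) _ exit_time_less[OF that(2)]] step(1) that(3) by simp
    also have "\<dots> \<le> ?S (Suc (snd (u (Suc n))))" using * by (intro sum_list_drop_mono) simp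
    also have "\<dots> \<le> exit_time (Suc n) u" using step(1) by simp
    finally show False using that(4) by simp
  qed
  have s: "snd (x (Suc n)) = snd (y (Suc n))"
    using key[OF x y] key[OF y x] step.prems by (metis le_antisym)
  then have eq: "x (Suc n) = y (Suc n)" using step.prems by (auto intro: prod_eqI)
  have "exit_time n x = exit_time n y" "fst (x n) = fst (y n)"
    using step.prems(2) eq step(1) pathsD(3)[OF x step(1)] pathsD(3)[OF y step(1)] by auto
  with step.IH have "\<forall>m\<in>{1..n}. x m = y m" by blast
  with eq show ?case by (auto simp: le_Suc_eq)
qed

text \<open>Greedy expansion: the block containing \<open>t\<close> gives the edge at the top level,
  and the remainder is realised below it. The induction hypothesis is applied to a spliced path, so
  that the tail of \<open>x\<close> survives.\<close>

lemma exit_time_exists: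
  assumes "n \<ge> 1" "x \<in> paths B" "t < height n (fst (x n))"
  shows "\<exists>y\<in>paths B. fst (y n) = fst (x n) \<and> (\<forall>m>n. y m = x m) \<and> exit_time n y = t"
  using assms
proof (induction n arbitrary: x t rule: dec_induct)
  case base
  then show ?case by (intro bexI[of _ x]) auto
next
  case (step n)
  let ?w = "W (Suc n) (fst (x (Suc n)))"
  have "t < sum_list (map (height n) ?w)" using step by simp
  then obtain q where q: "q < length ?w" "sum_list (map (height n) (drop (Suc q) ?w)) \<le> t"
    "t < sum_list (map (height n) (drop q ?w))" by (rule sum_list_drop_split)
  obtain y where y: "y \<in> paths B" "fst (y n) = ?w ! q"
    using path_through[OF step(1)] by blast
  let ?z = "splice n y q x"
  have z: "?z \<in> paths B" using splice_in_paths[OF step(4) y(1) step(1) q(1)] y(2) by simp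
  have "t - sum_list (map (height n) (drop (Suc q) ?w)) < height n (fst (?z n))"
    using q sum_list_drop_nth[OF q(1), of "height n"] y(2) by (simp add: splice_def)
  from step.IH[OF z this] obtain u where u: "u \<in> paths B" "fst (u n) = fst (?z n)"
    "\<forall>m>n. u m = ?z m" "exit_time n u = t - sum_list (map (height n) (drop (Suc q) ?w))" by blast
  have "u (Suc n) = (fst (x (Suc n)), q)" using u(3) by (simp add: splice_def)
  moreover have "\<forall>m>Suc n. u m = x m" using u(3) by (simp add: splice_def)
  moreover have "exit_time (Suc n) u = t" using calculation(1) u(4) q(2) step(1) by simp
  ultimately show ?case using u(1) by (intro bexI[of _ u]) auto
qed

text \<open>Identifies cylinders with floors of towers, so that topology and measure can be computed
  from a vertex and an exit time alone.\<close>

lemma cylinder_eq_floor: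
  assumes x: "x \<in> paths B" and n: "n \<ge> 1"
  shows "cylinder B x n = {y \<in> paths B. fst (y n) = fst (x n) \<and> exit_time n y = exit_time n x}"
proof -
  have "(\<forall>i\<in>{1..n}. y i = x i) \<longleftrightarrow> fst (y n) = fst (x n) \<and> exit_time n y = exit_time n x"
    if y: "y \<in> paths B" for y
  proof
    assume *: "\<forall>i\<in>{1..n}. y i = x i"
    then have "exit_time n y = exit_time n x" by (intro exit_time_cong) auto
    with * n show "fst (y n) = fst (x n) \<and> exit_time n y = exit_time n x" by simp
  next
    assume "fst (y n) = fst (x n) \<and> exit_time n y = exit_time n x"
    then show "\<forall>i\<in>{1..n}. y i = x i" using exit_time_inj[OF y x n] by blast
  qed
  then show ?thesis unfolding cylinder_def by blast
qed

lemma exit_time_eq_0_iff: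
  assumes x: "x \<in> paths B"
  shows "exit_time n x = 0 \<longleftrightarrow> (\<forall>m\<in>{1..n}. Suc (snd (x m)) = width m (fst (x m)))"
proof (induction n)
  case (Suc n)
  show ?case
  proof (cases "n = 0")
    case True
    then show ?thesis using pathsD(5)[OF x] by (auto simp: width_def)
  next
    case False
    let ?d = "drop (Suc (snd (x (Suc n)))) (W (Suc n) (fst (x (Suc n))))"
    have "sum_list (map (height n) ?d) = 0 \<longleftrightarrow> ?d = []"
    proof (cases ?d)
      case (Cons v vs)
      show ?thesis unfolding Cons using height_pos[of n v] by simp
    qed simp
    also have "\<dots> \<longleftrightarrow> Suc (snd (x (Suc n))) = width (Suc n) (fst (x (Suc n)))"
      using pathsD(2)[OF x, of "Suc n"] False by (auto simp: width_def)
    finally show ?thesis using Suc False by (auto simp: le_Suc_eq)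
  qed
qed simp

text \<open>Exit times count down towards the top of a tower, so the bottom floor carries the
  largest value.\<close>

lemma exit_time_bottom:
  assumes x: "x \<in> paths B" and n: "n \<ge> 1" and "\<forall>m\<in>{1..n}. snd (x m) = 0"
  shows "Suc (exit_time n x) = height n (fst (x n))"
  using n assms(3)
proof (induction n rule: dec_induct)
  case (step n)
  let ?w = "W (Suc n) (fst (x (Suc n)))"
  have s: "snd (x (Suc n)) = 0" using step by simp
  have "sum_list (map (height n) (drop 0 ?w)) = height n (fst (x n)) + sum_list (map (height n) (drop (Suc 0) ?w))"
    using sum_list_drop_nth[of 0 ?w "height n"] pathsD(3,4)[OF x step(1)] s by simp
  then show ?case using step s by simp
qed simp

lemma bottom_if_exit_time:
  assumes x: "x \<in> paths B" and n: "n \<ge> 1" and "Suc (exit_time n x) = height n (fst (x n))"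
  shows "\<forall>m\<in>{1..n}. snd (x m) = 0" "\<forall>m\<in>{1..<n}. fst (x m) = a"
proof -
  obtain y where y: "y \<in> paths B" "fst (y n) = fst (x n)" "\<forall>m\<in>{1..n}. snd (y m) = 0" "\<forall>m\<in>{1..<n}. fst (y m) = a"
    using bottom_path_exists[OF n] by blast
  have "exit_time n x = exit_time n y" using exit_time_bottom[OF y(1) n y(3)] y(2) assms(3) by simp
  then have "\<forall>m\<in>{1..n}. x m = y m" using y(2) by (intro exit_time_inj[OF x y(1) n]) auto
  then show "\<forall>m\<in>{1..n}. snd (x m) = 0" "\<forall>m\<in>{1..<n}. fst (x m) = a" using y by auto
qed

lemma max_path_iff: "max_path B x \<longleftrightarrow> x \<in> paths B \<and> (\<forall>n. exit_time n x = 0)"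
proof -
  have "(\<forall>n. exit_time n x = 0) \<longleftrightarrow> (\<forall>n\<ge>1. Suc (snd (x n)) = width n (fst (x n)))" if "x \<in> paths B"
    unfolding exit_time_eq_0_iff[OF that] by force
  then show ?thesis unfolding max_path_def by (auto simp: max_edge_word)
qed

lemma min_path_iff: "min_path B x \<longleftrightarrow> x \<in> paths B \<and> (\<forall>n\<ge>1. snd (x n) = 0)"
  unfolding min_path_def by (auto simp: min_edge_word)

text \<open>A maximal edge of level \<open>Suc n\<close> starts at the last letter of its word,
  which is always \<open>b\<close>, and a minimal one at \<open>a\<close>; the vertices of an
  extremal path are thereby fixed at every level.\<close>

lemma properly_ordered_word: "properly_ordered B"
proof -
  have "\<exists>!x. max_path B x"
  proof (rule ex1I)
    let ?x = "\<lambda>n. if n = 0 then undefined else (b, width n b - 1)"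
    have "?x \<in> paths B"
      unfolding paths_iff using width_pos by (auto simp: width_def word_nonempty intro!: word_last)
    moreover have "\<forall>n\<ge>1. Suc (snd (?x n)) = width n (fst (?x n))" using width_pos by simp
    ultimately show "max_path B ?x" unfolding max_path_def by (simp add: max_edge_word)
    fix x assume mx: "max_path B x"
    then have x: "x \<in> paths B" and m: "\<And>n. n \<ge> 1 \<Longrightarrow> Suc (snd (x n)) = width n (fst (x n))"
      unfolding max_path_def by (auto simp: max_edge_word)
    show "x = ?x"
    proof
      fix n
      show "x n = ?x n"
      proof (cases "n = 0")
        case True
        then show ?thesis using pathsD(1)[OF x] by simp
      next
        case False
        then have "fst (x n) = b"
          using pathsD(3)[OF x, of n] m[of "Suc n"] by (simp add: width_def word_last)
        then show ?thesis using m[of n] False by (auto intro!: prod_eqI)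
      qed
    qed
  qed
  moreover have "\<exists>!x. min_path B x"
  proof (rule ex1I)
    let ?x = "\<lambda>n::nat. if n = 0 then undefined else (a, 0::nat)"
    have "?x \<in> paths B"
      unfolding paths_iff using width_pos by (auto intro!: word_first)
    then show "min_path B ?x" unfolding min_path_iff by simp
    fix x assume mx: "min_path B x"
    then have x: "x \<in> paths B" and m: "\<And>n. n \<ge> 1 \<Longrightarrow> snd (x n) = 0"
      unfolding min_path_iff by auto
    show "x = ?x"
    proof
      fix n
      show "x n = ?x n"
      proof (cases "n = 0")
        case True
        then show ?thesis using pathsD(1)[OF x] by simp
      next
        case False
        then have "fst (x n) = a"
          using pathsD(3)[OF x, of n] m[of "Suc n"] by (simp add: word_first)
        then show ?thesis using m[of n] False by (auto intro!: prod_eqI)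
      qed
    qed
  qed
  ultimately show ?thesis unfolding properly_ordered_def by blast
qed

declare exit_time.simps(2) [simp del] height.simps(2) [simp del]

subsection \<open>The Vershik map\<close>

text \<open>The hypotheses say that \<open>Suc n\<close> is the first level with a non-maximal edge.
  The definite descriptions in \<open>vershik\<close> are evaluated here; the later arguments for
  non-maximal paths work through exit times.\<close>

lemma vershik_first_step:
  assumes x: "x \<in> paths B" and n: "n \<ge> 1" and top: "exit_time n x = 0" and nt: "exit_time (Suc n) x \<noteq> 0"
  shows "vershik B x \<in> paths B" and "m > Suc n \<Longrightarrow> vershik B x m = x m"
    and "vershik B x (Suc n) = (fst (x (Suc n)), Suc (snd (x (Suc n))))"
    and "\<forall>m\<in>{1..n}. snd (vershik B x m) = 0"
proof -
  obtain j q where jq: "x (Suc n) = (j, q)" by fastforce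
  have tops: "\<forall>m\<in>{1..n}. Suc (snd (x m)) = width m (fst (x m))"
    using top exit_time_eq_0_iff[OF x] by blast
  have "Suc q \<noteq> width (Suc n) j"
  proof
    assume "Suc q = width (Suc n) j"
    with tops have "\<forall>m\<in>{1..Suc n}. Suc (snd (x m)) = width m (fst (x m))"
      using jq by (auto simp: le_Suc_eq)
    then show False using nt exit_time_eq_0_iff[OF x, of "Suc n"] by argo
  qed
  then have q: "Suc q < width (Suc n) j"
    using pathsD(2)[OF x, of "Suc n"] jq by simp
  have least: "(LEAST k. k \<ge> 1 \<and> \<not> max_edge B k (x k)) = Suc n"
  proof (rule Least_equality)
    show "Suc n \<ge> 1 \<and> \<not> max_edge B (Suc n) (x (Suc n))" using q jq by (simp add: max_edge_word)
    fix k assume "k \<ge> 1 \<and> \<not> max_edge B k (x k)"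
    then show "Suc n \<le> k" using tops by (force simp: max_edge_word)
  qed
  have nmax: "\<not> max_path B x" using nt max_path_iff by metis
  define P where "P y \<longleftrightarrow> y \<in> paths B \<and> (\<forall>i\<in>{1..<Suc n}. min_edge B i (y i)) \<and>
                y (Suc n) = succ_edge B (Suc n) (x (Suc n)) \<and> (\<forall>i>Suc n. y i = x i)" for y
  have P_iff: "P y \<longleftrightarrow> y \<in> paths B \<and> (\<forall>i\<in>{1..n}. snd (y i) = 0) \<and>
                y (Suc n) = (j, Suc q) \<and> (\<forall>i>Suc n. y i = x i)" for y
    unfolding P_def jq succ_edge_word[OF _ q, simplified] by (auto simp: min_edge_word)
  obtain u where u: "u \<in> paths B" "fst (u n) = W (Suc n) j ! Suc q" "\<forall>m\<in>{1..n}. snd (u m) = 0"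
    using bottom_path_exists[OF n] by blast
  have lq: "Suc q < length (W (Suc n) j)" using q n by (simp add: width_def)
  let ?y = "splice n u (Suc q) x"
  have y: "P ?y" unfolding P_iff
    using splice_in_paths[OF x u(1) n] u lq jq by (auto simp: splice_def)
  \<comment> \<open>A minimal segment down from a given vertex is unique: it has the largest exit
    time of its tower, and exit times are injective.\<close>
  have "z = ?y" if z: "P z" for z
  proof (rule paths_eqI)
    show zp: "z \<in> paths B" and yp: "?y \<in> paths B" using z y unfolding P_iff by auto
    have "fst (z n) = fst (?y n)"
      using pathsD(3)[OF zp n] pathsD(3)[OF yp n] z y unfolding P_iff by simp
    moreover have "Suc (exit_time n z) = height n (fst (z n))" "Suc (exit_time n ?y) = height n (fst (?y n))"
      using z y n unfolding P_iff by (auto intro!: exit_time_bottom)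
    ultimately have "\<forall>m\<in>{1..n}. z m = ?y m" by (intro exit_time_inj[OF zp yp n]) auto
    then show "z m = ?y m" if "m \<ge> 1" for m
      using that z y unfolding P_iff
      by (cases m "Suc n" rule: linorder_cases) auto
  qed
  then have "(THE z. P z) = ?y" using y by (intro the_equality)
  then have "vershik B x = ?y"
    unfolding vershik_def Let_def least P_def by (simp only: nmax if_False)
  then show "vershik B x \<in> paths B" "m > Suc n \<Longrightarrow> vershik B x m = x m"
    "vershik B x (Suc n) = (fst (x (Suc n)), Suc (snd (x (Suc n))))"
    "\<forall>m\<in>{1..n}. snd (vershik B x m) = 0"
    using y jq unfolding P_iff by auto
qed

lemma exit_time_mono:
  assumes "m \<le> n" shows "exit_time m x \<le> exit_time n x"
  using assms by (induction n rule: dec_induct) (auto simp: exit_time.simps)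

lemma first_level:
  assumes "exit_time n x \<noteq> 0"
  obtains k where "k \<ge> 1" "Suc k \<le> n" "exit_time k x = 0" "exit_time (Suc k) x \<noteq> 0"
proof -
  define k where "k = (LEAST k. exit_time k x \<noteq> 0)"
  have k: "exit_time k x \<noteq> 0" "k \<le> n" using assms unfolding k_def by (auto intro: LeastI Least_le)
  then obtain l where l: "k = Suc l" by (cases k) auto
  have "exit_time l x = 0" using not_less_Least[of l "\<lambda>k. exit_time k x \<noteq> 0"] l unfolding k_def by auto
  moreover have "l \<ge> 1" using k l by (cases l) (auto simp: exit_time.simps)
  ultimately show thesis using that k l by blast
qed

text \<open>As long as a path is not on the top floor of its tower of level \<open>n\<close>, the
  map moves it up by one floor of that tower and does not touch the levels above.\<close>

lemma vershik_climb:
  assumes x: "x \<in> paths B" and nt: "exit_time n x \<noteq> 0"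
  shows "vershik B x \<in> paths B" and "m > n \<Longrightarrow> vershik B x m = x m"
    and "fst (vershik B x n) = fst (x n)" and "Suc (exit_time n (vershik B x)) = exit_time n x"
proof -
  obtain k where k: "k \<ge> 1" "Suc k \<le> n" "exit_time k x = 0" "exit_time (Suc k) x \<noteq> 0"
    using first_level[OF nt] by blast
  note s = vershik_first_step[OF x k(1,3,4)]
  show "vershik B x \<in> paths B" by (rule s(1))
  show "m > n \<Longrightarrow> vershik B x m = x m" using s(2) k by simp
  show "fst (vershik B x n) = fst (x n)" using s(2)[of n] s(3) k(2) by (cases "n = Suc k") auto
  show "Suc (exit_time n (vershik B x)) = exit_time n x"
    using k(2)
  proof (induction n rule: dec_induct)
    case base
    \<comment> \<open>The carry: moving to the next letter removes its full height from the suffix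
      sum, and starting at the bottom of its tower gives back that height minus one.\<close>
    let ?w = "W (Suc k) (fst (x (Suc k)))" and ?q = "snd (x (Suc k))"
    have "Suc ?q < length ?w"
      using pathsD(4)[OF s(1) k(1)] s(3) by simp
    moreover have "Suc (exit_time k (vershik B x)) = height k (fst (vershik B x k))"
      using s(1,4) k(1) by (intro exit_time_bottom) auto
    moreover have "fst (vershik B x k) = ?w ! Suc ?q"
      using pathsD(3)[OF s(1) k(1)] s(3) by simp
    ultimately show ?case
      using s(3) k(1,3) sum_list_drop_nth[of "Suc ?q" ?w "height k"] by (simp add: exit_time.simps)
  next
    case (step m)
    then show ?case using s(2)[of "Suc m"] by (simp add: exit_time.simps)
  qed
qed

lemma vershik_max:
  assumes x: "max_path B x"
  shows "min_path B (vershik B x)"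
proof -
  have "vershik B x = (THE y. min_path B y)" using x by (simp add: vershik_def)
  then show ?thesis using properly_ordered_word theI'[of "min_path B"]
    unfolding properly_ordered_def by simp
qed

lemma vershik_in_paths:
  assumes x: "x \<in> paths B" shows "vershik B x \<in> paths B"
proof (cases "max_path B x")
  case True
  then show ?thesis using vershik_max min_path_def by blast
next
  case False
  then obtain n where "exit_time n x \<noteq> 0" using x by (auto simp: max_path_iff)
  then show ?thesis by (rule vershik_climb(1)[OF x])
qed

text \<open>If the tower of level \<open>n\<close> is exhausted, the first non-maximal edge lies
  above \<open>n\<close>, or there is none; in both cases all edges up to \<open>n\<close> are reset
  to minimal ones.\<close>

lemma vershik_top:
  assumes x: "x \<in> paths B" and n: "n \<ge> 1" and top: "exit_time n x = 0"
  shows "Suc (exit_time n (vershik B x)) = height n (fst (vershik B x n))"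
proof (rule exit_time_bottom[OF vershik_in_paths[OF x] n])
  show "\<forall>m\<in>{1..n}. snd (vershik B x m) = 0"
  proof (cases "max_path B x")
    case True
    then show ?thesis using vershik_max unfolding min_path_iff by auto
  next
    case False
    then obtain N where "exit_time N x \<noteq> 0" using x by (auto simp: max_path_iff)
    then obtain k where k: "k \<ge> 1" "Suc k \<le> N" "exit_time k x = 0" "exit_time (Suc k) x \<noteq> 0"
      using first_level by blast
    have "n \<le> k" using k(4) top exit_time_mono[of "Suc k" n x] by (metis not_less_eq_eq le_0_eq)
    then show ?thesis using vershik_first_step(4)[OF x k(1,3,4)] by auto
  qed
qed

lemma vershik_funpow_in_paths: "x \<in> paths B \<Longrightarrow> (vershik B ^^ d) x \<in> paths B"
  by (induction d) (auto intro: vershik_in_paths)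

lemma vershik_funpow:
  assumes "x \<in> paths B" "y \<in> paths B" "n \<ge> 1" "fst (x n) = fst (y n)" "\<forall>m>n. x m = y m"
    "exit_time n x = exit_time n y + d"
  shows "(vershik B ^^ d) x = y"
  using assms
proof (induction d arbitrary: x)
  case 0
  have "x = y"
  proof (rule paths_eqI[OF 0(1,2)])
    show "x m = y m" if "m \<ge> 1" for m
      using exit_time_inj[OF 0(1-4)] 0(5,6) that by (cases "m \<le> n") auto
  qed
  then show ?case by simp
next
  case (Suc d)
  have nt: "exit_time n x \<noteq> 0" using Suc.prems by simp
  note v = vershik_climb[OF Suc.prems(1) nt]
  have "(vershik B ^^ d) (vershik B x) = y"
    using v Suc.prems by (intro Suc.IH) auto
  then show ?case by (simp add: funpow_swap1)
qed

lemma same_tail_orbit: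
  assumes "x \<in> paths B" "y \<in> paths B" "n \<ge> 1" "fst (x n) = fst (y n)" "\<forall>m>n. x m = y m"
  shows "\<exists>d. (vershik B ^^ d) x = y \<or> (vershik B ^^ d) y = x"
proof (cases "exit_time n x \<ge> exit_time n y")
  case True
  then show ?thesis using vershik_funpow[OF assms, of "exit_time n x - exit_time n y"] by auto
next
  case False
  then have "(vershik B ^^ (exit_time n y - exit_time n x)) y = x"
    using assms by (intro vershik_funpow[of _ _ n]) auto
  then show ?thesis by blast
qed

lemma vershik_inj: "inj_on (vershik B) (paths B)"
proof (rule inj_onI)
  fix x y assume x: "x \<in> paths B" and y: "y \<in> paths B" and eq: "vershik B x = vershik B y"
  \<comment> \<open>The image of a maximal path is on the bottom floor of every tower, whereas a
    path that climbs inside some tower lands strictly above its bottom floor.\<close>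
  have *: "max_path B v" if uv: "u \<in> paths B" "v \<in> paths B" "vershik B u = vershik B v" "max_path B u" for u v
  proof (rule ccontr)
    assume "\<not> max_path B v"
    then obtain n where n: "exit_time n v \<noteq> 0" using uv(2) by (auto simp: max_path_iff)
    then have n1: "n \<ge> 1" by (cases n) auto
    note c = vershik_climb[OF uv(2) n]
    have "Suc (exit_time n (vershik B u)) = height n (fst (vershik B u n))"
      using uv(1,4) by (intro vershik_top[OF _ n1]) (auto simp: max_path_iff)
    then show False using c(3,4) exit_time_less[OF uv(2) n1] uv(3) by simp
  qed
  show "x = y"
  proof (cases "max_path B x")
    case True
    then have "max_path B y" using * x y eq by blast
    then show ?thesis using True properly_ordered_word unfolding properly_ordered_def by blast
  next
    case False
    then have "\<not> max_path B y" using * x y eq by metis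
    with False obtain n n' where n: "exit_time n x \<noteq> 0" "exit_time n' y \<noteq> 0"
      using x y by (auto simp: max_path_iff)
    define N where "N = max n n'"
    have N: "exit_time N x \<noteq> 0" "exit_time N y \<noteq> 0"
      using n exit_time_mono[of n N x] exit_time_mono[of n' N y] by (auto simp: N_def)
    have N1: "N \<ge> 1" using N by (cases N) auto
    note cx = vershik_climb[OF x N(1)] and cy = vershik_climb[OF y N(2)]
    have "(vershik B ^^ 0) x = y"
      using cx cy eq x y N1 by (intro vershik_funpow[of _ _ N]) auto
    then show ?thesis by simp
  qed
qed

lemma vershik_surj: "vershik B ` paths B = paths B"
proof
  show "vershik B ` paths B \<subseteq> paths B" using vershik_in_paths by blast
  show "paths B \<subseteq> vershik B ` paths B"
  proof
    fix y assume y: "y \<in> paths B"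
    show "y \<in> vershik B ` paths B"
    proof (cases "min_path B y")
      case True
      obtain x where x: "max_path B x" using properly_ordered_word unfolding properly_ordered_def by blast
      then have "min_path B (vershik B x)" by (rule vershik_max)
      then have "vershik B x = y"
        using True properly_ordered_word unfolding properly_ordered_def by blast
      then show ?thesis using x unfolding max_path_def by blast
    next
      case False
      then obtain n where n: "n \<ge> 1" "snd (y n) \<noteq> 0" using y by (auto simp: min_path_iff)
      \<comment> \<open>A non-minimal edge at level \<open>n\<close> means that \<open>y\<close> is
        not on the bottom floor there, so the floor just below it exists and contains the
        preimage.\<close>
      have "Suc (exit_time n y) \<noteq> height n (fst (y n))"
        using bottom_if_exit_time(1)[OF y n(1)] n by force
      then have "Suc (exit_time n y) < height n (fst (y n))"
        using exit_time_less[OF y n(1)] by simp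
      then obtain x where x: "x \<in> paths B" "fst (x n) = fst (y n)" "\<forall>m>n. x m = y m"
        "exit_time n x = Suc (exit_time n y)"
        using exit_time_exists[OF n(1) y] by blast
      then have "(vershik B ^^ 1) x = y" using y n(1) by (intro vershik_funpow[of _ _ n]) auto
      then show ?thesis using x(1) by auto
    qed
  qed
qed

end

section \<open>Topology of the path space\<close>

lemma cylinder_subset: "cylinder B x n \<subseteq> paths B"
  by (auto simp: cylinder_def)

lemma cylinder_self: "x \<in> paths B \<Longrightarrow> x \<in> cylinder B x n"
  by (auto simp: cylinder_def)

lemma cylinder_cong: "y \<in> cylinder B x n \<Longrightarrow> cylinder B y n = cylinder B x n"
  by (auto simp: cylinder_def)

lemma cylinder_antimono: "m \<le> n \<Longrightarrow> cylinder B x n \<subseteq> cylinder B x m"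
  by (auto simp: cylinder_def)

lemma topspace_path_space [simp]: "topspace (path_space B) = paths B"
  unfolding path_space_def topology_generated_by_topspace
  using cylinder_subset cylinder_self by fastforce

text \<open>Two cylinders are nested or disjoint, so the generating family is already a base, and
  the cylinders around \<open>x\<close> are neighbourhoods that shrink with
  \<open>n\<close>.\<close>

lemma openin_path_space:
  "openin (path_space B) U \<longleftrightarrow> U \<subseteq> paths B \<and> (\<forall>x\<in>U. \<exists>n. cylinder B x n \<subseteq> U)"
proof
  let ?C = "{cylinder B x n |x n. x \<in> paths B}"
  assume U: "openin (path_space B) U"
  then have "generate_topology_on ?C U"
    unfolding path_space_def by (rule openin_topology_generated_by)
  then have "\<forall>x\<in>U. \<exists>n. cylinder B x n \<subseteq> U"
  proof (induction rule: generate_topology_on.induct)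
    case (Int U V)
    show ?case
    proof
      fix x assume "x \<in> U \<inter> V"
      then obtain m n where "cylinder B x m \<subseteq> U" "cylinder B x n \<subseteq> V" using Int by blast
      then have "cylinder B x (max m n) \<subseteq> U \<inter> V"
        using cylinder_antimono[of m "max m n" B x] cylinder_antimono[of n "max m n" B x] by auto
      then show "\<exists>n. cylinder B x n \<subseteq> U \<inter> V" by blast
    qed
  next
    case (UN K)
    then show ?case by (meson Sup_upper UnionE subset_trans)
  next
    case (Basis s)
    then show ?case using cylinder_cong by fastforce
  qed simp
  then show "U \<subseteq> paths B \<and> (\<forall>x\<in>U. \<exists>n. cylinder B x n \<subseteq> U)"
    using openin_subset[OF U] by simp
next
  assume U: "U \<subseteq> paths B \<and> (\<forall>x\<in>U. \<exists>n. cylinder B x n \<subseteq> U)"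
  then obtain f where f: "\<And>x. x \<in> U \<Longrightarrow> cylinder B x (f x) \<subseteq> U" by metis
  have "U = (\<Union>x\<in>U. cylinder B x (f x))"
    using U f cylinder_self[of _ B] by blast
  moreover have "openin (path_space B) (cylinder B x n)" if "x \<in> paths B" for x n
    unfolding path_space_def using that by (intro topology_generated_by_Basis) blast
  then have "openin (path_space B) (\<Union>x\<in>U. cylinder B x (f x))"
    using U by (intro openin_Union) auto
  ultimately show "openin (path_space B) U"
    by simp
qed

lemma openin_cylinder: "openin (path_space B) (cylinder B x n)"
  unfolding openin_path_space using cylinder_subset cylinder_cong by fastforce

lemma closedin_cylinder: "closedin (path_space B) (cylinder B x n)"
proof -
  have "cylinder B y n \<subseteq> paths B - cylinder B x n" if "y \<in> paths B - cylinder B x n" for y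
    using that by (auto simp: cylinder_def)
  then show ?thesis unfolding closedin_def openin_path_space using cylinder_subset by fastforce
qed

text \<open>Gives access to Tychonoff compactness and to metrizability of countable products;
  \<open>closedin_paths\<close> adds that the subspace is closed, being cut out by conditions on two
  consecutive coordinates.\<close>

lemma path_space_eq_subtopology:
  "path_space B = subtopology (product_topology (\<lambda>n. discrete_topology (edges B n)) {1..}) (paths B)"
    (is "_ = subtopology ?P _")
  unfolding topology_eq
proof (intro allI iffI)
  fix U assume U: "openin (path_space B) U"
  then obtain f where f: "\<And>x. x \<in> U \<Longrightarrow> cylinder B x (f x) \<subseteq> U"
    unfolding openin_path_space by metis
  have Up: "U \<subseteq> paths B" using U unfolding openin_path_space by simp
  define O' where "O' x = (\<Pi>\<^sub>E i\<in>{1::nat..}. if i \<le> f x then {x i} else edges B i)" for x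
  have O': "O' x \<inter> paths B = cylinder B x (f x)" for x
    unfolding O'_def cylinder_def paths_def by (auto simp: PiE_iff extensional_def split: if_splits)
  have "openin ?P (O' x)" if "x \<in> U" for x
  proof -
    have "finite {i \<in> {1..}. (if i \<le> f x then {x i} else edges B i) \<noteq> edges B i}"
      by (rule finite_subset[of _ "{..f x}"]) auto
    moreover have "x i \<in> edges B i" if "i \<ge> 1" for i
      using \<open>x \<in> U\<close> Up that unfolding paths_def by (auto simp: PiE_iff)
    ultimately show ?thesis unfolding O'_def openin_PiE_gen by auto
  qed
  then have "openin ?P (\<Union>x\<in>U. O' x)" by auto
  moreover have "U = (\<Union>x\<in>U. O' x) \<inter> paths B"
    using O' f cylinder_self[of _ B] Up by (auto simp: set_eq_iff) blast+
  ultimately show "openin (subtopology ?P (paths B)) U" unfolding openin_subtopology by blast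
next
  fix U assume "openin (subtopology ?P (paths B)) U"
  then obtain S where S: "openin ?P S" "U = S \<inter> paths B" unfolding openin_subtopology by blast
  have "\<exists>n. cylinder B x n \<subseteq> U" if x: "x \<in> U" for x
  proof -
    have "x \<in> S" using x S by simp
    then obtain V where V: "finite {i \<in> {1..}. V i \<noteq> edges B i}" "x \<in> PiE {1..} V" "PiE {1..} V \<subseteq> S"
      using S(1) unfolding openin_product_topology_alt by force
    obtain n where n: "\<forall>i\<in>{i \<in> {1..}. V i \<noteq> edges B i}. i \<le> n" using V(1) finite_nat_set_iff_bounded_le by blast
    have "cylinder B x n \<subseteq> U"
    proof
      fix y assume y: "y \<in> cylinder B x n"
      then have yp: "y \<in> paths B" by (simp add: cylinder_def)
      have "y i \<in> V i" if "i \<ge> 1" for i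
      proof (cases "i \<le> n")
        case True
        then show ?thesis using y V(2) that by (auto simp: cylinder_def PiE_iff)
      next
        case False
        then have "V i = edges B i"
          using n that by (metis (mono_tags, lifting) atLeast_iff mem_Collect_eq)
        then show ?thesis using yp that unfolding paths_def by (auto simp: PiE_iff)
      qed
      then have "y \<in> PiE {1..} V" using yp unfolding paths_def by (auto simp: PiE_iff)
      then show "y \<in> U" using V(3) S(2) yp by auto
    qed
    then show ?thesis by blast
  qed
  then show "openin (path_space B) U" using S(2) unfolding openin_path_space by auto
qed

lemma closedin_paths:
  "closedin (product_topology (\<lambda>n. discrete_topology (edges B n)) {1..}) (paths B)"
    (is "closedin ?P _")
proof -
  let ?X = "\<Pi>\<^sub>E n\<in>{1..}. edges B n"
  define G where "G n = (\<Pi>\<^sub>E i\<in>{1..}. edges B i) \<inter> {x. endpoint B n (x n) \<noteq> initial B (Suc n) (x (Suc n))}" for n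
  have "openin ?P (G n)" if n: "n \<ge> 1" for n
  proof -
    have "\<exists>U. finite {i \<in> {1..}. U i \<noteq> edges B i} \<and> (\<forall>i\<in>{1..}. U i \<subseteq> edges B i) \<and> x \<in> PiE {1..} U \<and> PiE {1..} U \<subseteq> G n"
      if x: "x \<in> G n" for x
    proof (intro exI conjI)
      let ?U = "\<lambda>i. if i = n \<or> i = Suc n then {x i} else edges B i"
      show "finite {i \<in> {1..}. ?U i \<noteq> edges B i}"
        by (rule finite_subset[of _ "{n, Suc n}"]) auto
      have xi: "x i \<in> edges B i" if "i \<ge> 1" for i
        using x that unfolding G_def by (auto simp: PiE_iff)
      then show "\<forall>i\<in>{1..}. ?U i \<subseteq> edges B i" using n by auto
      show "x \<in> PiE {1..} ?U" using x unfolding G_def by (auto simp: PiE_iff)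
      show "PiE {1..} ?U \<subseteq> G n"
      proof
        fix y assume y: "y \<in> PiE {1..} ?U"
        have "y i \<in> edges B i" if "i \<ge> 1" for i
          using PiE_mem[OF y, of i] xi[OF that] that by (auto split: if_splits)
        moreover have "y n = x n" "y (Suc n) = x (Suc n)"
          using PiE_mem[OF y, of n] PiE_mem[OF y, of "Suc n"] n by auto
        ultimately show "y \<in> G n" using x y unfolding G_def by (auto simp: PiE_iff)
      qed
    qed
    then show ?thesis unfolding openin_product_topology_alt by simp
  qed
  then have "openin ?P (\<Union>n\<in>{1..}. G n)" by auto
  moreover have "?X - paths B = (\<Union>n\<in>{1..}. G n)"
    unfolding paths_def G_def by auto
  moreover have "paths B \<subseteq> ?X" unfolding paths_def by blast
  ultimately show ?thesis unfolding closedin_def by simp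
qed

lemma
  assumes B: "ordered_bratteli_diagram B"
  shows compact_path_space: "compact_space (path_space B)"
    and metrizable_path_space: "metrizable_space (path_space B)"
proof -
  let ?P = "product_topology (\<lambda>n. discrete_topology (edges B n)) {1..}"
  have fin: "finite (edges B n)" "edges B n \<noteq> {}" if "n \<ge> 1" for n
    using B that unfolding ordered_bratteli_diagram_def by (auto, metis image_empty)
  have "compact_space ?P"
    unfolding compact_space_product_topology using fin by (simp add: compact_space_discrete_topology)
  then show "compact_space (path_space B)"
    unfolding path_space_eq_subtopology
    using closedin_compact_space closedin_paths compact_space_subtopology by blast
  have "topspace ?P \<noteq> {}" using fin by (auto simp: PiE_eq_empty_iff)
  then have "metrizable_space ?P" by (rule metrizable_topology_D) auto
  then show "metrizable_space (path_space B)"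
    unfolding path_space_eq_subtopology by (rule metrizable_space_subtopology)
qed

lemma countable_cylinders:
  assumes B: "ordered_bratteli_diagram B"
  shows "countable {cylinder B x n |x n. x \<in> paths B}"
proof -
  have "finite {cylinder B x n |x. x \<in> paths B}" for n
  proof -
    have "finite (\<Pi>\<^sub>E i\<in>{1..n}. edges B i)"
      using B unfolding ordered_bratteli_diagram_def by (intro finite_PiE) auto
    moreover have "{cylinder B x n |x. x \<in> paths B} \<subseteq> (\<lambda>x. cylinder B x n) ` (\<Pi>\<^sub>E i\<in>{1..n}. edges B i)"
    proof
      fix C assume "C \<in> {cylinder B x n |x. x \<in> paths B}"
      then obtain x where x: "x \<in> paths B" "C = cylinder B x n" by blast
      have "C = cylinder B (restrict x {1..n}) n" using x(2) by (auto simp: cylinder_def)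
      moreover have "restrict x {1..n} \<in> (\<Pi>\<^sub>E i\<in>{1..n}. edges B i)"
        using x(1) unfolding paths_def by (auto simp: PiE_iff)
      ultimately show "C \<in> (\<lambda>x. cylinder B x n) ` (\<Pi>\<^sub>E i\<in>{1..n}. edges B i)" by blast
    qed
    ultimately show ?thesis by (meson finite_imageI finite_subset)
  qed
  then have "countable (\<Union>n. {cylinder B x n |x. x \<in> paths B})"
    by (intro countable_UN) (auto intro: countable_finite)
  moreover have "(\<Union>n. {cylinder B x n |x. x \<in> paths B}) = {cylinder B x n |x n. x \<in> paths B}" by blast
  ultimately show ?thesis by simp
qed

lemma cylinder_base:
  assumes "openin (path_space B) U" "x \<in> U"
  shows "\<exists>V\<in>{cylinder B x n |x n. x \<in> paths B}. x \<in> V \<and> V \<subseteq> U"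
proof -
  obtain n where "cylinder B x n \<subseteq> U" "x \<in> paths B"
    using assms unfolding openin_path_space by blast
  then show ?thesis
    by (intro bexI[of _ "cylinder B x n"]) (auto intro: cylinder_self)
qed

lemma cantor_path_space:
  assumes B: "ordered_bratteli_diagram B" and ne: "paths B \<noteq> {}"
    and branch: "\<And>x n. x \<in> paths B \<Longrightarrow> cylinder B x n \<noteq> {x}"
  shows "cantor_space (path_space B)"
  unfolding cantor_space_def
proof (intro conjI)
  show "topspace (path_space B) \<noteq> {}" using ne by simp
  show "compact_space (path_space B)" "metrizable_space (path_space B)"
    using B by (rule compact_path_space, rule metrizable_path_space)
  show "\<exists>\<B>. countable \<B> \<and> (\<forall>V\<in>\<B>. openin (path_space B) V \<and> closedin (path_space B) V) \<and>
          (\<forall>U x. openin (path_space B) U \<and> x \<in> U \<longrightarrow> (\<exists>V\<in>\<B>. x \<in> V \<and> V \<subseteq> U))"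
  proof (intro exI conjI ballI allI impI)
    show "countable {cylinder B x n |x n. x \<in> paths B}" by (rule countable_cylinders[OF B])
    fix V assume "V \<in> {cylinder B x n |x n. x \<in> paths B}"
    then show "openin (path_space B) V" "closedin (path_space B) V"
      using openin_cylinder closedin_cylinder by auto
  next
    fix U x assume "openin (path_space B) U \<and> x \<in> U"
    then show "\<exists>V\<in>{cylinder B x n |x n. x \<in> paths B}. x \<in> V \<and> V \<subseteq> U"
      using cylinder_base by blast
  qed
  show "\<forall>x\<in>topspace (path_space B). \<not> openin (path_space B) {x}"
  proof (intro ballI notI)
    fix x assume x: "x \<in> topspace (path_space B)" and "openin (path_space B) {x}"
    then obtain n where "cylinder B x n \<subseteq> {x}" unfolding openin_path_space by blast
    moreover have "x \<in> paths B" using x by simp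
    ultimately show False using branch cylinder_self by blast
  qed
qed

text \<open>Each open set is the union of the countably many basic sets inside it. The generating
  family may be larger than the base; it is taken to be the cylinders for uniqueness of measures,
  and all clopen sets for their extension.\<close>

lemma sets_borel_of_base:
  assumes "countable \<B>" and "\<B> \<subseteq> \<G>" and open_G: "\<And>U. U \<in> \<G> \<Longrightarrow> openin X U"
    and base: "\<And>U x. openin X U \<Longrightarrow> x \<in> U \<Longrightarrow> \<exists>V\<in>\<B>. x \<in> V \<and> V \<subseteq> U"
  shows "sets (borel_of X) = sigma_sets (topspace X) \<G>"
proof -
  have "sigma_sets (topspace X) {U. openin X U} = sigma_sets (topspace X) \<G>"
  proof (rule sigma_sets_eqI)
    fix U assume "U \<in> {U. openin X U}"
    then have U: "openin X U" by simp
    let ?D = "{V \<in> \<B>. V \<subseteq> U}"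
    have "U = \<Union>?D" using base[OF U] by blast
    moreover have "countable ?D" by (rule countable_subset[OF _ assms(1)]) auto
    then have "\<Union>?D \<in> sigma_sets (topspace X) \<G>"
    proof (rule sigma_algebra.countable_Union[rotated])
      show "sigma_algebra (topspace X) (sigma_sets (topspace X) \<G>)"
        using open_G openin_subset by (intro sigma_algebra_sigma_sets) blast
    qed (use assms(2) in auto)
    ultimately show "U \<in> sigma_sets (topspace X) \<G>" by simp
  qed (use open_G in auto)
  then show ?thesis unfolding borel_of_def using openin_subset by (subst sets_measure_of) auto
qed

lemma sets_borel_of_path_space:
  assumes "ordered_bratteli_diagram B"
  shows "sets (borel_of (path_space B)) =
    sigma_sets (paths B) (insert {} {cylinder B x n |x n. x \<in> paths B})"
  unfolding topspace_path_space[symmetric]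
  using countable_cylinders[OF assms] cylinder_base openin_cylinder
  by (intro sets_borel_of_base[of "{cylinder B x n |x n. x \<in> paths B}"]) auto

lemma Int_stable_cylinders: "Int_stable (insert {} {cylinder B x n |x n. x \<in> paths B})"
proof (rule Int_stableI)
  have *: "cylinder B x m \<inter> cylinder B y n \<in> insert {} {cylinder B x n |x n. x \<in> paths B}"
    if "m \<le> n" "y \<in> paths B" for x y m n
  proof (cases "cylinder B x m \<inter> cylinder B y n = {}")
    case False
    then obtain z where "z \<in> cylinder B x m" "z \<in> cylinder B y n" by blast
    then have "cylinder B y n \<subseteq> cylinder B x m"
      using cylinder_cong cylinder_antimono[OF that(1)] by metis
    then have "cylinder B x m \<inter> cylinder B y n = cylinder B y n" by blast
    then show ?thesis using that(2) by blast
  qed simp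
  fix C D assume "C \<in> insert {} {cylinder B x n |x n. x \<in> paths B}"
    "D \<in> insert {} {cylinder B x n |x n. x \<in> paths B}"
  then consider "C = {} \<or> D = {}" | x y m n where "x \<in> paths B" "y \<in> paths B" "C = cylinder B x m" "D = cylinder B y n"
    by blast
  then show "C \<inter> D \<in> insert {} {cylinder B x n |x n. x \<in> paths B}"
  proof cases
    case (2 x y m n)
    then show ?thesis using *[of m n y x] *[of n m x y] by (metis Int_commute nat_le_linear)
  qed auto
qed

context proper_words
begin

lemma paths_nonempty: "paths B \<noteq> {}"
  using path_through[of 1] by blast

text \<open>Keep \<open>x\<close> up to level \<open>Suc n\<close> and continue through another
  vertex one level higher; the word of that vertex contains the letter needed for gluing.\<close>

lemma cylinder_not_singleton:
  assumes x: "x \<in> paths B"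
  shows "cylinder B x n \<noteq> {x}"
proof -
  let ?m = "Suc (Suc n)"
  obtain v where v: "v \<noteq> fst (x ?m)" using first_neq_last by metis
  obtain y where y: "y \<in> paths B" "fst (y ?m) = v" using path_through[of ?m v] by auto
  obtain q where q: "q < length (W ?m v)" "W ?m v ! q = fst (x (Suc n))"
    using letter_position[of ?m v] by auto
  let ?z = "splice (Suc n) x q y"
  have "?z \<in> paths B" using q y by (intro splice_in_paths[OF y(1) x]) auto
  then have "?z \<in> cylinder B x n" by (auto simp: cylinder_def splice_def)
  moreover have "fst (?z ?m) \<noteq> fst (x ?m)" using y v by (simp add: splice_def)
  ultimately show ?thesis by (metis singletonD)
qed

lemma cantor_space_word: "cantor_space (path_space B)"
  using ordered_bratteli_diagram_word paths_nonempty cylinder_not_singleton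
  by (rule cantor_path_space)

lemma vershik_cylinder:
  assumes x: "x \<in> paths B"
  shows "\<exists>m. \<forall>y\<in>cylinder B x m. vershik B y \<in> cylinder B (vershik B x) n"
proof (cases "max_path B x")
  case True
  have bx: "min_path B (vershik B x)" using True by (rule vershik_max)
  \<comment> \<open>Near the maximal path, the image lands on a bottom floor of level
    \<open>Suc n\<close>. Such a floor determines vertices only strictly below its level, hence a
    level beyond \<open>n\<close>; those vertices are all \<open>a\<close>, as for the minimal
    path.\<close>
  have "vershik B y \<in> cylinder B (vershik B x) n" if y: "y \<in> cylinder B x (Suc (Suc n))" for y
  proof -
    have yp: "y \<in> paths B" using y by (simp add: cylinder_def)
    have "exit_time (Suc n) y = exit_time (Suc n) x"
      using y by (intro exit_time_cong) (auto simp: cylinder_def)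
    then have "exit_time (Suc n) y = 0" using True by (simp only: max_path_iff)
    then have "Suc (exit_time (Suc n) (vershik B y)) = height (Suc n) (fst (vershik B y (Suc n)))"
      by (rule vershik_top[OF yp, rotated]) simp
    note bot = bottom_if_exit_time[OF vershik_in_paths[OF yp] _ this]
    have vx: "vershik B x \<in> paths B" by (rule vershik_in_paths[OF x])
    have "vershik B x m = (a, 0)" if "m \<ge> 1" for m
    proof -
      have "fst (vershik B x m) = a"
        using pathsD(3)[OF vx that] bx[unfolded min_path_iff] word_first[of "Suc m"] that by simp
      then show ?thesis using bx[unfolded min_path_iff] that by (auto intro: prod_eqI)
    qed
    then show ?thesis using bot vershik_in_paths[OF yp]
      by (auto simp: cylinder_def intro!: prod_eqI)
  qed
  then show ?thesis by blast
next
  case False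
  then obtain N where "exit_time N x \<noteq> 0" using x by (auto simp: max_path_iff)
  then obtain k where k: "k \<ge> 1" "exit_time k x = 0" "exit_time (Suc k) x \<noteq> 0"
    using first_level by blast
  define m where "m = max n (Suc k)"
  have m: "exit_time m x \<noteq> 0" "m \<ge> 1"
    using k(3) exit_time_mono[of "Suc k" m x] by (auto simp: m_def simp del: exit_time.simps)
  have "vershik B y \<in> cylinder B (vershik B x) n" if y: "y \<in> cylinder B x m" for y
  proof -
    have yp: "y \<in> paths B" using y by (simp add: cylinder_def)
    have e: "exit_time m y = exit_time m x"
      using y by (intro exit_time_cong) (auto simp: cylinder_def)
    have "fst (y m) = fst (x m)" using y m(2) by (simp add: cylinder_def)
    then have "\<forall>i\<in>{1..m}. vershik B y i = vershik B x i"
      using vershik_climb[OF x m(1)] vershik_climb[OF yp, of m] e m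
      by (intro exit_time_inj) simp_all
    then show ?thesis using vershik_in_paths[OF yp] unfolding cylinder_def m_def by auto
  qed
  then show ?thesis by blast
qed

lemma continuous_vershik: "continuous_map (path_space B) (path_space B) (vershik B)"
  unfolding continuous_map_def
proof (intro conjI allI impI)
  show "vershik B \<in> topspace (path_space B) \<rightarrow> topspace (path_space B)" using vershik_in_paths by simp
  fix U assume U: "openin (path_space B) U"
  show "openin (path_space B) {x \<in> topspace (path_space B). vershik B x \<in> U}"
    unfolding openin_path_space
  proof (intro conjI ballI)
    fix x assume "x \<in> {x \<in> topspace (path_space B). vershik B x \<in> U}"
    then have x: "x \<in> paths B" "vershik B x \<in> U" by auto
    then obtain n where n: "cylinder B (vershik B x) n \<subseteq> U" using U unfolding openin_path_space by blast
    obtain m where "\<forall>y\<in>cylinder B x m. vershik B y \<in> cylinder B (vershik B x) n"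
      using vershik_cylinder[OF x(1)] by blast
    then show "\<exists>m. cylinder B x m \<subseteq> {x \<in> topspace (path_space B). vershik B x \<in> U}"
      using n cylinder_subset by (intro exI[of _ m]) force
  qed auto
qed

lemma homeomorphic_vershik: "homeomorphic_map (path_space B) (path_space B) (vershik B)"
  using ordered_bratteli_diagram_word vershik_inj vershik_surj
  by (intro continuous_imp_homeomorphic_map continuous_vershik compact_path_space
      metrizable_imp_Hausdorff_space metrizable_path_space) auto

text \<open>The initial segment of \<open>y\<close> is glued below the tail of \<open>x\<close>, and
  paths with a common tail lie in one orbit. This is density of orbits.\<close>

lemma orbit_meets_cylinder:
  assumes x: "x \<in> paths B" and y: "y \<in> paths B"
  shows "orbit_of (path_space B) (vershik B) x \<inter> cylinder B y n \<noteq> {}"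
proof -
  let ?m = "Suc (Suc n)"
  obtain q where q: "q < length (W ?m (fst (x ?m)))" "W ?m (fst (x ?m)) ! q = fst (y (Suc n))"
    using letter_position[of ?m "fst (x ?m)"] by auto
  let ?z = "splice (Suc n) y q x"
  have z: "?z \<in> paths B" using q by (intro splice_in_paths[OF x y]) auto
  moreover have "?z \<in> cylinder B y n" using z by (auto simp: cylinder_def splice_def)
  moreover have "\<exists>d. (vershik B ^^ d) x = ?z \<or> (vershik B ^^ d) ?z = x"
    by (rule same_tail_orbit[OF x z, of ?m]) (auto simp: splice_def)
  ultimately show ?thesis unfolding orbit_of_def by auto
qed

lemma cantor_minimal_word: "cantor_minimal_system (path_space B) (vershik B)"
  unfolding cantor_minimal_system_def
proof (intro conjI ballI cantor_space_word homeomorphic_vershik)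
  fix x assume x: "x \<in> topspace (path_space B)"
  show "path_space B closure_of orbit_of (path_space B) (vershik B) x = topspace (path_space B)"
    unfolding dense_intersects_open
  proof (intro allI impI, elim conjE)
    fix U assume U: "openin (path_space B) U" "U \<noteq> {}"
    then obtain y n where y: "y \<in> paths B" "cylinder B y n \<subseteq> U" unfolding openin_path_space by blast
    then show "orbit_of (path_space B) (vershik B) x \<inter> U \<noteq> {}"
      using orbit_meets_cylinder[of x y n] x by auto
  qed
qed

end

section \<open>Invariant measures\<close>

text \<open>A cube over an arbitrary index type is compact but need not be sequentially compact, so
  convergence along a subsequence is replaced by convergence along a filter finer than
  \<open>sequentially\<close>, which serves all indices \<open>c\<close> at once.\<close>

lemma cluster_filter:
  fixes p :: "nat \<Rightarrow> 'a \<Rightarrow> real"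
  assumes "\<And>n c. 0 \<le> p n c \<and> p n c \<le> 1"
  obtains m F where "F \<noteq> bot" "F \<le> sequentially" "\<And>c. ((\<lambda>n. p n c) \<longlongrightarrow> m c) F"
proof -
  let ?K = "PiE UNIV (\<lambda>_. {0..1}) :: ('a \<Rightarrow> real) set"
  have "compactin (product_topology (\<lambda>_. euclidean) UNIV) ?K"
    unfolding compactin_PiE by (simp add: compactin_euclidean_iff)
  then have "compact ?K"
    by (simp add: euclidean_product_topology)
  moreover have "filtermap p sequentially \<noteq> bot" by (simp add: filtermap_bot_iff)
  moreover have "eventually (\<lambda>x. x \<in> ?K) (filtermap p sequentially)"
    using assms by (auto simp: eventually_filtermap PiE_iff)
  ultimately obtain m where m: "inf (nhds m) (filtermap p sequentially) \<noteq> bot"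
    unfolding compact_filter by blast
  define F where "F = inf (filtercomap p (nhds m)) sequentially"
  have "F \<noteq> bot"
  proof
    assume "F = bot"
    then have "eventually (\<lambda>_. False) F" by simp
    then obtain Q R where "eventually Q (nhds m)" "eventually R sequentially"
      "\<forall>x. \<not> (Q (p x) \<and> R x)"
      unfolding F_def eventually_inf eventually_filtercomap by blast
    moreover from this have "eventually (\<lambda>y. \<not> Q y) (filtermap p sequentially)"
      unfolding eventually_filtermap by (auto elim: eventually_mono)
    ultimately have "eventually (\<lambda>_. False) (inf (nhds m) (filtermap p sequentially))"
      unfolding eventually_inf by blast
    then show False using m trivial_limit_def by blast
  qed
  moreover have "F \<le> sequentially" by (simp add: F_def)
  moreover have "filterlim p (nhds m) F"
    unfolding F_def by (rule filterlim_mono[OF filterlim_filtercomap]) auto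
  then have "((\<lambda>n. p n c) \<longlongrightarrow> m c) F" for c
    using continuous_on_tendsto_compose[OF continuous_on_product_coordinates, of p m F c] by simp
  ultimately show thesis using that by blast
qed

text \<open>For Caratheodory's theorem only continuity at the empty set is missing. A decreasing
  sequence of clopen sets with empty intersection is eventually empty, because nonempty closed sets
  in a compact space would meet.\<close>

lemma clopen_extension:
  fixes m :: "'a set \<Rightarrow> real"
  assumes X: "cantor_space X" and nonneg: "\<And>C. 0 \<le> m C" and empty: "m {} = 0"
    and add: "\<And>C D. C \<inter> D = {} \<Longrightarrow> m (C \<union> D) = m C + m D"
  obtains \<mu> where "sets \<mu> = sets (borel_of X)"
    "\<And>C. openin X C \<Longrightarrow> closedin X C \<Longrightarrow> emeasure \<mu> C = ennreal (m C)"
    "sets (borel_of X) = sigma_sets (topspace X) {C. openin X C \<and> closedin X C}"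
proof -
  let ?G = "{C. openin X C \<and> closedin X C}"
  let ?f = "\<lambda>C. ennreal (m C)"
  obtain \<B> where \<B>: "countable \<B>" "\<forall>V\<in>\<B>. openin X V \<and> closedin X V"
    "\<forall>U x. openin X U \<and> x \<in> U \<longrightarrow> (\<exists>V\<in>\<B>. x \<in> V \<and> V \<subseteq> U)"
    using X unfolding cantor_space_def by blast
  have sets: "sets (borel_of X) = sigma_sets (topspace X) ?G"
    using \<B> by (intro sets_borel_of_base[of \<B>]) auto
  interpret ring_of_sets "topspace X" ?G
    by (rule ring_of_setsI) (auto dest: openin_subset)
  have "\<exists>\<mu>. (\<forall>C\<in>?G. \<mu> C = ?f C) \<and> measure_space (topspace X) (sigma_sets (topspace X) ?G) \<mu>"
  proof (rule caratheodory_empty_continuous)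
    show "positive ?G ?f" using empty by (simp add: positive_def)
    show "additive ?G ?f" using add nonneg by (simp add: additive_def)
    fix A :: "nat \<Rightarrow> 'a set" assume A: "range A \<subseteq> ?G" "decseq A" "(\<Inter>i. A i) = {}"
    have "\<not> (\<forall>i. A i \<noteq> {})"
    proof
      assume "\<forall>i. A i \<noteq> {}"
      then have "(\<Inter>i. A i) \<noteq> {}"
        using A(1,2) X unfolding cantor_space_def by (intro compact_space_imp_nest[of X]) auto
      then show False using A(3) by simp
    qed
    then obtain N where N: "A N = {}" by auto
    have "A n = {}" if "n \<ge> N" for n using A(2) N that by (auto simp: decseq_def)
    then have "\<forall>\<^sub>F n in sequentially. ?f (A n) = 0"
      using empty by (auto simp: eventually_sequentially intro!: exI[of _ N])
    then show "(\<lambda>n. ?f (A n)) \<longlonglongrightarrow> 0" by (rule tendsto_eventually)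
  qed simp
  then obtain \<mu>0 where \<mu>0: "\<forall>C\<in>?G. \<mu>0 C = ?f C"
    "measure_space (topspace X) (sigma_sets (topspace X) ?G) \<mu>0" by blast
  define \<mu> where "\<mu> = measure_of (topspace X) ?G \<mu>0"
  have sub: "?G \<subseteq> Pow (topspace X)" using space_closed .
  show thesis
  proof
    show "sets \<mu> = sets (borel_of X)" unfolding \<mu>_def sets using sub by (rule sets_measure_of)
    show "sets (borel_of X) = sigma_sets (topspace X) ?G" by (rule sets)
    fix C assume "openin X C" "closedin X C"
    then have C: "C \<in> ?G" by simp
    have "emeasure \<mu> C = \<mu>0 C"
      using \<mu>0(2) C sub by (intro emeasure_measure_of[OF \<mu>_def sub]) (auto simp: measure_space_def \<mu>_def)
    then show "emeasure \<mu> C = ?f C" using \<mu>0(1) C by simp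
  qed
qed

lemma space_borel_of [simp]: "space (borel_of X) = topspace X"
  unfolding borel_of_def using openin_subset by (subst space_measure_of) auto

text \<open>Krylov--Bogolyubov: a cluster point of the empirical averages along an orbit is an additive
  invariant set function, and on clopen sets additivity extends by compactness.\<close>

lemma invariant_probability_exists:
  assumes X: "cantor_space X" and T: "continuous_map X X T"
  shows "\<exists>\<mu>. invariant_probability X T \<mu>"
proof -
  obtain x where x: "x \<in> topspace X" using X unfolding cantor_space_def by blast
  have Tx: "(T ^^ d) x \<in> topspace X" for d
    by (induction d) (use x T in \<open>auto simp: continuous_map_def\<close>)
  define p where "p n C = (\<Sum>d\<le>n. indicator C ((T ^^ d) x)) / real (Suc n)" for n C
  have p01: "0 \<le> p n C \<and> p n C \<le> 1" for n C
  proof -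
    have "(\<Sum>d\<le>n. indicator C ((T ^^ d) x) :: real) \<le> (\<Sum>d\<le>n. 1)"
      by (intro sum_mono) (auto simp: indicator_def)
    then show ?thesis unfolding p_def by (auto intro!: sum_nonneg divide_nonneg_pos simp: divide_le_eq_1)
  qed
  obtain m F where F: "F \<noteq> bot" "F \<le> sequentially" and lim: "\<And>C. ((\<lambda>n. p n C) \<longlongrightarrow> m C) F"
    by (rule cluster_filter[where p = p, OF p01]) (rule that)
  have m_eqI: "m C = c" if "((\<lambda>n. p n C) \<longlongrightarrow> c) F" for C c
    using tendsto_unique[OF F(1) lim that] .
  have m_add: "m (C \<union> D) = m C + m D" if "C \<inter> D = {}" for C D
  proof (rule m_eqI)
    have "p n (C \<union> D) = p n C + p n D" for n
      unfolding p_def indicator_add[OF that, symmetric] by (simp add: sum.distrib add_divide_distrib)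
    then show "((\<lambda>n. p n (C \<union> D)) \<longlongrightarrow> m C + m D) F" using tendsto_add[OF lim lim] by simp
  qed
  have m_empty: "m {} = 0" by (rule m_eqI) (simp add: p_def)
  have "p n (topspace X) = 1" for n using Tx by (simp add: p_def)
  then have m_space: "m (topspace X) = 1" by (intro m_eqI) simp
  have m_nonneg: "0 \<le> m C" for C
    using F(1) p01 by (intro tendsto_lowerbound[OF lim]) auto
  have m_inv: "m (T -` C \<inter> topspace X) = m C" for C
  proof (rule m_eqI)
    \<comment> \<open>The two averages are sums over a segment of the orbit and over its shift, so
      only the end terms remain after telescoping.\<close>
    have "p n (T -` C \<inter> topspace X) - p n C =
        (indicator C ((T ^^ Suc n) x) - indicator C x) / real (Suc n)" for n
    proof -
      have "(\<Sum>d\<le>n. indicator (T -` C \<inter> topspace X) ((T ^^ d) x)) =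
          (\<Sum>d\<le>n. indicator C ((T ^^ Suc d) x) :: real)"
        using Tx by (intro sum.cong) (auto simp: indicator_def)
      also have "\<dots> = (\<Sum>d\<le>Suc n. indicator C ((T ^^ d) x)) - indicator C x"
        by (simp add: sum.atMost_Suc_shift del: sum.atMost_Suc funpow.simps(2))
      finally show ?thesis unfolding p_def by (simp add: diff_divide_distrib[symmetric])
    qed
    then have eq: "p n (T -` C \<inter> topspace X) =
        p n C + (indicator C ((T ^^ Suc n) x) - indicator C x) / real (Suc n)" for n
      by (simp add: algebra_simps)
    have "(\<lambda>n. (indicator C ((T ^^ Suc n) x) - indicator C x) / real (Suc n)) \<longlonglongrightarrow> 0"
    proof (rule Lim_null_comparison)
      show "\<forall>\<^sub>F n in sequentially. norm ((indicator C ((T ^^ Suc n) x) - indicator C x) / real (Suc n)) \<le> 1 / real (Suc n)"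
        by (intro always_eventually) (auto simp: indicator_def)
      show "(\<lambda>n. 1 / real (Suc n)) \<longlonglongrightarrow> 0" by (rule lim_1_over_n[THEN LIMSEQ_Suc])
    qed
    then have "((\<lambda>n. (indicator C ((T ^^ Suc n) x) - indicator C x) / real (Suc n)) \<longlongrightarrow> 0) F"
      using F(2) by (rule tendsto_mono[rotated])
    then show "((\<lambda>n. p n (T -` C \<inter> topspace X)) \<longlongrightarrow> m C) F"
      unfolding eq using tendsto_add[OF lim] by fastforce
  qed
  obtain \<mu> where \<mu>: "sets \<mu> = sets (borel_of X)"
    "\<And>C. openin X C \<Longrightarrow> closedin X C \<Longrightarrow> emeasure \<mu> C = ennreal (m C)"
    and gen: "sets (borel_of X) = sigma_sets (topspace X) {C. openin X C \<and> closedin X C}"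
    using clopen_extension[OF X m_nonneg m_empty m_add] by blast
  let ?G = "{C. openin X C \<and> closedin X C}"
  have G: "?G \<subseteq> Pow (topspace X)" by (auto dest: openin_subset)
  have sp: "space \<mu> = topspace X" using sets_eq_imp_space_eq[OF \<mu>(1)] by simp
  have pre: "T -` C \<inter> topspace X \<in> ?G" if "C \<in> ?G" for C
  proof -
    have "T -` C \<inter> topspace X = {x \<in> topspace X. T x \<in> C}" by auto
    then show ?thesis
      using openin_continuous_map_preimage[OF T] closedin_continuous_map_preimage[OF T] that by simp
  qed
  have sG: "C \<in> sets \<mu>" if "C \<in> ?G" for C using that unfolding \<mu>(1) gen by auto
  have meas: "T \<in> measurable \<mu> \<mu>"
  proof (rule measurable_sigma_sets[OF _ G])
    show "sets \<mu> = sigma_sets (topspace X) ?G" using \<mu>(1) gen by simp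
    show "T \<in> space \<mu> \<rightarrow> topspace X" using T unfolding sp continuous_map_def by auto
    show "T -` C \<inter> space \<mu> \<in> sets \<mu>" if "C \<in> ?G" for C
      unfolding sp using pre[OF that] by (rule sG)
  qed
  have "distr \<mu> \<mu> T = \<mu>"
  proof (rule measure_eqI_generator_eq[OF _ G])
    show "Int_stable ?G" by (intro Int_stableI) auto
    show "emeasure (distr \<mu> \<mu> T) C = emeasure \<mu> C" if "C \<in> ?G" for C
      using emeasure_distr[OF meas sG[OF that]] \<mu>(2) pre[OF that] that m_inv sp by simp
    show "sets (distr \<mu> \<mu> T) = sigma_sets (topspace X) ?G" "sets \<mu> = sigma_sets (topspace X) ?G"
      using \<mu>(1) gen by auto
    show "range (\<lambda>_::nat. topspace X) \<subseteq> ?G" "(\<Union>i::nat. topspace X) = topspace X" by auto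
    have "emeasure (distr \<mu> \<mu> T) (topspace X) = ennreal (m (topspace X))"
      using emeasure_distr[OF meas, of "topspace X"] sG[of "topspace X"] pre[of "topspace X"] \<mu>(2) m_inv sp by simp
    then show "\<And>i::nat. emeasure (distr \<mu> \<mu> T) (topspace X) \<noteq> \<infinity>" by simp
  qed
  moreover have "prob_space \<mu>"
    by (rule prob_spaceI) (simp add: sp \<mu>(2) m_space)
  ultimately show ?thesis unfolding invariant_probability_def using \<mu>(1) meas by blast
qed

section \<open>Floors of the towers and their measures\<close>

context proper_words
begin

text \<open>Floors are numbered from the top: \<open>t = 0\<close> is the top floor of the tower
  over \<open>j\<close>.\<close>

definition tower_floor :: "nat \<Rightarrow> 'v \<Rightarrow> nat \<Rightarrow> (nat \<Rightarrow> 'v \<times> nat) set" where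
  "tower_floor n j t = {x \<in> paths B. fst (x n) = j \<and> exit_time n x = t}"

lemma cylinder_tower_floor:
  "x \<in> paths B \<Longrightarrow> n \<ge> 1 \<Longrightarrow> cylinder B x n = tower_floor n (fst (x n)) (exit_time n x)"
  unfolding tower_floor_def by (rule cylinder_eq_floor)

lemma tower_floor_nonempty:
  assumes "n \<ge> 1" "t < height n j"
  obtains x where "x \<in> paths B" "fst (x n) = j" "exit_time n x = t"
  using path_through[OF assms(1), of j] exit_time_exists[OF assms(1)] assms(2) by metis

lemma vershik_preimage_floor:
  assumes n: "n \<ge> 1" and t: "Suc t < height n j"
  shows "vershik B -` tower_floor n j t \<inter> paths B = tower_floor n j (Suc t)"
proof (intro set_eqI iffI)
  fix x assume "x \<in> vershik B -` tower_floor n j t \<inter> paths B"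
  then have x: "x \<in> paths B" and "fst (vershik B x n) = j" "exit_time n (vershik B x) = t"
    by (auto simp: tower_floor_def)
  moreover from this have nt: "exit_time n x \<noteq> 0" using vershik_top[OF x n] t by auto
  ultimately show "x \<in> tower_floor n j (Suc t)"
    using vershik_climb[OF x nt] by (simp add: tower_floor_def)
next
  fix x assume "x \<in> tower_floor n j (Suc t)"
  then have x: "x \<in> paths B" "fst (x n) = j" "exit_time n x = Suc t"
    by (auto simp: tower_floor_def)
  then show "x \<in> vershik B -` tower_floor n j t \<inter> paths B"
    using vershik_climb[OF x(1), of n] by (simp add: tower_floor_def)
qed

end

locale invariant_measure = proper_words +
  fixes \<mu> :: "(nat \<Rightarrow> 'a \<times> nat) measure"
  assumes invariant: "invariant_probability (path_space B) (vershik B) \<mu>"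
begin

sublocale prob_space \<mu>
  using invariant by (simp add: invariant_probability_def)

lemma sets_\<mu>: "sets \<mu> = sets (borel_of (path_space B))"
  using invariant by (simp add: invariant_probability_def)

lemma space_\<mu>: "space \<mu> = paths B"
  using sets_eq_imp_space_eq[OF sets_\<mu>] by simp

lemma measurable_vershik [measurable]: "vershik B \<in> measurable \<mu> \<mu>"
  using invariant by (simp add: invariant_probability_def)

lemma distr_vershik: "distr \<mu> \<mu> (vershik B) = \<mu>"
  using invariant by (simp add: invariant_probability_def)

lemma open_in_sets: "openin (path_space B) U \<Longrightarrow> U \<in> sets \<mu>"
  unfolding sets_\<mu> borel_of_def using openin_subset[of "path_space B"]
  by (subst sets_measure_of) auto

lemma floor_in_sets [measurable]: "n \<ge> 1 \<Longrightarrow> tower_floor n j t \<in> sets \<mu>"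
proof (rule open_in_sets)
  assume n: "n \<ge> 1"
  show "openin (path_space B) (tower_floor n j t)"
    unfolding openin_path_space
  proof (intro conjI ballI)
    fix x assume "x \<in> tower_floor n j t"
    then have "cylinder B x n = tower_floor n j t"
      using cylinder_tower_floor[OF _ n, of x] by (auto simp: tower_floor_def)
    then show "\<exists>m. cylinder B x m \<subseteq> tower_floor n j t" by blast
  qed (auto simp: tower_floor_def)
qed

text \<open>All floors of one tower have the same measure, because the map carries each of them onto
  the next; the top floor always exists, so it serves as representative.\<close>

definition weight :: "nat \<Rightarrow> 'a \<Rightarrow> real" where
  "weight n j = measure \<mu> (tower_floor n j 0)"

lemma measure_tower_floor:
  assumes n: "n \<ge> 1" and t: "t < height n j"
  shows "measure \<mu> (tower_floor n j t) = weight n j"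
  using t
proof (induction t)
  case 0
  then show ?case by (simp add: weight_def)
next
  case (Suc t)
  have "measure \<mu> (tower_floor n j t) = measure (distr \<mu> \<mu> (vershik B)) (tower_floor n j t)"
    by (simp add: distr_vershik)
  also have "\<dots> = measure \<mu> (vershik B -` tower_floor n j t \<inter> paths B)"
    using measure_distr[OF measurable_vershik floor_in_sets[OF n]] by (simp only: space_\<mu>)
  also have "\<dots> = measure \<mu> (tower_floor n j (Suc t))"
    using vershik_preimage_floor[OF n Suc.prems] by simp
  finally show ?case using Suc by simp
qed

text \<open>A floor of level \<open>n\<close> restricted to one copy of its tower inside a tower of
  level \<open>Suc n\<close>. Such a piece is a single floor of level \<open>Suc n\<close>.\<close>

definition edge_floor :: "nat \<Rightarrow> 'a \<times> nat \<Rightarrow> nat \<Rightarrow> (nat \<Rightarrow> 'a \<times> nat) set" where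
  "edge_floor n e t = {x \<in> paths B. x (Suc n) = e \<and> exit_time n x = t}"

lemma
  assumes n: "n \<ge> 1" and q: "q < length (W (Suc n) j)" and t: "t < height n (W (Suc n) j ! q)"
  shows edge_floor_in_sets: "edge_floor n (j, q) t \<in> sets \<mu>"
    and measure_edge_floor: "measure \<mu> (edge_floor n (j, q) t) = weight (Suc n) j"
proof -
  obtain y where y: "y \<in> paths B" "fst (y n) = W (Suc n) j ! q" "exit_time n y = t"
    using tower_floor_nonempty[OF n t] by blast
  obtain z where z: "z \<in> paths B" "fst (z (Suc n)) = j" using path_through[of "Suc n" j] by auto
  let ?x = "splice n y q z"
  have x: "?x \<in> paths B" using y z q n by (intro splice_in_paths) auto
  have xn: "?x (Suc n) = (j, q)" using z by (simp add: splice_def)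
  have ex: "exit_time n ?x = t" using y(3) exit_time_cong[of n ?x y] by (simp add: splice_def)
  have vx: "fst (?x n) = W (Suc n) j ! q" using y(2) by (simp add: splice_def)
  have "edge_floor n (j, q) t = cylinder B ?x (Suc n)"
  proof (intro set_eqI iffI)
    fix u assume "u \<in> edge_floor n (j, q) t"
    then have u: "u \<in> paths B" "u (Suc n) = (j, q)" "exit_time n u = t" by (auto simp: edge_floor_def)
    have "\<forall>m\<in>{1..n}. u m = ?x m"
      using pathsD(3)[OF u(1) n] u vx ex by (intro exit_time_inj[OF u(1) x n]) auto
    then show "u \<in> cylinder B ?x (Suc n)" using u xn by (auto simp: cylinder_def le_Suc_eq)
  next
    fix u assume "u \<in> cylinder B ?x (Suc n)"
    then have u: "u \<in> paths B" "\<forall>m\<in>{1..Suc n}. u m = ?x m" by (auto simp: cylinder_def)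
    moreover have "exit_time n u = exit_time n ?x" using u(2) by (intro exit_time_cong) auto
    ultimately show "u \<in> edge_floor n (j, q) t" using xn ex by (auto simp: edge_floor_def)
  qed
  then have *: "edge_floor n (j, q) t = tower_floor (Suc n) j (exit_time (Suc n) ?x)"
    using cylinder_tower_floor[OF x, of "Suc n"] xn by simp
  show "edge_floor n (j, q) t \<in> sets \<mu>" unfolding * by (intro floor_in_sets) simp
  have "exit_time (Suc n) ?x < height (Suc n) (fst (?x (Suc n)))" using exit_time_less[OF x, of "Suc n"] by simp
  then have "exit_time (Suc n) ?x < height (Suc n) j" unfolding xn by simp
  then show "measure \<mu> (edge_floor n (j, q) t) = weight (Suc n) j"
    unfolding * by (intro measure_tower_floor) simp_all
qed

text \<open>Cutting and stacking: the top floor over \<open>i\<close> splits into one piece for each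
  occurrence of \<open>i\<close> in the words of the next level. The weights are thus transported by
  transposed incidence matrices, from level \<open>Suc n\<close> down to level
  \<open>n\<close>.\<close>

lemma weight_rec:
  assumes n: "n \<ge> 1"
  shows "weight n i = (\<Sum>j\<in>UNIV. real (count_list (W (Suc n) j) i) * weight (Suc n) j)"
proof -
  let ?Q = "\<lambda>j. {q. q < length (W (Suc n) j) \<and> W (Suc n) j ! q = i}"
  let ?I = "SIGMA j:UNIV. ?Q j"
  have "tower_floor n i 0 = (\<Union>e\<in>?I. edge_floor n e 0)"
  proof (intro set_eqI iffI)
    fix x assume "x \<in> tower_floor n i 0"
    then have x: "x \<in> paths B" "fst (x n) = i" "exit_time n x = 0" by (auto simp: tower_floor_def)
    then show "x \<in> (\<Union>e\<in>?I. edge_floor n e 0)"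
      using pathsD(3,4)[OF x(1) n] by (cases "x (Suc n)") (auto simp: edge_floor_def)
  next
    fix x assume "x \<in> (\<Union>e\<in>?I. edge_floor n e 0)"
    then have x: "x \<in> paths B" "exit_time n x = 0" "x (Suc n) \<in> ?I" by (auto simp: edge_floor_def)
    then show "x \<in> tower_floor n i 0"
      using pathsD(3)[OF x(1) n] by (auto simp: tower_floor_def)
  qed
  then have "weight n i = measure \<mu> (\<Union>e\<in>?I. edge_floor n e 0)" by (simp add: weight_def)
  also have "\<dots> = (\<Sum>e\<in>?I. measure \<mu> (edge_floor n e 0))"
    using height_pos by (intro finite_measure_finite_Union)
      (auto simp: disjoint_family_on_def edge_floor_def[abs_def] intro!: edge_floor_in_sets[OF n, unfolded edge_floor_def])
  also have "\<dots> = (\<Sum>e\<in>?I. weight (Suc n) (fst e))"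
    using height_pos by (intro sum.cong) (auto intro!: measure_edge_floor[OF n])
  also have "\<dots> = (\<Sum>j\<in>UNIV. \<Sum>q\<in>?Q j. weight (Suc n) j)"
    by (simp add: sum.Sigma split_def del: sum_constant)
  also have "\<dots> = (\<Sum>j\<in>UNIV. real (count_list (W (Suc n) j) i) * weight (Suc n) j)"
    by (intro sum.cong) (auto simp: count_list_eq_length_filter length_filter_conv_card eq_commute)
  finally show ?thesis .
qed

lemma weight_total:
  assumes n: "n \<ge> 1"
  shows "(\<Sum>j\<in>UNIV. real (height n j) * weight n j) = 1"
proof -
  let ?I = "SIGMA j:UNIV. {..<height n j}"
  have "paths B = (\<Union>e\<in>?I. tower_floor n (fst e) (snd e))"
    using exit_time_less[OF _ n] by (auto simp: tower_floor_def)
  then have "1 = measure \<mu> (\<Union>e\<in>?I. tower_floor n (fst e) (snd e))"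
    using prob_space space_\<mu> by simp
  also have "\<dots> = (\<Sum>e\<in>?I. measure \<mu> (tower_floor n (fst e) (snd e)))"
    by (intro finite_measure_finite_Union)
      (auto simp: disjoint_family_on_def floor_in_sets[OF n] tower_floor_def[abs_def]
        intro!: floor_in_sets[OF n, unfolded tower_floor_def])
  also have "\<dots> = (\<Sum>e\<in>?I. weight n (fst e))"
    by (intro sum.cong) (auto intro!: measure_tower_floor[OF n])
  also have "\<dots> = (\<Sum>j\<in>UNIV. \<Sum>t<height n j. weight n j)"
    by (simp add: sum.Sigma split_def del: sum_constant)
  finally show ?thesis by simp
qed

lemma
  assumes n: "n \<ge> 1" and q: "q < length (W (Suc n) j)"
  shows edge_in_sets: "{x \<in> paths B. x (Suc n) = (j, q)} \<in> sets \<mu>"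
    and measure_edge: "measure \<mu> {x \<in> paths B. x (Suc n) = (j, q)} =
      real (height n (W (Suc n) j ! q)) * weight (Suc n) j"
proof -
  let ?T = "{..<height n (W (Suc n) j ! q)}"
  have eq: "{x \<in> paths B. x (Suc n) = (j, q)} = (\<Union>t\<in>?T. edge_floor n (j, q) t)"
  proof -
    have "exit_time n x < height n (W (Suc n) j ! q)" if "x \<in> paths B" "x (Suc n) = (j, q)" for x
      using exit_time_less[OF that(1) n] pathsD(3)[OF that(1) n] that(2) by simp
    then show ?thesis by (auto simp: edge_floor_def)
  qed
  show "{x \<in> paths B. x (Suc n) = (j, q)} \<in> sets \<mu>"
    unfolding eq using edge_floor_in_sets[OF n q] by blast
  have "measure \<mu> (\<Union>t\<in>?T. edge_floor n (j, q) t) = (\<Sum>t\<in>?T. measure \<mu> (edge_floor n (j, q) t))"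
    using edge_floor_in_sets[OF n q]
    by (intro finite_measure_finite_Union) (auto simp: disjoint_family_on_def edge_floor_def)
  also have "\<dots> = (\<Sum>t\<in>?T. weight (Suc n) j)"
    using measure_edge_floor[OF n q] by (intro sum.cong) auto
  finally show "measure \<mu> {x \<in> paths B. x (Suc n) = (j, q)} =
      real (height n (W (Suc n) j ! q)) * weight (Suc n) j" unfolding eq by simp
qed

end

text \<open>Cylinders of positive length are floors, whose measures are the weights, and cylinders
  form an intersection-stable generator of the Borel sets.\<close>

lemma (in proper_words) invariant_measure_eqI:
  assumes \<mu>: "invariant_measure W a b \<mu>" and \<nu>: "invariant_measure W a b \<nu>"
    and eq: "\<And>n j. n \<ge> 1 \<Longrightarrow> invariant_measure.weight W \<mu> n j = invariant_measure.weight W \<nu> n j"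
  shows "\<mu> = \<nu>"
proof -
  interpret \<mu>: invariant_measure W a b \<mu> by (rule \<mu>)
  interpret \<nu>: invariant_measure W a b \<nu> by (rule \<nu>)
  let ?E = "insert {} {cylinder B x n |x n. x \<in> paths B}"
  obtain x0 where x0: "x0 \<in> paths B" using paths_nonempty by blast
  have c0: "cylinder B x 0 = paths B" for x by (auto simp: cylinder_def)
  show ?thesis
  proof (rule measure_eqI_generator_eq[OF Int_stable_cylinders])
    show "?E \<subseteq> Pow (paths B)" using cylinder_subset by blast
    fix C assume "C \<in> ?E"
    then consider "C = {}" | x n where "x \<in> paths B" "C = cylinder B x n" by blast
    then show "emeasure \<mu> C = emeasure \<nu> C"
    proof cases
      case (2 x n)
      show ?thesis
      proof (cases "n = 0")
        case True
        then show ?thesis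
          using 2 c0 \<mu>.emeasure_space_1 \<nu>.emeasure_space_1 by (simp add: \<mu>.space_\<mu> \<nu>.space_\<mu>)
      next
        case False
        then have "C = tower_floor n (fst (x n)) (exit_time n x)" "exit_time n x < height n (fst (x n))"
          using cylinder_tower_floor[of x n] exit_time_less[of x n] 2 by auto
        then show ?thesis
          using False eq[of n] \<mu>.measure_tower_floor[of n] \<nu>.measure_tower_floor[of n]
          by (simp add: \<mu>.emeasure_eq_measure \<nu>.emeasure_eq_measure)
      qed
    qed simp
  next
    show "sets \<mu> = sigma_sets (paths B) ?E" "sets \<nu> = sigma_sets (paths B) ?E"
      using \<mu>.sets_\<mu> \<nu>.sets_\<mu> sets_borel_of_path_space[OF ordered_bratteli_diagram_word] by auto
    show "range (\<lambda>_::nat. paths B) \<subseteq> ?E" using c0[of x0] x0 by auto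
  qed auto
qed

section \<open>Eigenvalues\<close>

definition turn :: "real \<Rightarrow> complex" where
  "turn t = cis (2 * pi * t)"

lemma turn_add: "turn (s + t) = turn s * turn t"
  by (simp add: turn_def cis_mult distrib_left)

lemma turn_Ints: "t \<in> \<int> \<Longrightarrow> turn t = 1"
  by (auto simp: turn_def elim!: Ints_cases)

lemma turn_cong: "s - t \<in> \<int> \<Longrightarrow> turn s = turn t"
  using turn_add[of t "s - t"] turn_Ints by simp

lemma norm_turn [simp]: "norm (turn t) = 1"
  by (simp add: turn_def)

lemma turn_of_nat_mult: "turn (real n * t) = turn t ^ n"
  unfolding turn_def Complex.DeMoivre by (rule arg_cong[where f = cis]) simp

lemma norm_turn_minus_1: "norm (turn t - 1) \<le> 2 * pi * \<bar>t\<bar>"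
  using iexp_approx1[of "2 * pi * t" 0] by (simp add: turn_def cis_conv_exp abs_mult)

lemma tendsto_turn: "(f \<longlongrightarrow> 0) F \<Longrightarrow> ((\<lambda>n. turn (f n)) \<longlongrightarrow> 1) F"
proof -
  assume "(f \<longlongrightarrow> 0) F"
  then have "((\<lambda>n. 2 * pi * \<bar>f n\<bar>) \<longlongrightarrow> 0) F"
    by (intro tendsto_mult_right_zero tendsto_rabs_zero)
  then have "((\<lambda>n. turn (f n) - 1) \<longlongrightarrow> 0) F"
    by (rule Lim_null_comparison[rotated]) (simp add: norm_turn_minus_1)
  then show ?thesis by (rule LIM_zero_cancel)
qed

context invariant_measure
begin

lemma measurable_exit_time [measurable]: "exit_time n \<in> measurable \<mu> (count_space UNIV)"
proof (cases "n = 0")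
  case False
  have "exit_time n -` {t} \<inter> space \<mu> \<in> sets \<mu>" for t
  proof -
    have "exit_time n -` {t} \<inter> space \<mu> = (\<Union>j. tower_floor n j t)"
      by (auto simp: space_\<mu> tower_floor_def)
    also have "\<dots> \<in> sets \<mu>" using floor_in_sets[of n] False by auto
    finally show ?thesis .
  qed
  then show ?thesis by (simp add: measurable_count_space_eq2_countable)
qed (simp cong: measurable_cong)

text \<open>Converts a bound on the proportion of bad letters in each tower, counted by height, into
  a bound on measure: the towers have total mass one.\<close>

lemma measure_bad_edges:
  assumes n: "n \<ge> 1"
    and d: "\<And>j. (\<Sum>q | q < length (W (Suc n) j) \<and> bad j q. real (height n (W (Suc n) j ! q)))
        \<le> d * real (height (Suc n) j)"
  shows "{x \<in> paths B. bad (fst (x (Suc n))) (snd (x (Suc n)))} \<in> sets \<mu>" (is "?A \<in> _")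
    and "measure \<mu> {x \<in> paths B. bad (fst (x (Suc n))) (snd (x (Suc n)))} \<le> d"
proof -
  let ?Q = "\<lambda>j. {q. q < length (W (Suc n) j) \<and> bad j q}"
  let ?I = "SIGMA j:UNIV. ?Q j"
  let ?E = "\<lambda>e. {x \<in> paths B. x (Suc n) = e}"
  have eq: "?A = (\<Union>e\<in>?I. ?E e)"
  proof (intro set_eqI iffI)
    fix x assume x: "x \<in> ?A"
    then show "x \<in> (\<Union>e\<in>?I. ?E e)" using pathsD(4)[of x n] n by (cases "x (Suc n)") auto
  qed auto
  have E: "?E e \<in> sets \<mu>" "measure \<mu> (?E e) = real (height n (W (Suc n) (fst e) ! snd e)) * weight (Suc n) (fst e)"
    if "e \<in> ?I" for e using that edge_in_sets[OF n] measure_edge[OF n] by auto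
  have "(\<Union>e\<in>?I. ?E e) \<in> sets \<mu>" by (intro sets.finite_UN) (use E in auto)
  then show "?A \<in> sets \<mu>" unfolding eq .
  have "measure \<mu> ?A = (\<Sum>e\<in>?I. measure \<mu> (?E e))"
    unfolding eq using E(1) by (intro finite_measure_finite_Union) (auto simp: disjoint_family_on_def)
  also have "\<dots> = (\<Sum>e\<in>?I. real (height n (W (Suc n) (fst e) ! snd e)) * weight (Suc n) (fst e))"
    using E(2) by (intro sum.cong) auto
  also have "\<dots> = (\<Sum>j\<in>UNIV. (\<Sum>q\<in>?Q j. real (height n (W (Suc n) j ! q))) * weight (Suc n) j)"
    by (simp add: sum.Sigma split_def sum_distrib_right)
  also have "\<dots> \<le> (\<Sum>j\<in>UNIV. d * real (height (Suc n) j) * weight (Suc n) j)"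
    using d by (intro sum_mono mult_right_mono) (auto simp: weight_def)
  also have "\<dots> = d * (\<Sum>j\<in>UNIV. real (height (Suc n) j) * weight (Suc n) j)"
    by (simp add: sum_distrib_left mult.assoc)
  also have "\<dots> = d" using weight_total[of "Suc n"] by simp
  finally show "measure \<mu> ?A \<le> d" .
qed

text \<open>The eigenfunction is the limit of \<open>turn (- \<alpha> * exit_time n x)\<close>: by Borel--Cantelli almost every
  path eventually avoids the exceptional edges, along which the phases are not summable.\<close>

lemma measurable_eigenvalueI:
  fixes g :: "nat \<Rightarrow> 'a \<Rightarrow> real" and bad :: "nat \<Rightarrow> 'a \<Rightarrow> nat \<Rightarrow> bool"
  assumes g: "\<And>n i. n \<ge> 1 \<Longrightarrow> \<alpha> * real (height n i) - g n i \<in> \<int>"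
    and good: "\<And>n j q. n \<ge> 1 \<Longrightarrow> q < length (W (Suc n) j) \<Longrightarrow> \<not> bad n j q \<Longrightarrow>
        \<bar>sum_list (map (g n) (drop (Suc q) (W (Suc n) j)))\<bar> \<le> c n"
    and c: "summable c"
    and g_first: "(\<lambda>n. g n a) \<longlonglongrightarrow> 0"
    and d: "summable d" "\<And>n j. n \<ge> 1 \<Longrightarrow>
       (\<Sum>q | q < length (W (Suc n) j) \<and> bad n j q. real (height n (W (Suc n) j ! q)))
        \<le> d n * real (height (Suc n) j)"
  shows "measurable_eigenvalue (vershik B) \<mu> (turn \<alpha>)"
proof -
  define f where "f n x = turn (- \<alpha> * real (exit_time n x))" for n x
  define F where "F x = lim (\<lambda>n. f n x)" for x
  have f_meas: "f n \<in> borel_measurable \<mu>" for n unfolding f_def by measurable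
  have F_meas: "F \<in> borel_measurable \<mu>" unfolding F_def using f_meas by (rule borel_measurable_lim_metric)
  have g_sum: "\<alpha> * real (sum_list (map (height n) l)) - sum_list (map (g n) l) \<in> \<int>" if "n \<ge> 1" for n l
  proof (induction l)
    case (Cons i l)
    then show ?case using Ints_add[OF g[OF that, of i] Cons] by (simp add: algebra_simps)
  qed simp
  \<comment> \<open>Passing from level \<open>n\<close> to \<open>Suc n\<close> multiplies
    \<open>f\<close> by the turn of the heights of the letters after the edge; modulo integers these
    heights may be replaced by the small phases \<open>g\<close>.\<close>
  have f_step: "norm (f (Suc n) x - f n x) \<le> 2 * pi * c n"
    if n: "n \<ge> 1" and x: "x \<in> paths B" and nb: "\<not> bad n (fst (x (Suc n))) (snd (x (Suc n)))" for n x
  proof -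
    let ?l = "drop (Suc (snd (x (Suc n)))) (W (Suc n) (fst (x (Suc n))))"
    have "f (Suc n) x = f n x * turn (- (\<alpha> * real (sum_list (map (height n) ?l))))"
      unfolding f_def using n by (simp add: exit_time.simps turn_add[symmetric] algebra_simps)
    also have "turn (- (\<alpha> * real (sum_list (map (height n) ?l)))) = turn (- sum_list (map (g n) ?l))"
      using Ints_minus[OF g_sum[OF n]] by (intro turn_cong) simp
    finally have "f (Suc n) x - f n x = f n x * (turn (- sum_list (map (g n) ?l)) - 1)"
      by (simp add: algebra_simps)
    then have "norm (f (Suc n) x - f n x) = norm (turn (- sum_list (map (g n) ?l)) - 1)"
      by (simp add: norm_mult f_def)
    also have "\<dots> \<le> 2 * pi * \<bar>sum_list (map (g n) ?l)\<bar>"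
      using norm_turn_minus_1[of "- sum_list (map (g n) ?l)"] by simp
    also have "\<dots> \<le> 2 * pi * c n" using good[OF n pathsD(4)[OF x n] nb] by simp
    finally show ?thesis .
  qed
  \<comment> \<open>Shifted by one because the hypotheses concern levels
    \<open>n \<ge> 1\<close>.\<close>
  define A where "A n = {x \<in> paths B. bad (Suc n) (fst (x (Suc (Suc n)))) (snd (x (Suc (Suc n))))}" for n
  have A: "A n \<in> sets \<mu>" "measure \<mu> (A n) \<le> d (Suc n)" for n
    unfolding A_def using measure_bad_edges[OF _ d(2), of "Suc n"] by auto
  have "AE x in \<mu>. eventually (\<lambda>n. x \<in> space \<mu> - A n) sequentially"
  proof (rule borel_cantelli_AE1[OF A(1)])
    show "summable (\<lambda>n. measure \<mu> (A n))"
      using A(2) d(1) by (intro summable_comparison_test_ev[OF _ summable_Suc_iff[THEN iffD2, OF d(1)]]) auto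
  qed (simp add: emeasure_eq_measure)
  then have conv: "AE x in \<mu>. x \<in> paths B \<and> (\<lambda>n. f n x) \<longlonglongrightarrow> F x"
  proof (rule AE_mp, intro AE_I2 impI)
    fix x assume x: "x \<in> space \<mu>" and ev: "eventually (\<lambda>n. x \<in> space \<mu> - A n) sequentially"
    have xp: "x \<in> paths B" using x by (simp add: space_\<mu>)
    have "eventually (\<lambda>n. norm (f (Suc (Suc n)) x - f (Suc n) x) \<le> 2 * pi * c (Suc n)) sequentially"
      using ev by eventually_elim (intro f_step, auto simp: A_def xp)
    then have "summable (\<lambda>n. f (Suc (Suc n)) x - f (Suc n) x)"
      using summable_mult[OF summable_Suc_iff[THEN iffD2, OF c], of "2 * pi"]
      by (rule summable_comparison_test_ev)
    then have "convergent (\<lambda>n. \<Sum>k<n. f (Suc (Suc k)) x - f (Suc k) x)"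
      by (simp add: summable_iff_convergent)
    then have "convergent (\<lambda>n. f (Suc n) x - f (Suc 0) x)"
      by (simp only: sum_lessThan_telescope[of "\<lambda>n. f (Suc n) x"])
    then have "convergent (\<lambda>n. f (Suc n) x)"
      by (simp add: convergent_diff_const_right_iff)
    then have "convergent (\<lambda>n. f n x)" by (rule convergent_Suc_iff[THEN iffD1])
    then show "x \<in> paths B \<and> (\<lambda>n. f n x) \<longlonglongrightarrow> F x"
      unfolding F_def using xp by (simp add: convergent_LIMSEQ_iff)
  qed
  have norm_F: "AE x in \<mu>. norm (F x) = 1"
    using conv
  proof eventually_elim
    case (elim x)
    then have "(\<lambda>n. norm (f n x)) \<longlonglongrightarrow> norm (F x)" by (intro tendsto_norm) simp
    then show ?case by (simp add: f_def LIMSEQ_const_iff)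
  qed
  have "AE x in \<mu>. F (vershik B x) = turn \<alpha> * F x"
    using conv
  proof eventually_elim
    case (elim x)
    then have x: "x \<in> paths B" and lim: "(\<lambda>n. f n x) \<longlonglongrightarrow> F x" by auto
    have "(\<lambda>n. f n (vershik B x)) \<longlonglongrightarrow> turn \<alpha> * F x"
    proof (cases "max_path B x")
      \<comment> \<open>The maximal path goes to the minimal one, whose exit time is the height over
        \<open>a\<close> minus one; this missing one produces \<open>turn \<alpha>\<close>, and the
        phase of the full height disappears since \<open>g n a\<close> tends to
        \<open>0\<close>.\<close>
      case True
      then have top: "exit_time n x = 0" for n by (simp add: max_path_iff)
      then have "F x = 1" using lim by (simp add: f_def turn_def LIMSEQ_const_iff)
      have mn: "min_path B (vershik B x)" using True by (rule vershik_max)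
      have "f n (vershik B x) = turn \<alpha> * turn (- g n a)" if n: "n \<ge> 1" for n
      proof -
        have "fst (vershik B x n) = a"
          using pathsD(3)[OF vershik_in_paths[OF x] n] mn[unfolded min_path_iff] word_first[of "Suc n"] n
          by simp
        then have ex: "real (exit_time n (vershik B x)) = real (height n a) - 1"
          using vershik_top[OF x n top] by simp
        then have "f n (vershik B x) = turn \<alpha> * turn (- (\<alpha> * real (height n a)))"
          unfolding f_def ex by (simp add: turn_add[symmetric] algebra_simps)
        also have "turn (- (\<alpha> * real (height n a))) = turn (- g n a)"
          using Ints_minus[OF g[OF n]] by (intro turn_cong) simp
        finally show ?thesis .
      qed
      then have "\<forall>\<^sub>F n in sequentially. f n (vershik B x) = turn \<alpha> * turn (- g n a)"
        by (auto simp: eventually_sequentially)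
      moreover have "(\<lambda>n. turn \<alpha> * turn (- g n a)) \<longlonglongrightarrow> turn \<alpha> * 1"
        using tendsto_minus[OF g_first] by (intro tendsto_mult tendsto_const tendsto_turn) simp
      ultimately show ?thesis using \<open>F x = 1\<close> by (simp add: tendsto_cong)
    next
      case False
      then obtain N where N: "exit_time N x \<noteq> 0" using x by (auto simp: max_path_iff)
      have "f n (vershik B x) = turn \<alpha> * f n x" if "n \<ge> N" for n
      proof -
        have "exit_time n x \<noteq> 0" using N exit_time_mono[OF that, of x] by simp
        then have "real (exit_time n x) = real (exit_time n (vershik B x)) + 1"
          using vershik_climb(4)[OF x] by fastforce
        then show ?thesis unfolding f_def by (simp add: turn_add[symmetric] algebra_simps)
      qed
      then have "\<forall>\<^sub>F n in sequentially. f n (vershik B x) = turn \<alpha> * f n x"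
        by (auto simp: eventually_sequentially)
      moreover have "(\<lambda>n. turn \<alpha> * f n x) \<longlonglongrightarrow> turn \<alpha> * F x" by (intro tendsto_intros lim)
      ultimately show ?thesis by (simp add: tendsto_cong)
    qed
    then show ?case unfolding F_def[of "vershik B x"] by (rule limI)
  qed
  moreover have "\<not> (AE x in \<mu>. F x = 0)"
  proof
    assume "AE x in \<mu>. F x = 0"
    with norm_F have "AE x in \<mu>. False" by eventually_elim auto
    then show False by simp
  qed
  moreover have "integrable \<mu> (\<lambda>x. (cmod (F x))\<^sup>2)"
  proof (rule integrable_const_bound[where B = 1])
    show "AE x in \<mu>. norm ((cmod (F x))\<^sup>2) \<le> 1" using norm_F by eventually_elim simp
    show "(\<lambda>x. (cmod (F x))\<^sup>2) \<in> borel_measurable \<mu>" using F_meas by measurable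
  qed
  ultimately show ?thesis unfolding measurable_eigenvalue_def using F_meas by blast
qed

end

section \<open>Continuous eigenfunctions near the minimal path\<close>

context proper_words
begin

lemma eigenfunction_funpow:
  fixes f :: "_ \<Rightarrow> complex"
  assumes "\<forall>x\<in>paths B. f (vershik B x) = c * f x" and "x \<in> paths B"
  shows "f ((vershik B ^^ d) x) = c ^ d * f x"
  using assms by (induction d) (auto simp: vershik_funpow_in_paths mult.assoc)

text \<open>Positions \<open>0\<close> and \<open>q n\<close> of the word both carry
  \<open>a\<close>, so the minimal path up to level \<open>n\<close> occurs at both. The heights
  between them add up to the time from one occurrence to the other, and both paths converge to the
  minimal path, so an eigenfunction takes asymptotically equal values on them.\<close>

lemma continuous_eigenvalue_return_times:
  assumes ev: "continuous_eigenvalue (path_space B) (vershik B) c" and c: "norm c = 1"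
    and q: "\<And>n. n \<ge> N \<Longrightarrow> q n < length (W (Suc n) (j n)) \<and> W (Suc n) (j n) ! q n = a"
  shows "(\<lambda>n. c ^ sum_list (map (height n) (take (q n) (W (Suc n) (j n))))) \<longlonglongrightarrow> 1"
proof -
  obtain f x0 where f: "continuous_map (path_space B) euclidean f" "x0 \<in> paths B" "f x0 \<noteq> 0"
    and inv: "\<forall>x\<in>paths B. f (vershik B x) = c * f x"
    using ev unfolding continuous_eigenvalue_def by auto
  obtain y where y: "min_path B y" using properly_ordered_word unfolding properly_ordered_def by blast
  then have yp: "y \<in> paths B" and y0: "\<And>n. n \<ge> 1 \<Longrightarrow> snd (y n) = 0" by (auto simp: min_path_iff)
  have ya: "fst (y n) = a" if "n \<ge> 1" for n
    using pathsD(3)[OF yp that] y0 word_first[of "Suc n"] that by simp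
  have "\<exists>u v. u \<in> cylinder B y n \<and> v \<in> cylinder B y n \<and> norm (f u) = norm (f x0) \<and>
      f v = c ^ sum_list (map (height n) (take (q n) (W (Suc n) (j n)))) * f u"
    if n: "n \<ge> N" "n \<ge> 1" for n
  proof -
    let ?w = "W (Suc n) (j n)" and ?h = "height n"
    have qn: "q n < length ?w" "?w ! q n = a" using q n by auto
    obtain p where p: "p < length (W (Suc (Suc n)) (fst (x0 (Suc (Suc n)))))"
      "W (Suc (Suc n)) (fst (x0 (Suc (Suc n)))) ! p = j n" using letter_position[of "Suc (Suc n)"] by auto
    obtain z where z: "z \<in> paths B" "fst (z (Suc n)) = j n" using path_through[of "Suc n" "j n"] by auto
    \<comment> \<open>\<open>u r\<close> follows the minimal path up to level \<open>n\<close>, uses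
      position \<open>r\<close> at level \<open>Suc n\<close>, and then joins \<open>x0\<close>.
      Sharing the tail of \<open>x0\<close> puts it into the orbit of \<open>x0\<close>, so that
      \<open>f\<close> has the same modulus there for all \<open>n\<close>.\<close>
    define u where "u r = splice (Suc n) (splice n y r z) p x0" for r
    have u: "u r \<in> paths B" if "r < length ?w" "?w ! r = a" for r
      unfolding u_def using that p z ya n
      by (intro splice_in_paths f(2) yp) (auto simp: splice_def)
    have u_low: "u r m = y m" if "m \<le> n" for r m using that by (simp add: u_def splice_def)
    have u_n: "u r (Suc n) = (j n, r)" for r using z by (simp add: u_def splice_def)
    have u_high: "\<forall>m>Suc n. u r m = u r' m" for r r' by (simp add: u_def splice_def)
    have u_high0: "\<forall>m>Suc (Suc n). u r m = x0 m" "fst (u r (Suc (Suc n))) = fst (x0 (Suc (Suc n)))" for r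
      by (simp_all add: u_def splice_def)
    have w0: "0 < length ?w" "?w ! 0 = a" using word_nonempty[of "Suc n"] word_first[of "Suc n"] n by auto
    have ex: "exit_time (Suc n) (u r) = exit_time n y + sum_list (map ?h (drop (Suc r) ?w))" for r
    proof -
      have "exit_time n (u r) = exit_time n y" using u_low by (intro exit_time_cong) auto
      then show ?thesis using n u_n by (simp add: exit_time.simps)
    qed
    have "sum_list (map ?h (take (q n) ?w)) + sum_list (map ?h (drop (q n) ?w)) = sum_list (map ?h (drop 0 ?w))"
      by (simp flip: sum_list_append map_append)
    then have "sum_list (map ?h (drop (Suc 0) ?w)) =
        sum_list (map ?h (drop (Suc (q n)) ?w)) + sum_list (map ?h (take (q n) ?w))"
      using sum_list_drop_nth[OF qn(1), of ?h] sum_list_drop_nth[OF w0(1), of ?h] qn w0 by simp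
    then have "(vershik B ^^ sum_list (map ?h (take (q n) ?w))) (u 0) = u (q n)"
      using u_high u_n ex by (intro vershik_funpow[OF u[OF w0] u[OF qn], of "Suc n"]) auto
    then have "f (u (q n)) = c ^ sum_list (map ?h (take (q n) ?w)) * f (u 0)"
      using eigenfunction_funpow[OF inv u[OF w0]] by metis
    moreover have "u r \<in> cylinder B y n" if "r < length ?w" "?w ! r = a" for r
      using u[OF that] u_low by (simp add: cylinder_def)
    moreover have "norm (f (u 0)) = norm (f x0)"
    proof -
      obtain d where "(vershik B ^^ d) (u 0) = x0 \<or> (vershik B ^^ d) x0 = u 0"
        using same_tail_orbit[OF u[OF w0] f(2), of "Suc (Suc n)"] u_high0 by auto
      then show ?thesis
        using eigenfunction_funpow[OF inv u[OF w0], of d] eigenfunction_funpow[OF inv f(2), of d] c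
        by (auto simp: norm_mult norm_power)
    qed
    ultimately show ?thesis using w0 qn by blast
  qed
  then obtain u v where u: "\<And>n. n \<ge> max N 1 \<Longrightarrow> u n \<in> cylinder B y n"
    and v: "\<And>n. n \<ge> max N 1 \<Longrightarrow> v n \<in> cylinder B y n"
    and fu: "\<And>n. n \<ge> max N 1 \<Longrightarrow> norm (f (u n)) = norm (f x0)"
    and fv: "\<And>n. n \<ge> max N 1 \<Longrightarrow> f (v n) = c ^ sum_list (map (height n) (take (q n) (W (Suc n) (j n)))) * f (u n)"
    by (metis max.bounded_iff)
  have lim: "(\<lambda>n. f (t n)) \<longlonglongrightarrow> f y" if t: "\<And>n. n \<ge> max N 1 \<Longrightarrow> t n \<in> cylinder B y n" for t
  proof (rule topological_tendstoI)
    fix S :: "complex set" assume "open S" "f y \<in> S"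
    then have "openin (path_space B) {x \<in> topspace (path_space B). f x \<in> S}" "y \<in> {x \<in> topspace (path_space B). f x \<in> S}"
      using openin_continuous_map_preimage[OF f(1)] yp by auto
    then obtain m where m: "cylinder B y m \<subseteq> {x \<in> topspace (path_space B). f x \<in> S}"
      unfolding openin_path_space by blast
    have "f (t n) \<in> S" if "n \<ge> max m (max N 1)" for n
      using m t[of n] cylinder_antimono[of m n B y] that by auto
    then show "\<forall>\<^sub>F n in sequentially. f (t n) \<in> S" unfolding eventually_sequentially by blast
  qed
  \<comment> \<open>Continuity carries the constant modulus to the minimal path, so the limit of the
    quotients has a nonzero denominator.\<close>
  have "(\<lambda>n. norm (f (u n))) \<longlonglongrightarrow> norm (f y)" by (intro tendsto_norm lim u)
  moreover have "(\<lambda>n. norm (f (u n))) \<longlonglongrightarrow> norm (f x0)"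
    by (intro tendsto_eventually eventually_sequentiallyI[of "max N 1"] fu)
  ultimately have "norm (f y) = norm (f x0)" by (rule LIMSEQ_unique)
  then have "f y \<noteq> 0" using f(3) by auto
  then have "(\<lambda>n. f (v n) / f (u n)) \<longlonglongrightarrow> f y / f y" by (intro tendsto_divide lim u v)
  moreover have "\<forall>\<^sub>F n in sequentially. f (v n) / f (u n) = c ^ sum_list (map (height n) (take (q n) (W (Suc n) (j n))))"
    unfolding eventually_sequentially
  proof (intro exI allI impI)
    fix n assume n: "max N 1 \<le> n"
    have "f (u n) \<noteq> 0" using fu[OF n] f(3) by auto
    then show "f (v n) / f (u n) = c ^ sum_list (map (height n) (take (q n) (W (Suc n) (j n))))"
      using fv[OF n] by simp
  qed
  ultimately show ?thesis using \<open>f y \<noteq> 0\<close> by (simp add: tendsto_cong)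
qed

end

section \<open>Best orderings\<close>

lemma two_neq_one: "(2::2) \<noteq> 1"
  by simp

lemma count_list_2: "count_list xs (1::2) + count_list xs 2 = length xs"
proof (induction xs)
  case (Cons x xs)
  then show ?case using exhaust_2[of x] two_neq_one by auto
qed simp

lemma sum_list_count_2:
  fixes f :: "2 \<Rightarrow> 'a::semiring_1"
  shows "sum_list (map f xs) = of_nat (count_list xs 1) * f 1 + of_nat (count_list xs 2) * f 2"
proof (induction xs)
  case (Cons x xs)
  then show ?case using exhaust_2[of x] two_neq_one by (auto simp: algebra_simps)
qed simp

lemma inner_sum_axis: "sum_list (map (\<lambda>j. axis j 1) p) \<bullet> w = sum_list (map (($) w) p)"
  for w :: "real^'n"
  by (induction p) (auto simp: inner_add_left inner_axis')

text \<open>\<open>inner_pos\<close> is the ratio condition \<open>|w_1| / |w_2| < h_2 / h_1\<close>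
  with denominators cleared, for the signs that occur here.\<close>

locale best_word =
  fixes w :: "real^2" and h :: "nat^2"
  assumes w1: "w $ 1 < 0" and w2: "- w $ 1 < w $ 2" and h1: "h $ 1 > 0"
    and inner_pos: "real (h $ 1) * w $ 1 + real (h $ 2) * w $ 2 > 0"
begin

definition target :: real where
  "target = real (h $ 1) * w $ 1 + real (h $ 2) * w $ 2"

text \<open>The value reached after \<open>i\<close> letters; \<open>target - val i\<close> is the
  pairing of \<open>w\<close> with the letters still to come, and its sign decides the next
  letter.\<close>

definition val :: "nat \<Rightarrow> real" where
  "val i = sum_list (map (($) w) (best_prefix w h i))"

definition letter :: "nat \<Rightarrow> 2" where
  "letter i = (if val i > target then 1 else 2)"

lemma best_prefix_Suc: "best_prefix w h (Suc i) = best_prefix w h i @ [letter i]"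
proof -
  have "real_vec h \<bullet> w = target"
    by (simp add: inner_vec_def sum_2 real_vec_def target_def)
  then show ?thesis
    by (simp add: Let_def letter_def val_def inner_diff_left inner_sum_axis)
qed

lemma length_best_prefix: "length (best_prefix w h i) = i"
  by (induction i) (auto simp: best_prefix_Suc simp del: best_prefix.simps(2))

lemma val_Suc: "val (Suc i) = val i + w $ letter i"
  by (simp add: val_def best_prefix_Suc del: best_prefix.simps(2))

lemma val_0: "val 0 = 0"
  by (simp add: val_def)

lemma take_best_prefix:
  assumes "i \<le> n" shows "take i (best_prefix w h n) = best_prefix w h i"
  using assms
proof (induction n rule: dec_induct)
  case (step n)
  then show ?case by (simp add: best_prefix_Suc length_best_prefix del: best_prefix.simps(2))
qed (simp add: length_best_prefix)

lemma nth_best_prefix: "i < n \<Longrightarrow> best_prefix w h n ! i = letter i"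
  using take_best_prefix[of "Suc i" n] take_Suc_conv_app_nth[of i "best_prefix w h n"]
  by (simp add: best_prefix_Suc length_best_prefix del: best_prefix.simps(2))

lemma w2_pos: "w $ 2 > 0"
  using w1 w2 by linarith

text \<open>The bound allows one step beyond \<open>target\<close>: a letter is chosen from the
  value before it, so the first value above \<open>target\<close> is still a multiple of
  \<open>w $ 2\<close>.\<close>

lemma before_crossing: "real i * w $ 2 \<le> target + w $ 2 \<Longrightarrow> val i = real i * w $ 2"
proof (induction i)
  case (Suc i)
  then have "real i * w $ 2 \<le> target" by (simp add: algebra_simps)
  then have "val i = real i * w $ 2" using Suc w2_pos by (simp add: algebra_simps)
  then have "letter i = 2" using \<open>real i * w $ 2 \<le> target\<close> by (simp add: letter_def)
  then show ?case using \<open>val i = _\<close> by (simp add: val_Suc algebra_simps)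
qed (simp add: val_0)

lemma letter_before_crossing: "real i * w $ 2 \<le> target \<Longrightarrow> letter i = 2"
  using before_crossing[of i] w2_pos by (simp add: letter_def)

text \<open>The window \<open>]w_1, w_2]\<close> for \<open>val i - target\<close> is invariant: a
  positive difference is lowered by \<open>-w_1 < w_2\<close>, and a nonpositive one raised by
  \<open>w_2 > -w_1\<close>. The first crossing enters the window from below with a step
  \<open>w_2\<close>.\<close>

lemma after_crossing:
  "real i * w $ 2 > target \<Longrightarrow> w $ 1 < val i - target \<and> val i - target \<le> w $ 2"
proof (induction i)
  case 0
  then show ?case using inner_pos by (simp add: target_def)
next
  case (Suc i)
  show ?case
  proof (cases "real i * w $ 2 \<le> target")
    case True
    then have "val (Suc i) = real (Suc i) * w $ 2"
      by (intro before_crossing) (simp add: algebra_simps)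
    then show ?thesis using Suc.prems True w1 by (simp add: algebra_simps)
  next
    case False
    then have "w $ 1 < val i - target \<and> val i - target \<le> w $ 2" using Suc.IH by simp
    then show ?thesis using w1 w2 by (auto simp: val_Suc letter_def)
  qed
qed

lemma val_counts:
  "val i = real (count_list (best_prefix w h i) 1) * w $ 1 + real (count_list (best_prefix w h i) 2) * w $ 2"
  unfolding val_def by (rule sum_list_count_2)

text \<open>No letter is overused: once all letters \<open>1\<close> are spent, the remainder
  consists of letters \<open>2\<close> and has nonnegative pairing, so the rule cannot choose
  \<open>1\<close>; once all letters \<open>2\<close> are spent, it is negative and forces
  \<open>1\<close>. Hence the word has exactly the prescribed counts.\<close>

lemma counts_le:
  "i \<le> h $ 1 + h $ 2 \<Longrightarrow> count_list (best_prefix w h i) 1 \<le> h $ 1 \<and> count_list (best_prefix w h i) 2 \<le> h $ 2"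
proof (induction i)
  case (Suc i)
  let ?c = "count_list (best_prefix w h i)"
  have IH: "?c 1 \<le> h $ 1" "?c 2 \<le> h $ 2" using Suc by auto
  have sum: "?c 1 + ?c 2 = i" using count_list_2[of "best_prefix w h i"] by (simp add: length_best_prefix)
  have v: "val i - target = (real (?c 1) - real (h $ 1)) * w $ 1 + (real (?c 2) - real (h $ 2)) * w $ 2"
    by (simp add: val_counts target_def algebra_simps)
  show ?case
  proof (cases "val i > target")
    case True
    then have "letter i = 1" by (simp add: letter_def)
    moreover have "?c 1 \<noteq> h $ 1"
    proof
      assume "?c 1 = h $ 1"
      then have "val i - target = (real (?c 2) - real (h $ 2)) * w $ 2" using v by simp
      moreover have "\<dots> \<le> 0" using IH w2_pos by (intro mult_nonpos_nonneg) auto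
      ultimately show False using True by simp
    qed
    ultimately show ?thesis using IH two_neq_one by (simp add: best_prefix_Suc del: best_prefix.simps(2))
  next
    case False
    then have "letter i = 2" by (simp add: letter_def)
    moreover have "?c 2 \<noteq> h $ 2"
    proof
      assume eq: "?c 2 = h $ 2"
      then have "?c 1 < h $ 1" using sum Suc.prems by simp
      then have "(real (?c 1) - real (h $ 1)) * w $ 1 > 0" using w1 by (intro mult_neg_neg) auto
      then show False using v eq False by simp
    qed
    ultimately show ?thesis using IH two_neq_one by (simp add: best_prefix_Suc del: best_prefix.simps(2))
  qed
qed simp

lemma length_best_ordering: "length (best_ordering w h) = h $ 1 + h $ 2"
  by (simp add: best_ordering_def length_best_prefix)

lemma count_best_ordering: "count_list (best_ordering w h) j = h $ j"
proof -
  have "count_list (best_ordering w h) 1 \<le> h $ 1" "count_list (best_ordering w h) 2 \<le> h $ 2"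
    using counts_le[of "h $ 1 + h $ 2"] by (auto simp: best_ordering_def)
  moreover have "count_list (best_ordering w h) 1 + count_list (best_ordering w h) 2 = h $ 1 + h $ 2"
    using count_list_2[of "best_ordering w h"] by (simp add: length_best_ordering)
  ultimately show ?thesis using exhaust_2[of j] by auto
qed

lemma nth_best_ordering: "i < h $ 1 + h $ 2 \<Longrightarrow> best_ordering w h ! i = letter i"
  by (simp add: best_ordering_def nth_best_prefix)

lemma val_end: "val (h $ 1 + h $ 2) = target"
  using count_best_ordering by (simp add: val_counts best_ordering_def target_def)

lemma h2: "h $ 2 > 0"
proof (rule ccontr)
  assume "\<not> h $ 2 > 0"
  then show False using inner_pos mult_nonneg_nonpos[of "real (h $ 1)" "w $ 1"] w1 by simp
qed

lemma hd_best_ordering: "hd (best_ordering w h) = 2"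
proof -
  have "hd (best_ordering w h) = letter 0"
    using nth_best_ordering[of 0] length_best_ordering h1 by (metis add_gr_0 hd_conv_nth length_greater_0_conv)
  then show ?thesis using inner_pos by (simp add: letter_def val_0 target_def)
qed

text \<open>The last index is past the crossing, since \<open>h $ 1 > 0\<close>. A final
  \<open>2\<close> would put the previous difference at \<open>-w_2\<close>, which is below the
  window.\<close>

lemma last_best_ordering: "last (best_ordering w h) = 1"
proof -
  define i where "i = h $ 1 + h $ 2 - 1"
  have i: "Suc i = h $ 1 + h $ 2" using h1 by (simp add: i_def)
  have "last (best_ordering w h) = letter i"
    using nth_best_ordering[of i] i length_best_ordering
    by (metis diff_Suc_1 last_conv_nth length_0_conv lessI nat.distinct(1))
  moreover have "letter i \<noteq> 2"
  proof
    assume l: "letter i = 2"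
    have "real (h $ 2) \<le> real i" using i h1 by linarith
    then have "real (h $ 2) * w $ 2 \<le> real i * w $ 2" using w2_pos by (intro mult_right_mono) auto
    moreover have "real (h $ 1) * w $ 1 < 0" using h1 w1 by (intro mult_pos_neg) auto
    ultimately have "real i * w $ 2 > target" by (simp add: target_def)
    then have "w $ 1 < val i - target" using after_crossing by blast
    moreover have "val i + w $ 2 = target" using val_Suc[of i] val_end i l by simp
    ultimately show False using w2 by simp
  qed
  ultimately show ?thesis using exhaust_2 by metis
qed

lemma set_best_ordering: "set (best_ordering w h) = UNIV"
proof -
  have "j \<in> set (best_ordering w h)" for j
    using count_best_ordering[of j] exhaust_2[of j] h1 h2 by (metis count_list_0_iff less_numeral_extra(3))
  then show ?thesis by blast
qed

text \<open>The sum is \<open>target - val (Suc q)\<close>, up to sign the difference confined to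
  the window. This is the bound that makes phases summable along good edges.\<close>

lemma sum_drop_best_ordering:
  assumes q: "q < h $ 1 + h $ 2" and large: "real (Suc q) * w $ 2 > target"
  shows "\<bar>sum_list (map (($) w) (drop (Suc q) (best_ordering w h)))\<bar> \<le> w $ 2"
proof -
  have "sum_list (map (($) w) (take (Suc q) (best_ordering w h))) +
      sum_list (map (($) w) (drop (Suc q) (best_ordering w h))) = val (h $ 1 + h $ 2)"
    unfolding val_def best_ordering_def by (simp del: best_prefix.simps flip: sum_list_append map_append)
  moreover have "take (Suc q) (best_ordering w h) = best_prefix w h (Suc q)"
    unfolding best_ordering_def using q by (intro take_best_prefix) simp
  ultimately have "sum_list (map (($) w) (drop (Suc q) (best_ordering w h))) = target - val (Suc q)"
    using val_end by (simp add: val_def del: best_prefix.simps)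
  then show ?thesis using after_crossing[OF large] w1 w2 by (simp add: abs_le_iff)
qed

lemma take_best_ordering:
  assumes "real q * w $ 2 \<le> target + w $ 2" "q \<le> h $ 1 + h $ 2"
  shows "take q (best_ordering w h) = replicate q 2"
proof (rule nth_equalityI)
  show "length (take q (best_ordering w h)) = length (replicate q (2::2))"
    using assms(2) by (simp add: length_best_ordering)
  fix i assume "i < length (take q (best_ordering w h))"
  then have i: "i < q" by simp
  then have "real (Suc i) * w $ 2 \<le> real q * w $ 2" using w2_pos by (intro mult_right_mono) auto
  then have "letter i = 2" using assms(1) by (intro letter_before_crossing) (simp add: algebra_simps)
  then show "take q (best_ordering w h) ! i = replicate q 2 ! i"
    using i assms(2) by (simp add: nth_best_ordering)
qed

end

section \<open>Powers of the Fibonacci matrix\<close>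

lemma golden_ratio_sq: "golden_ratio\<^sup>2 = golden_ratio + 1"
  by (simp add: golden_ratio_def power2_eq_square field_simps)

lemma golden_ratio_bounds: "3 / 2 < golden_ratio" "golden_ratio < 2"
  using real_less_rsqrt[of 2 5] real_less_lsqrt[of 3 5] by (auto simp: golden_ratio_def)

lemma map_matrix_mult:
  fixes A :: "nat^'n^'m" and B :: "nat^'k^'n"
  shows "map_matrix real (A ** B) = map_matrix real A ** map_matrix real B"
  by (simp add: vec_eq_iff map_matrix_def matrix_matrix_mult_def)

lemma map_matrix_mat_1: "map_matrix real (mat 1 :: nat^'n^'n) = mat 1"
  by (simp add: vec_eq_iff map_matrix_def mat_def)

definition fib_act :: "nat \<Rightarrow> real^2 \<Rightarrow> real^2" where
  "fib_act k x = map_matrix real (mat_power (fib_mat :: nat^2^2) k) *v x"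

lemma fib_act_0: "fib_act 0 x = x"
  by (simp add: fib_act_def mat_power_def map_matrix_mat_1 del: One_nat_def)

lemma fib_act_Suc:
  "fib_act (Suc k) x $ 1 = fib_act k x $ 1 + fib_act k x $ 2"
  "fib_act (Suc k) x $ 2 = fib_act k x $ 1"
proof -
  have "fib_act (Suc k) x = map_matrix real (fib_mat :: nat^2^2) *v fib_act k x"
    by (simp add: fib_act_def mat_power_def map_matrix_mult matrix_vector_mul_assoc)
  then show "fib_act (Suc k) x $ 1 = fib_act k x $ 1 + fib_act k x $ 2"
    "fib_act (Suc k) x $ 2 = fib_act k x $ 1"
    by (simp_all add: matrix_vector_mult_def sum_2 map_matrix_def fib_mat_def)
qed

lemma fib_act_add: "fib_act k (x + y) = fib_act k x + fib_act k y"
  by (simp add: fib_act_def matrix_vector_right_distrib)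

lemma fib_act_scaleR: "fib_act k (c *\<^sub>R x) = c *\<^sub>R fib_act k x"
  by (simp add: fib_act_def matrix_vector_mult_scaleR)

lemma fib_act_nth:
  "fib_act k x $ j = real (mat_power fib_mat k $ j $ 1) * x $ 1 + real (mat_power fib_mat k $ j $ 2) * x $ 2"
  by (simp add: fib_act_def matrix_vector_mult_def sum_2 map_matrix_def)

lemma fib_act_mono:
  assumes "x $ 1 \<le> y $ 1" "x $ 2 \<le> y $ 2"
  shows "fib_act k x $ j \<le> fib_act k y $ j"
  unfolding fib_act_nth using assms by (intro add_mono mult_left_mono) auto

lemma fib_act_ordered:
  assumes "x $ 2 \<le> x $ 1" "0 \<le> x $ 2"
  shows "fib_act k x $ 2 \<le> fib_act k x $ 1 \<and> 0 \<le> fib_act k x $ 2"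
proof (induction k)
  case (Suc k)
  then show ?case unfolding fib_act_Suc by linarith
qed (simp add: fib_act_0 assms)

lemma mat_power_fib_Suc:
  "mat_power (fib_mat :: nat^2^2) (Suc k) $ 1 $ j = mat_power fib_mat k $ 1 $ j + mat_power fib_mat k $ 2 $ j"
  "mat_power (fib_mat :: nat^2^2) (Suc k) $ 2 $ j = mat_power fib_mat k $ 1 $ j"
  by (simp_all add: mat_power_def matrix_matrix_mult_def sum_2 fib_mat_def)

lemma mat_power_fib_pos:
  assumes "k \<ge> 2" shows "mat_power (fib_mat :: nat^2^2) k $ i $ j > 0"
proof -
  have "\<forall>i j. mat_power (fib_mat :: nat^2^2) k $ i $ j > 0"
    using assms
  proof (induction k rule: dec_induct)
    case base
    show ?case
      by (simp add: forall_2 numeral_2_eq_2 mat_power_fib_Suc) (simp add: mat_power_def mat_def)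
  next
    case (step k)
    then show ?case by (simp add: forall_2 mat_power_fib_Suc)
  qed
  then show ?thesis by blast
qed

definition int_vecs :: "(real^2) set" where
  "int_vecs = {x. x $ 1 \<in> \<int> \<and> x $ 2 \<in> \<int>}"

lemma int_vecs_real_ivec: "int_vecs = range real_ivec"
proof
  show "int_vecs \<subseteq> range real_ivec"
  proof
    fix x assume "x \<in> int_vecs"
    then obtain p q where "x $ 1 = real_of_int p" "x $ 2 = real_of_int q"
      by (auto simp: int_vecs_def elim!: Ints_cases)
    then have "x = real_ivec (vector [p, q])" by (simp add: vec_eq_iff forall_2 real_ivec_def)
    then show "x \<in> range real_ivec" by blast
  qed
qed (auto simp: int_vecs_def real_ivec_def)

lemma int_vecs_add: "x \<in> int_vecs \<Longrightarrow> y \<in> int_vecs \<Longrightarrow> x + y \<in> int_vecs"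
  by (auto simp: int_vecs_def)

lemma int_vecs_diff: "x \<in> int_vecs \<Longrightarrow> y \<in> int_vecs \<Longrightarrow> x - y \<in> int_vecs"
  by (auto simp: int_vecs_def)

lemma int_vecs_fib_act: "x \<in> int_vecs \<Longrightarrow> fib_act k x \<in> int_vecs"
  by (induction k) (auto simp: fib_act_0 int_vecs_def fib_act_Suc)

locale golden_basis =
  fixes e_u e_s :: "real^2"
  assumes norm_u: "norm e_u = 1" and norm_s: "norm e_s = 1" and orth: "e_u \<bullet> e_s = 0"
    and eigen_u: "fib_mat *v e_u = golden_ratio *\<^sub>R e_u"
    and pos_u: "e_u $ 2 > 0" and pos_s: "e_s $ 2 > 0"
begin

abbreviation \<phi> :: real where "\<phi> \<equiv> golden_ratio"

text \<open>The common normalising factor \<open>1 / sqrt (\<phi> + 2)\<close> of the eigenvectors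
  \<open>(\<phi>, 1)\<close> and \<open>(-1, \<phi>)\<close>.\<close>

definition s :: real where "s = e_u $ 2"

lemma s_pos: "s > 0"
  using pos_u by (simp add: s_def)

lemma e_u_nth: "e_u $ 1 = \<phi> * s" "e_u $ 2 = s"
proof -
  have "(fib_mat *v e_u) $ 2 = \<phi> * e_u $ 2" using eigen_u by simp
  then show "e_u $ 1 = \<phi> * s" by (simp add: matrix_vector_mult_def sum_2 fib_mat_def s_def)
qed (simp add: s_def)

lemma s_sq: "s\<^sup>2 * (\<phi> + 2) = 1"
proof -
  have "e_u \<bullet> e_u = 1" using norm_u by (simp add: norm_eq_sqrt_inner)
  then have "(\<phi> * s)\<^sup>2 + s\<^sup>2 = 1" by (simp add: inner_vec_def sum_2 e_u_nth power2_eq_square)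
  moreover have "(\<phi> * s)\<^sup>2 = (\<phi> + 1) * s\<^sup>2" by (simp add: power_mult_distrib golden_ratio_sq)
  ultimately show ?thesis by (simp add: algebra_simps)
qed

text \<open>Orthogonality to \<open>e_u\<close> and norm one determine \<open>e_s\<close> up to
  sign, and \<open>pos_s\<close> fixes the sign.\<close>

lemma e_s_nth: "e_s $ 1 = - s" "e_s $ 2 = \<phi> * s"
proof -
  have "s * (\<phi> * e_s $ 1 + e_s $ 2) = 0"
    using orth by (simp add: inner_vec_def sum_2 e_u_nth algebra_simps)
  then have 2: "e_s $ 2 = - \<phi> * e_s $ 1" using s_pos by simp
  have "e_s \<bullet> e_s = 1" using norm_s by (simp add: norm_eq_sqrt_inner)
  then have "(e_s $ 1)\<^sup>2 + (\<phi> * e_s $ 1)\<^sup>2 = 1"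
    by (simp add: inner_vec_def sum_2 2 power2_eq_square)
  then have "(e_s $ 1)\<^sup>2 * (\<phi> + 2) = s\<^sup>2 * (\<phi> + 2)"
    unfolding s_sq power_mult_distrib golden_ratio_sq by (simp add: distrib_left distrib_right mult.commute)
  then have "(e_s $ 1)\<^sup>2 = s\<^sup>2" using golden_ratio_bounds by simp
  moreover have "e_s $ 1 < 0"
    using 2 pos_s golden_ratio_bounds by (simp add: zero_less_mult_iff mult_less_0_iff)
  ultimately show 1: "e_s $ 1 = - s" using s_pos by (auto simp: power2_eq_iff)
  show "e_s $ 2 = \<phi> * s" using 1 2 by simp
qed

lemma s_bounds: "1 / 2 < s" "s < 1"
proof -
  have "s\<^sup>2 * (\<phi> + 2) < s\<^sup>2 * 4" using golden_ratio_bounds s_pos by simp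
  then have "(1 / 2)\<^sup>2 < s\<^sup>2" using s_sq by (simp add: power2_eq_square)
  then show "1 / 2 < s" by (rule power2_less_imp_less) (use s_pos in simp)
  have "s\<^sup>2 * 1 < s\<^sup>2 * (\<phi> + 2)" using golden_ratio_bounds s_pos by (intro mult_strict_left_mono) auto
  then have "s\<^sup>2 < 1\<^sup>2" using s_sq by simp
  then show "s < 1" by (rule power2_less_imp_less) simp
qed

text \<open>\<open>\<rho>\<close> and \<open>\<sigma>\<close> are the eigenvalues
  \<open>\<phi>^(-2)\<close> and \<open>\<phi>^2\<close> of the squared matrix, written linearly in
  \<open>\<phi>\<close>.\<close>

definition \<rho> :: real where "\<rho> = 2 - \<phi>"
definition \<sigma> :: real where "\<sigma> = \<phi> + 1"

lemma \<rho>_bounds: "0 < \<rho>" "\<rho> < 1 / 2" and \<sigma>_bounds: "2 < \<sigma>"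
  using golden_ratio_bounds by (auto simp: \<rho>_def \<sigma>_def)

lemma \<rho>\<sigma>: "\<rho> * \<sigma> = 1"
  using golden_ratio_sq by (simp add: \<rho>_def \<sigma>_def algebra_simps power2_eq_square)

lemma \<rho>\<sigma>_power: "\<rho> ^ n * \<sigma> ^ n = 1"
  by (simp add: power_mult_distrib[symmetric] \<rho>\<sigma>)

lemma fib_act_u: "fib_act (2 * k) e_u = \<sigma> ^ k *\<^sub>R e_u"
proof (induction k)
  case (Suc k)
  have "\<phi> * (\<phi> * (s * \<sigma> ^ k)) = (\<phi> + 1) * (s * \<sigma> ^ k)"
    using golden_ratio_sq by (simp add: power2_eq_square flip: mult.assoc)
  then show ?case using Suc
    by (simp add: vec_eq_iff forall_2 fib_act_Suc e_u_nth \<sigma>_def algebra_simps)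
qed (simp add: fib_act_0)

lemma fib_act_s: "fib_act (2 * k) e_s = \<rho> ^ k *\<^sub>R e_s"
proof (induction k)
  case (Suc k)
  have "\<phi> * (\<phi> * (s * \<rho> ^ k)) = (\<phi> + 1) * (s * \<rho> ^ k)"
    using golden_ratio_sq by (simp add: power2_eq_square flip: mult.assoc)
  then show ?case using Suc
    by (simp add: vec_eq_iff forall_2 fib_act_Suc e_s_nth \<rho>_def algebra_simps)
qed (simp add: fib_act_0)

lemma fib_act_coords:
  "fib_act (2 * k) (x *\<^sub>R e_u + y *\<^sub>R e_s) = (x * \<sigma> ^ k) *\<^sub>R e_u + (y * \<rho> ^ k) *\<^sub>R e_s"
  by (simp add: fib_act_add fib_act_scaleR fib_act_u fib_act_s)

text \<open>The negative contracting coordinate matters: subtracting \<open>A^(2m) (1, 0)\<close>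
  adds \<open>s \<rho>^m\<close> to the contracting coordinate, which is the source of the positive
  numbers \<open>v n\<close>.\<close>

lemma axis_coords: "vector [1, 0] = (\<phi> * s) *\<^sub>R e_u + (- s) *\<^sub>R e_s"
proof -
  have "s * s * (\<phi> + 2) = 1" using s_sq by (simp add: power2_eq_square)
  moreover have "\<phi> * \<phi> = \<phi> + 1" using golden_ratio_sq by (simp add: power2_eq_square)
  ultimately show ?thesis
    by (simp add: vec_eq_iff forall_2 e_u_nth e_s_nth) algebra
qed

lemma ones_coords: "vector [1, 1] = (\<sigma> * s) *\<^sub>R e_u + ((\<phi> - 1) * s) *\<^sub>R e_s"
proof -
  have "s * s * (\<phi> + 2) = 1" using s_sq by (simp add: power2_eq_square)
  moreover have "\<phi> * \<phi> = \<phi> + 1" using golden_ratio_sq by (simp add: power2_eq_square)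
  ultimately show ?thesis
    by (simp add: vec_eq_iff forall_2 e_u_nth e_s_nth \<sigma>_def) algebra
qed

lemma coords_eq_iff:
  "x *\<^sub>R e_u + y *\<^sub>R e_s = x' *\<^sub>R e_u + y' *\<^sub>R e_s \<longleftrightarrow> x = x' \<and> y = y'"
proof
  assume "x *\<^sub>R e_u + y *\<^sub>R e_s = x' *\<^sub>R e_u + y' *\<^sub>R e_s" (is "?l = ?r")
  then have "?l \<bullet> e_u = ?r \<bullet> e_u" "?l \<bullet> e_s = ?r \<bullet> e_s" by simp_all
  then show "x = x' \<and> y = y'"
    using norm_u norm_s orth by (simp add: inner_add_left inner_add_right inner_commute norm_eq_1)
qed simp

end

section \<open>Construction of the parameters\<close>

text \<open>Solved forwards, the recursion would divide by the small \<open>a n\<close> and blow up.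
  Unrolling it towards infinity gives the series of the terms \<open>t n i\<close>, dominated by a
  geometric series of ratio \<open>1/2\<close>.\<close>

lemma backward_recursion:
  fixes a b :: "nat \<Rightarrow> real"
  assumes a: "\<And>n. n \<ge> 1 \<Longrightarrow> 0 \<le> a n \<and> a n \<le> 1 / 2"
    and b: "\<And>n. n \<ge> 1 \<Longrightarrow> 0 \<le> b n \<and> b n \<le> c"
  shows "\<exists>u. \<forall>n\<ge>1. u n = a n * u (Suc n) + b n \<and> 0 \<le> u n \<and> u n \<le> 2 * c"
proof -
  define t where "t n i = (\<Prod>l<i. a (n + l)) * b (n + i)" for n i
  have c: "0 \<le> c" using b[of 1] by simp
  have t0: "t n 0 = b n" and tS: "t n (Suc i) = a n * t (Suc n) i" for n i
    by (simp_all add: t_def prod.lessThan_Suc_shift del: prod.lessThan_Suc)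
  have t_bounds: "0 \<le> t n i \<and> t n i \<le> c * (1 / 2) ^ i" if "n \<ge> 1" for n i
    using that
  proof (induction i arbitrary: n)
    case 0
    then show ?case using b by (simp add: t0)
  next
    case (Suc i)
    have "a n * t (Suc n) i \<le> (1 / 2) * (c * (1 / 2) ^ i)"
      using a[OF Suc.prems] Suc.IH[of "Suc n"] by (intro mult_mono) auto
    then show ?case using a[OF Suc.prems] Suc.IH[of "Suc n"] by (simp add: tS)
  qed
  have geo: "summable (\<lambda>i. c * (1 / 2) ^ i)" by (intro summable_mult summable_geometric) simp
  have t_sum: "summable (t n)" if "n \<ge> 1" for n
    using t_bounds[OF that] by (intro summable_comparison_test[OF _ geo]) auto
  have "(\<Sum>i. t n i) = a n * (\<Sum>i. t (Suc n) i) + b n" if n: "n \<ge> 1" for n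
    using suminf_split_head[OF t_sum[OF n]] suminf_mult[OF t_sum[of "Suc n"], of "a n"]
    by (simp add: t0 tS)
  moreover have "0 \<le> (\<Sum>i. t n i)" if n: "n \<ge> 1" for n
    using t_bounds[OF n] by (intro suminf_nonneg t_sum n) auto
  moreover have "(\<Sum>i. t n i) \<le> 2 * c" if n: "n \<ge> 1" for n
  proof -
    have "(\<Sum>i. t n i) \<le> (\<Sum>i. c * (1 / 2) ^ i)"
      using t_bounds[OF n] by (intro suminf_le t_sum n geo) auto
    also have "\<dots> = c * (\<Sum>i. (1 / 2) ^ i)" by (rule suminf_mult) (simp add: summable_geometric)
    also have "\<dots> = 2 * c" using suminf_geometric[of "1 / 2 :: real"] by simp
    finally show ?thesis .
  qed
  ultimately show ?thesis by (intro exI[of _ "\<lambda>n. \<Sum>i. t n i"] allI impI conjI)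
qed

lemma small_power:
  fixes r e :: real
  assumes "0 \<le> r" "r < 1" "0 < e"
  obtains k where "k \<ge> 1" "r ^ k \<le> e"
proof -
  obtain k where "r ^ k < e" using real_arch_pow_inv assms by blast
  then have "r ^ Suc k \<le> e" using power_Suc_le_self[of r k] mult_left_le_one_le[of "r ^ k" r] assms by simp
  then show thesis using that[of "Suc k"] by simp
qed

text \<open>\<open>\<kappa>\<close> and \<open>\<mu>\<close> are half-exponents:
  \<open>k n = 2 * \<kappa> n\<close>, and \<open>A^(2 * \<mu> n) (1, 0)\<close> is the integer
  vector removed on reaching level \<open>n\<close>. The factor \<open>1/4\<close> in
  \<open>u_le\<close> yields \<open>\<phi> * u n < v n\<close>, hence a negative first coordinate of
  \<open>w n\<close>; \<open>contraction\<close> bounds the contracting part of the total phase of a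
  word.\<close>

locale golden_sequences = golden_basis +
  fixes \<kappa> \<mu> :: "nat \<Rightarrow> nat" and \<alpha> :: real and u v \<delta> :: "nat \<Rightarrow> real"
  assumes \<kappa>_pos: "n \<ge> 2 \<Longrightarrow> \<kappa> n \<ge> 1"
    and \<delta>_pos: "n \<ge> 1 \<Longrightarrow> 0 < \<delta> n" and \<delta>_le: "n \<ge> 1 \<Longrightarrow> \<delta> n \<le> 1"
    and summable_\<delta>: "summable \<delta>"
    and u_pos: "n \<ge> 1 \<Longrightarrow> 0 < u n" and u_le: "n \<ge> 1 \<Longrightarrow> u n \<le> \<delta> n * v n / 4"
    and v_le: "n \<ge> 1 \<Longrightarrow> v n \<le> 2 * s * \<rho> ^ \<mu> n"
    and summable_\<mu>: "summable (\<lambda>n. \<rho> ^ \<mu> n)"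
    and contraction: "n \<ge> 1 \<Longrightarrow> \<rho> ^ \<kappa> (Suc n) \<le> \<delta> n"
    and \<alpha>_pos: "\<alpha> > 0"
    and start: "\<alpha> *\<^sub>R vector [1, 1] = u 1 *\<^sub>R e_u + v 1 *\<^sub>R e_s + vector [1, 0]"
    and step: "n \<ge> 1 \<Longrightarrow> fib_act (2 * \<kappa> (Suc n)) (u n *\<^sub>R e_u + v n *\<^sub>R e_s) =
      u (Suc n) *\<^sub>R e_u + v (Suc n) *\<^sub>R e_s + fib_act (2 * \<mu> (Suc n)) (vector [1, 0])"

text \<open>The translation by \<open>fib_act (2 * \<mu> (Suc n)) (vector [1, 0])\<close> brings the expanding coordinate
  back to a small value, so \<open>v\<close> is determined forwards and \<open>u\<close> backwards. All exponents are even,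
  so that the contracting eigenvalue is positive.\<close>

lemma (in golden_basis) golden_sequences_exist:
  fixes \<delta> \<epsilon> :: "nat \<Rightarrow> real"
  assumes \<epsilon>: "\<And>n. n \<ge> 1 \<Longrightarrow> 0 < \<epsilon> n" "summable \<epsilon>"
    and \<delta>: "\<And>n. n \<ge> 1 \<Longrightarrow> 0 < \<delta> n" "\<And>n. n \<ge> 1 \<Longrightarrow> \<delta> n \<le> 1" "summable \<delta>"
  shows "\<exists>\<kappa> \<mu> \<alpha> u v. golden_sequences e_u e_s \<kappa> \<mu> \<alpha> u v \<delta> \<and> (\<forall>n\<ge>2. \<rho> ^ \<mu> n \<le> \<epsilon> n)"
proof -
  have "\<exists>m. n \<ge> 2 \<longrightarrow> \<rho> ^ m \<le> \<epsilon> n" for n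
  proof (cases "n \<ge> 2")
    case True
    obtain m where "\<rho> ^ m \<le> \<epsilon> n"
      by (rule small_power[of \<rho> "\<epsilon> n"]) (use \<rho>_bounds \<epsilon>(1)[of n] True in auto)
    then show ?thesis by blast
  qed simp
  then obtain m0 where m0: "\<And>n. n \<ge> 2 \<Longrightarrow> \<rho> ^ m0 n \<le> \<epsilon> n" by metis
  \<comment> \<open>The vector removed in \<open>start\<close> is \<open>(1, 0)\<close> itself,
    hence exponent \<open>0\<close> at level \<open>1\<close>.\<close>
  define \<mu> where "\<mu> n = (if n \<le> 1 then 0 else m0 n)" for n
  have \<mu>1: "\<mu> 1 = 0" and \<mu>: "\<And>n. n \<ge> 2 \<Longrightarrow> \<rho> ^ \<mu> n \<le> \<epsilon> n" using m0 by (auto simp: \<mu>_def)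
  have \<rho>\<mu>: "0 < \<rho> ^ \<mu> n" "\<rho> ^ \<mu> n \<le> 1" for n using \<rho>_bounds by (auto intro: power_le_one)
  \<comment> \<open>Here \<open>\<rho> ^ \<mu> (Suc n)\<close> will cancel the growth
    \<open>\<sigma> ^ \<mu> (Suc n)\<close> of the removed vector, while
    \<open>\<delta> n * \<rho> ^ \<mu> n\<close> keeps \<open>u n\<close> below
    \<open>\<delta> n\<close> times \<open>v n\<close>, which is of size
    \<open>s * \<rho> ^ \<mu> n\<close>. The \<open>16\<close> absorbs constants.\<close>
  have "\<exists>k\<ge>1. \<rho> ^ k \<le> \<delta> n * \<rho> ^ \<mu> n * \<rho> ^ \<mu> (Suc n) / 16" if n: "n \<ge> 1" for n
  proof -
    obtain k where "k \<ge> 1" "\<rho> ^ k \<le> \<delta> n * \<rho> ^ \<mu> n * \<rho> ^ \<mu> (Suc n) / 16"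
      by (rule small_power[of \<rho> "\<delta> n * \<rho> ^ \<mu> n * \<rho> ^ \<mu> (Suc n) / 16"])
        (use \<rho>_bounds \<delta>(1)[OF n] \<rho>\<mu> in auto)
    then show ?thesis by blast
  qed
  then obtain k0 where k0: "\<And>n. n \<ge> 1 \<Longrightarrow> k0 n \<ge> 1 \<and> \<rho> ^ k0 n \<le> \<delta> n * \<rho> ^ \<mu> n * \<rho> ^ \<mu> (Suc n) / 16"
    by metis
  define \<kappa> where "\<kappa> n = k0 (n - 1)" for n
  have \<kappa>: "\<kappa> (Suc n) \<ge> 1" "\<rho> ^ \<kappa> (Suc n) \<le> \<delta> n * \<rho> ^ \<mu> n * \<rho> ^ \<mu> (Suc n) / 16" if "n \<ge> 1" for n
    using k0[OF that] by (auto simp: \<kappa>_def)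
  \<comment> \<open>Since \<open>a n\<close> is also the inverse of
    \<open>\<sigma> ^ \<kappa> (Suc n)\<close>, solving the expanding coordinate of
    \<open>step\<close> for \<open>u n\<close> gives
    \<open>u n = a n * u (Suc n) + b n\<close>.\<close>
  define a where "a n = \<rho> ^ \<kappa> (Suc n)" for n
  define b where "b n = a n * (\<phi> * s * \<sigma> ^ \<mu> (Suc n))" for n
  have a_pos: "0 < a n" for n using \<rho>_bounds by (simp add: a_def)
  have a_le: "a n \<le> \<delta> n * \<rho> ^ \<mu> n / 16" "a n \<le> \<rho> ^ \<mu> (Suc n) / 16" "a n \<le> \<delta> n" if "n \<ge> 1" for n
  proof -
    have p: "0 < \<delta> n * \<rho> ^ \<mu> n" "\<delta> n * \<rho> ^ \<mu> n \<le> \<delta> n"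
      using \<delta>(1,2)[OF that] \<rho>\<mu>[of n] by (auto intro!: mult_left_le)
    have le: "a n \<le> \<delta> n * \<rho> ^ \<mu> n * \<rho> ^ \<mu> (Suc n) / 16" using \<kappa>[OF that] by (simp add: a_def)
    have "\<delta> n * \<rho> ^ \<mu> n * \<rho> ^ \<mu> (Suc n) \<le> \<delta> n * \<rho> ^ \<mu> n * 1" using \<rho>\<mu> p by (intro mult_left_mono) auto
    with le show 1: "a n \<le> \<delta> n * \<rho> ^ \<mu> n / 16" by simp
    have "\<delta> n * \<rho> ^ \<mu> n * \<rho> ^ \<mu> (Suc n) \<le> 1 * \<rho> ^ \<mu> (Suc n)"
      using \<rho>\<mu>(1)[of "Suc n"] p \<delta>(2)[OF that] by (intro mult_right_mono) auto
    with le show "a n \<le> \<rho> ^ \<mu> (Suc n) / 16" by simp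
    show "a n \<le> \<delta> n" using 1 p by linarith
  qed
  have b_pos: "0 < b n" for n
    unfolding b_def using a_pos s_pos golden_ratio_bounds \<sigma>_bounds by (intro mult_pos_pos) auto
  have b_le: "b n \<le> s * (\<delta> n * \<rho> ^ \<mu> n) / 8" if "n \<ge> 1" for n
  proof -
    have c: "0 < \<phi> * s * \<sigma> ^ \<mu> (Suc n)" using s_pos golden_ratio_bounds \<sigma>_bounds by simp
    have "b n \<le> \<delta> n * \<rho> ^ \<mu> n * \<rho> ^ \<mu> (Suc n) / 16 * (\<phi> * s * \<sigma> ^ \<mu> (Suc n))"
      unfolding b_def a_def using \<kappa>[OF that] c by (intro mult_right_mono) auto
    also have "\<dots> = \<phi> * (s * (\<delta> n * \<rho> ^ \<mu> n)) / 16 * (\<rho> ^ \<mu> (Suc n) * \<sigma> ^ \<mu> (Suc n))" by simp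
    also have "\<dots> = \<phi> * (s * (\<delta> n * \<rho> ^ \<mu> n)) / 16" by (simp only: \<rho>\<sigma>_power mult_1_right)
    also have "\<dots> \<le> 2 * (s * (\<delta> n * \<rho> ^ \<mu> n)) / 16"
      using golden_ratio_bounds s_pos \<delta>(1)[OF that] \<rho>\<mu>(1)[of n]
      by (intro divide_right_mono mult_right_mono) auto
    finally show ?thesis by simp
  qed
  have \<delta>\<rho>: "\<delta> n * \<rho> ^ \<mu> n \<le> 1" "0 \<le> \<delta> n * \<rho> ^ \<mu> n" if "n \<ge> 1" for n
    using \<delta>(1,2)[OF that] \<rho>\<mu>[of n] mult_mono[of "\<delta> n" 1 "\<rho> ^ \<mu> n" 1] by auto
  have "\<exists>u. \<forall>n\<ge>1. u n = a n * u (Suc n) + b n \<and> 0 \<le> u n \<and> u n \<le> 2 * (s / 8)"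
  proof (rule backward_recursion)
    fix n :: nat assume n: "n \<ge> 1"
    show "0 \<le> a n \<and> a n \<le> 1 / 2" using a_pos[of n] a_le[OF n] \<rho>\<mu>(2)[of "Suc n"] by linarith
    have "s * (\<delta> n * \<rho> ^ \<mu> n) \<le> s * 1" using \<delta>\<rho>[OF n] s_pos by (intro mult_left_mono) auto
    then show "0 \<le> b n \<and> b n \<le> s / 8" using b_pos[of n] b_le[OF n] by linarith
  qed
  then obtain u where u_all: "\<forall>n\<ge>1. u n = a n * u (Suc n) + b n \<and> 0 \<le> u n \<and> u n \<le> 2 * (s / 8)"
    by blast
  have u: "u n = a n * u (Suc n) + b n" "0 \<le> u n" "u n \<le> s / 4" if "n \<ge> 1" for n
    using u_all[rule_format, OF that] by linarith+
  have u_pos: "0 < u n" if "n \<ge> 1" for n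
  proof -
    have "0 \<le> a n * u (Suc n)" using a_pos[of n] u(2)[of "Suc n"] by simp
    then show ?thesis using u(1)[OF that] b_pos[of n] by linarith
  qed
  have u_le: "u n \<le> s * (\<delta> n * \<rho> ^ \<mu> n) / 4" if "n \<ge> 1" for n
  proof -
    have "a n * u (Suc n) \<le> \<delta> n * \<rho> ^ \<mu> n / 16 * s"
      using a_le(1)[OF that] u(2,3)[of "Suc n"] a_pos[of n] s_pos \<delta>\<rho>[OF that] by (intro mult_mono) auto
    then have "a n * u (Suc n) \<le> s * (\<delta> n * \<rho> ^ \<mu> n) / 16" by (simp add: mult.commute)
    moreover have "0 \<le> s * (\<delta> n * \<rho> ^ \<mu> n)" using \<delta>\<rho>(2)[OF that] s_pos by simp
    ultimately show ?thesis using u(1)[OF that] b_le[OF that] by linarith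
  qed
  \<comment> \<open>Chosen so that the expanding coordinate of
    \<open>\<alpha> (1, 1) - (1, 0)\<close> is \<open>u 1\<close>; the contracting coordinate then
    dictates \<open>v 1\<close>.\<close>
  define \<alpha> where "\<alpha> = (\<phi> * s + u 1) / (\<sigma> * s)"
  have \<alpha>_pos: "0 < \<alpha>"
    unfolding \<alpha>_def using s_pos golden_ratio_bounds \<sigma>_bounds u_pos[of 1]
    by (intro divide_pos_pos add_pos_pos mult_pos_pos) auto
  have "\<phi> * s + u 1 \<le> \<sigma> * s" using u(3)[of 1] s_pos by (simp add: \<sigma>_def algebra_simps)
  then have \<alpha>_le: "\<alpha> \<le> 1" unfolding \<alpha>_def using s_pos \<sigma>_bounds by simp
  \<comment> \<open>The contracting coordinate of \<open>step\<close>, run forwards; the argument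
    \<open>n - 1\<close> makes the recursion start at level \<open>1\<close>.\<close>
  define v where "v n = rec_nat (\<alpha> * ((\<phi> - 1) * s) + s) (\<lambda>i x. a (Suc i) * x + s * \<rho> ^ \<mu> (Suc (Suc i))) (n - 1)" for n
  have v1: "v 1 = \<alpha> * ((\<phi> - 1) * s) + s" by (simp add: v_def)
  have vS: "v (Suc n) = a n * v n + s * \<rho> ^ \<mu> (Suc n)" if "n \<ge> 1" for n
    using that by (cases n) (simp_all add: v_def)
  \<comment> \<open>The translation term \<open>s * \<rho> ^ \<mu> (Suc n)\<close> dominates: the
    inherited term is at most an eighth of it. The lower bound turns \<open>u_le\<close> into
    \<open>u n \<le> \<delta> n * v n / 4\<close>.\<close>
  have v_bounds: "s * \<rho> ^ \<mu> n \<le> v n \<and> v n \<le> 2 * s * \<rho> ^ \<mu> n" if "n \<ge> 1" for n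
    using that
  proof (induction n rule: dec_induct)
    case base
    have "0 \<le> \<alpha> * (\<phi> - 1) * s" using \<alpha>_pos golden_ratio_bounds s_pos by (intro mult_nonneg_nonneg) auto
    moreover have "\<alpha> * (\<phi> - 1) * s \<le> 1 * s"
      using \<alpha>_pos \<alpha>_le golden_ratio_bounds s_pos mult_mono[of \<alpha> 1 "\<phi> - 1" 1] by (intro mult_right_mono) auto
    ultimately show ?case unfolding v1 \<mu>1 by (simp add: mult.assoc)
  next
    case (step n)
    have v0: "0 \<le> v n" using step s_pos \<rho>\<mu>(1)[of n] by (smt (verit) mult_pos_pos)
    have "a n * v n \<le> \<rho> ^ \<mu> (Suc n) / 16 * (2 * s)"
    proof (intro mult_mono a_le(2) step)
      have "2 * s * \<rho> ^ \<mu> n \<le> 2 * s * 1" using \<rho>\<mu>(2)[of n] s_pos by (intro mult_left_mono) auto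
      then show "v n \<le> 2 * s" using step by linarith
    qed (use \<rho>\<mu>(1)[of "Suc n"] v0 in auto)
    moreover have "0 \<le> a n * v n" using a_pos[of n] v0 by simp
    moreover have "0 < s * \<rho> ^ \<mu> (Suc n)" using s_pos \<rho>\<mu>(1)[of "Suc n"] by simp
    ultimately show ?case using step(1) by (simp add: vS)
  qed
  have "golden_sequences e_u e_s \<kappa> \<mu> \<alpha> u v \<delta>"
  proof
    fix n :: nat
    show "\<kappa> n \<ge> 1" if "n \<ge> 2" using \<kappa>(1)[of "n - 1"] that by (cases n) auto
    show "summable \<delta>" by (rule \<delta>(3))
    show "0 < \<alpha>" by (rule \<alpha>_pos)
    show "summable (\<lambda>n. \<rho> ^ \<mu> n)"
    proof (rule summable_comparison_test_ev[OF _ \<epsilon>(2)])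
      show "\<forall>\<^sub>F n in sequentially. norm (\<rho> ^ \<mu> n) \<le> \<epsilon> n"
        using \<mu> \<rho>\<mu>(1) by (intro eventually_sequentiallyI[of 2]) (auto simp: less_imp_le)
    qed
    have "\<alpha> * (\<sigma> * s) = \<phi> * s + u 1" unfolding \<alpha>_def using s_pos \<sigma>_bounds by simp
    then show "\<alpha> *\<^sub>R vector [1, 1] = u 1 *\<^sub>R e_u + v 1 *\<^sub>R e_s + vector [1, 0]"
      unfolding ones_coords axis_coords v1 by (simp add: scaleR_add_right algebra_simps)
    assume n: "n \<ge> 1"
    show "0 < \<delta> n" "\<delta> n \<le> 1" by (rule \<delta>(1)[OF n], rule \<delta>(2)[OF n])
    show "0 < u n" by (rule u_pos[OF n])
    have "s * (\<delta> n * \<rho> ^ \<mu> n) = \<delta> n * (s * \<rho> ^ \<mu> n)" by simp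
    also have "\<dots> \<le> \<delta> n * v n" using v_bounds[OF n] \<delta>(1)[OF n] by (intro mult_left_mono) auto
    finally show "u n \<le> \<delta> n * v n / 4" using u_le[OF n] by simp
    show "v n \<le> 2 * s * \<rho> ^ \<mu> n" using v_bounds[OF n] by simp
    show "\<rho> ^ \<kappa> (Suc n) \<le> \<delta> n" using a_le(3)[OF n] by (simp add: a_def)
    have aS: "a n * \<sigma> ^ \<kappa> (Suc n) = 1" using \<rho>\<sigma>_power by (simp add: a_def)
    have "u n * \<sigma> ^ \<kappa> (Suc n) = (a n * \<sigma> ^ \<kappa> (Suc n)) * (u (Suc n) + \<phi> * s * \<sigma> ^ \<mu> (Suc n))"
      unfolding u(1)[OF n] b_def by (simp add: algebra_simps)
    then have "u n * \<sigma> ^ \<kappa> (Suc n) = u (Suc n) + \<phi> * s * \<sigma> ^ \<mu> (Suc n)" by (simp only: aS mult_1_left)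
    moreover have "v n * \<rho> ^ \<kappa> (Suc n) = v (Suc n) + - s * \<rho> ^ \<mu> (Suc n)"
      unfolding vS[OF n] a_def by simp
    ultimately show "fib_act (2 * \<kappa> (Suc n)) (u n *\<^sub>R e_u + v n *\<^sub>R e_s) =
      u (Suc n) *\<^sub>R e_u + v (Suc n) *\<^sub>R e_s + fib_act (2 * \<mu> (Suc n)) (vector [1, 0])"
      unfolding axis_coords fib_act_coords by (simp add: scaleR_add_left scaleR_diff_left)
  qed
  then show ?thesis using \<mu> by blast
qed

lemma real_sum_list: "real (sum_list (map f xs)) = sum_list (map (\<lambda>x. real (f x)) xs)"
  by (induction xs) auto

section \<open>The diagram attached to the sequences, its heights and phases\<close>

context golden_sequences
begin

definition w :: "nat \<Rightarrow> real^2" where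
  "w n = u n *\<^sub>R e_u + v n *\<^sub>R e_s"

definition M :: "nat \<Rightarrow> nat^2^2" where
  "M n = mat_power fib_mat (2 * \<kappa> n)"

definition W :: "nat \<Rightarrow> 2 \<Rightarrow> 2 list" where
  "W n j = best_ordering (w (n - 1)) (M n $ j)"

definition tower_heights :: "nat \<Rightarrow> real^2" where
  "tower_heights n = map_matrix real (mat_product M n) *v vector [1, 1]"

lemma w_nth: "w n $ 1 = s * (\<phi> * u n - v n)" "w n $ 2 = s * (u n + \<phi> * v n)"
  by (simp_all add: w_def e_u_nth e_s_nth algebra_simps)

lemma v_pos: "n \<ge> 1 \<Longrightarrow> 0 < v n"
proof -
  assume n: "n \<ge> 1"
  have "0 < \<delta> n * v n" using u_pos[OF n] u_le[OF n] by linarith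
  then show ?thesis using \<delta>_pos[OF n] by (simp add: zero_less_mult_iff)
qed

lemma u_le_v: "n \<ge> 1 \<Longrightarrow> u n \<le> v n / 4"
proof -
  assume n: "n \<ge> 1"
  have "\<delta> n * v n \<le> 1 * v n" using \<delta>_le[OF n] v_pos[OF n] by (intro mult_right_mono) auto
  then show ?thesis using u_le[OF n] by linarith
qed

lemma phi_u_less: "n \<ge> 1 \<Longrightarrow> \<phi> * u n < v n"
proof -
  assume n: "n \<ge> 1"
  have "\<phi> * u n < 2 * u n" using golden_ratio_bounds u_pos[OF n] by (intro mult_strict_right_mono) auto
  then show ?thesis using u_le_v[OF n] v_pos[OF n] by linarith
qed

lemma w_1_neg: "n \<ge> 1 \<Longrightarrow> w n $ 1 < 0"
  using phi_u_less[of n] s_pos by (simp add: w_nth mult_pos_neg)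

lemma w_2_bounds:
  assumes n: "n \<ge> 1"
  shows "3 / 4 * v n \<le> w n $ 2" "w n $ 2 \<le> 9 / 4 * s * v n" "0 < w n $ 2"
proof -
  have "3 / 2 * v n \<le> \<phi> * v n" "\<phi> * v n \<le> 2 * v n"
    using golden_ratio_bounds v_pos[OF n] by (auto intro: mult_right_mono)
  then have b: "3 / 2 * v n \<le> u n + \<phi> * v n" "u n + \<phi> * v n \<le> 9 / 4 * v n"
    using u_pos[OF n] u_le_v[OF n] by linarith+
  have "1 / 2 * (3 / 2 * v n) \<le> s * (u n + \<phi> * v n)"
    using s_bounds b v_pos[OF n] by (intro mult_mono) auto
  then show 1: "3 / 4 * v n \<le> w n $ 2" by (simp add: w_nth)
  show "w n $ 2 \<le> 9 / 4 * s * v n"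
    using mult_left_mono[OF b(2), of s] s_pos by (simp add: w_nth mult.left_commute mult.assoc)
  show "0 < w n $ 2" using 1 v_pos[OF n] by linarith
qed

lemma w_sum_pos: "n \<ge> 1 \<Longrightarrow> - w n $ 1 < w n $ 2"
proof -
  assume n: "n \<ge> 1"
  have "1 * v n < \<phi> * v n" using golden_ratio_bounds v_pos[OF n] by (intro mult_strict_right_mono) auto
  moreover have "0 < \<phi> * u n" using golden_ratio_bounds u_pos[OF n] by simp
  ultimately have "v n - \<phi> * u n < u n + \<phi> * v n" using u_pos[OF n] by linarith
  then have "s * (v n - \<phi> * u n) < s * (u n + \<phi> * v n)" using s_pos by (rule mult_strict_left_mono)
  then show ?thesis by (simp add: w_nth algebra_simps)
qed

lemma w_2_le: "n \<ge> 1 \<Longrightarrow> w n $ 2 \<le> 2 * \<rho> ^ \<mu> n"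
proof -
  assume n: "n \<ge> 1"
  have "s\<^sup>2 * (7 / 2) \<le> s\<^sup>2 * (\<phi> + 2)" using golden_ratio_bounds by (intro mult_left_mono) auto
  then have s2: "9 / 2 * s\<^sup>2 \<le> 2" unfolding s_sq by simp
  have "w n $ 2 \<le> 9 / 4 * s * v n" by (rule w_2_bounds(2)[OF n])
  also have "\<dots> \<le> 9 / 4 * s * (2 * s * \<rho> ^ \<mu> n)"
    using v_le[OF n] s_pos by (intro mult_left_mono) auto
  also have "\<dots> = 9 / 2 * s\<^sup>2 * \<rho> ^ \<mu> n" by (simp add: power2_eq_square)
  also have "\<dots> \<le> 2 * \<rho> ^ \<mu> n" using s2 \<rho>_bounds by (intro mult_right_mono) auto
  finally show ?thesis .
qed

lemma infnorm_w_le: "n \<ge> 1 \<Longrightarrow> infnorm (w n) \<le> 2 * \<rho> ^ \<mu> n"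
proof -
  assume n: "n \<ge> 1"
  have "\<bar>w n $ i\<bar> \<le> 2 * \<rho> ^ \<mu> n" for i
    using exhaust_2[of i] w_2_le[OF n] w_1_neg[OF n] w_sum_pos[OF n] by auto
  then show ?thesis by (auto simp: infnorm_cart intro!: cSup_least)
qed

lemma summable_w_2: "summable (\<lambda>n. w n $ 2)"
proof (rule summable_comparison_test_ev[OF _ summable_mult[OF summable_\<mu>, of 2]])
  show "\<forall>\<^sub>F n in sequentially. norm (w n $ 2) \<le> 2 * \<rho> ^ \<mu> n"
    using w_2_le w_2_bounds(3) by (intro eventually_sequentiallyI[of 1]) (auto simp: less_imp_le)
qed

lemma w_tendsto_0: "(\<lambda>n. w n $ i) \<longlonglongrightarrow> 0"
proof (rule Lim_null_comparison[OF _ summable_LIMSEQ_zero[OF summable_w_2]])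
  have "\<bar>w n $ i\<bar> \<le> w n $ 2" if "n \<ge> 1" for n
    using exhaust_2[of i] w_2_bounds(3)[OF that] w_1_neg[OF that] w_sum_pos[OF that] by auto
  then show "\<forall>\<^sub>F n in sequentially. norm (w n $ i) \<le> w n $ 2"
    by (intro eventually_sequentiallyI[of 1]) simp
qed

text \<open>By \<open>step\<close> this vector is \<open>w (Suc n)\<close> plus the removed integer
  vector. In the first coordinate the bounds \<open>\<phi>^2 = \<phi> + 1\<close> and
  \<open>v \<le> 2 s \<rho>^\<mu>\<close> leave at least
  \<open>s^2 \<phi> = \<phi> / (\<phi> + 2) > 2/5\<close>. This excludes continuity; positivity of
  both coordinates is the ratio condition for best orderings.\<close>

lemma fib_act_w:
  assumes n: "n \<ge> 1"
  shows "2 / 5 \<le> fib_act (2 * \<kappa> (Suc n)) (w n) $ 1" "0 < fib_act (2 * \<kappa> (Suc n)) (w n) $ j"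
proof -
  let ?r = "\<rho> ^ \<mu> (Suc n)" and ?t = "\<sigma> ^ \<mu> (Suc n)"
  have rt: "0 < ?r" "?r \<le> 1" "1 \<le> ?t"
    using \<rho>_bounds \<sigma>_bounds by (auto intro: power_le_one one_le_power)
  have eq: "fib_act (2 * \<kappa> (Suc n)) (w n) =
      w (Suc n) + ((\<phi> * s * ?t) *\<^sub>R e_u + (- s * ?r) *\<^sub>R e_s)"
    using step[OF n] unfolding axis_coords fib_act_coords w_def by simp
  have phi2: "\<phi> * \<phi> = \<phi> + 1" using golden_ratio_sq by (simp add: power2_eq_square)
  have "fib_act (2 * \<kappa> (Suc n)) (w n) $ 1 =
      s * (\<phi> * u (Suc n)) + (s\<^sup>2 * (\<phi> * \<phi> * ?t + ?r) - s * v (Suc n))"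
    unfolding eq by (simp add: w_nth e_u_nth e_s_nth power2_eq_square algebra_simps)
  moreover have "0 \<le> s * (\<phi> * u (Suc n))" using s_pos golden_ratio_bounds u_pos[of "Suc n"] by simp
  moreover have "s * v (Suc n) \<le> s * (2 * s * ?r)" using s_pos v_le[of "Suc n"] by (intro mult_left_mono) auto
  moreover have "s * (2 * s * ?r) = s\<^sup>2 * (2 * ?r)" by (simp add: power2_eq_square)
  moreover have "s\<^sup>2 * \<phi> \<le> s\<^sup>2 * (\<phi> * \<phi> * ?t + ?r) - s\<^sup>2 * (2 * ?r)"
  proof -
    have "\<phi> * \<phi> * 1 \<le> \<phi> * \<phi> * ?t" using rt golden_ratio_bounds by (intro mult_left_mono) auto
    then have "\<phi> \<le> \<phi> * \<phi> * ?t + ?r - 2 * ?r" using phi2 rt by linarith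
    then have "s\<^sup>2 * \<phi> \<le> s\<^sup>2 * (\<phi> * \<phi> * ?t + ?r - 2 * ?r)" by (rule mult_left_mono) simp
    then show ?thesis by (simp add: algebra_simps)
  qed
  moreover have "2 / 5 \<le> s\<^sup>2 * \<phi>"
  proof -
    have "s\<^sup>2 * (2 / 5 * (\<phi> + 2)) \<le> s\<^sup>2 * \<phi>" using golden_ratio_bounds by (intro mult_left_mono) auto
    then show ?thesis by (simp only: mult.left_commute[of "s\<^sup>2"] s_sq mult_1_right)
  qed
  ultimately show 1: "2 / 5 \<le> fib_act (2 * \<kappa> (Suc n)) (w n) $ 1" by linarith
  have "fib_act (2 * \<kappa> (Suc n)) (w n) $ 2 = w (Suc n) $ 2 + s\<^sup>2 * \<phi> * (?t - ?r)"
    unfolding eq by (simp add: e_u_nth e_s_nth power2_eq_square algebra_simps)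
  moreover have "0 \<le> s\<^sup>2 * \<phi> * (?t - ?r)" using rt golden_ratio_bounds by simp
  ultimately have "0 < fib_act (2 * \<kappa> (Suc n)) (w n) $ 2" using w_2_bounds(3)[of "Suc n"] by simp
  then show "0 < fib_act (2 * \<kappa> (Suc n)) (w n) $ j" using 1 exhaust_2[of j] by auto
qed

lemma M_pos: "n \<ge> 2 \<Longrightarrow> M n $ i $ j > 0"
  unfolding M_def using \<kappa>_pos[of n] by (intro mat_power_fib_pos) simp

lemma fib_act_M: "fib_act (2 * \<kappa> n) x $ j = real (M n $ j $ 1) * x $ 1 + real (M n $ j $ 2) * x $ 2"
  by (simp add: fib_act_nth M_def)

lemma best_word_w: "n \<ge> 1 \<Longrightarrow> best_word (w n) (M (Suc n) $ j)"
  using w_1_neg[of n] w_sum_pos[of n] M_pos[of "Suc n"] fib_act_w(2)[of n j]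
  by unfold_locales (auto simp: fib_act_M)

lemma target_eq: "n \<ge> 1 \<Longrightarrow> best_word.target (w n) (M (Suc n) $ j) = fib_act (2 * \<kappa> (Suc n)) (w n) $ j"
  using best_word.target_def[OF best_word_w] by (simp add: fib_act_M)

lemma W_Suc: "W (Suc n) j = best_ordering (w n) (M (Suc n) $ j)"
  by (simp add: W_def)

sublocale proper_words W 2 1
proof
  fix n :: nat and j :: 2 assume "2 \<le> n"
  then obtain m where m: "n = Suc m" "m \<ge> 1" by (cases n) auto
  note bw = best_word_w[OF m(2), of j]
  show "hd (W n j) = 2" "last (W n j) = 1" "set (W n j) = UNIV"
    unfolding m W_Suc
    using best_word.hd_best_ordering[OF bw] best_word.last_best_ordering[OF bw]
      best_word.set_best_ordering[OF bw] by auto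
qed simp

text \<open>\<open>word_diagram\<close> copies the edges, maps and order of
  \<open>best_ordering_diagram\<close>, so only the two descriptions of the vertex set
  differ.\<close>

lemma best_ordering_diagram_eq: "best_ordering_diagram M w = word_diagram W"
proof -
  have eq: "{Some 1, Some 2} = range (Some :: 2 \<Rightarrow> 2 option)" by (simp add: UNIV_2)
  show ?thesis unfolding best_ordering_diagram_def word_diagram_def W_def Let_def eq ..
qed

lemma length_W: "n \<ge> 1 \<Longrightarrow> length (W (Suc n) j) = M (Suc n) $ j $ 1 + M (Suc n) $ j $ 2"
  using best_word.length_best_ordering[OF best_word_w] by (simp add: W_Suc)

lemma count_W: "n \<ge> 1 \<Longrightarrow> count_list (W (Suc n) j) i = M (Suc n) $ j $ i"
  using best_word.count_best_ordering[OF best_word_w] by (simp add: W_Suc)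

lemma tower_heights_1: "tower_heights (Suc 0) = vector [1, 1]"
  by (simp add: tower_heights_def map_matrix_mat_1 del: One_nat_def)

lemma tower_heights_Suc: "n \<ge> 1 \<Longrightarrow> tower_heights (Suc n) = fib_act (2 * \<kappa> (Suc n)) (tower_heights n)"
  by (simp add: tower_heights_def fib_act_def M_def map_matrix_mult matrix_vector_mul_assoc)

lemma height_eq:
  assumes "n \<ge> 1" shows "real (height n j) = tower_heights n $ j"
  using assms
proof (induction n arbitrary: j rule: dec_induct)
  case base
  show ?case using exhaust_2[of j] by (auto simp: tower_heights_1 height.simps)
next
  case (step n)
  have "real (height (Suc n) j) = sum_list (map (\<lambda>i. real (height n i)) (W (Suc n) j))"
    using step(1) by (simp add: height.simps real_sum_list)
  also have "\<dots> = tower_heights (Suc n) $ j"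
    unfolding sum_list_count_2 step.IH
    using step(1) by (simp add: tower_heights_Suc fib_act_M count_W)
  finally show ?case .
qed

text \<open>The run consists of letters \<open>2\<close>, so its share of a tower by height is at
  most its share of the word by number of letters.\<close>

lemma height_le: "n \<ge> 1 \<Longrightarrow> height n 2 \<le> height n 1"
proof -
  assume "n \<ge> 1"
  then have "tower_heights n $ 2 \<le> tower_heights n $ 1 \<and> 0 \<le> tower_heights n $ 2"
    by (induction n rule: dec_induct)
      (auto simp: tower_heights_1 tower_heights_Suc intro: fib_act_ordered[THEN conjunct1] fib_act_ordered[THEN conjunct2])
  then show ?thesis using height_eq[OF \<open>n \<ge> 1\<close>] by (metis of_nat_le_iff)
qed

text \<open>Modulo integer vectors, \<open>\<alpha>\<close> times the heights and \<open>w\<close>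
  have the same start and obey the same recursion, as the vectors removed in \<open>start\<close>
  and \<open>step\<close> are integral.\<close>

lemma heights_int_vecs: "n \<ge> 1 \<Longrightarrow> \<alpha> *\<^sub>R tower_heights n - w n \<in> int_vecs"
proof (induction n rule: dec_induct)
  case base
  have "\<alpha> *\<^sub>R tower_heights (Suc 0) - w (Suc 0) = vector [1, 0]"
    using start by (simp add: tower_heights_1 w_def)
  then show ?case by (simp add: int_vecs_def)
next
  case (step n)
  have "\<alpha> *\<^sub>R tower_heights (Suc n) - w (Suc n) =
      fib_act (2 * \<kappa> (Suc n)) (\<alpha> *\<^sub>R tower_heights n - w n) + fib_act (2 * \<mu> (Suc n)) (vector [1, 0])"
    using golden_sequences.step[OF golden_sequences_axioms step(1)]
      fib_act_add[of "2 * \<kappa> (Suc n)" "\<alpha> *\<^sub>R tower_heights n - w n" "w n"]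
    by (simp add: tower_heights_Suc[OF step(1)] fib_act_scaleR w_def)
  moreover have "fib_act (2 * \<mu> (Suc n)) (vector [1, 0]) \<in> int_vecs"
    by (intro int_vecs_fib_act) (simp add: int_vecs_def)
  ultimately show ?case using step.IH by (simp add: int_vecs_add int_vecs_fib_act)
qed

lemma phase_Ints: "n \<ge> 1 \<Longrightarrow> \<alpha> * real (height n i) - w n $ i \<in> \<int>"
  using heights_int_vecs[of n] exhaust_2[of i] by (auto simp: int_vecs_def height_eq)

text \<open>Otherwise \<open>\<alpha>\<close> times the heights would be congruent to a multiple
  \<open>cs n\<close> of \<open>e_s\<close> tending to \<open>0\<close>, as well as to
  \<open>w n\<close>, which also tends to \<open>0\<close>. A small integer vector vanishes, so
  \<open>w n\<close> would lie in the contracting line, against \<open>u n > 0\<close>.\<close>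

lemma start_not_stable: "\<alpha> *\<^sub>R vector [1, 1] \<notin> {real_ivec y + t |y t. t \<in> span {e_s}}"
proof
  assume "\<alpha> *\<^sub>R vector [1, 1] \<in> {real_ivec y + t |y t. t \<in> span {e_s}}"
  then obtain y c where yc: "\<alpha> *\<^sub>R vector [1, 1] = real_ivec y + c *\<^sub>R e_s"
    by (auto simp: span_singleton)
  \<comment> \<open>Each level contracts the coefficient by at least \<open>1/2\<close>; the factor
    \<open>2\<close> accounts for starting at \<open>n = 1\<close>.\<close>
  have "\<exists>c'. \<bar>c'\<bar> \<le> 2 * \<bar>c\<bar> * (1 / 2) ^ n \<and> \<alpha> *\<^sub>R tower_heights n - c' *\<^sub>R e_s \<in> int_vecs" if "n \<ge> 1" for n
    using that
  proof (induction n rule: dec_induct)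
    case base
    show ?case using yc by (intro exI[of _ c]) (auto simp: tower_heights_1 int_vecs_real_ivec)
  next
    case (step n)
    then obtain c' where c': "\<bar>c'\<bar> \<le> 2 * \<bar>c\<bar> * (1 / 2) ^ n" "\<alpha> *\<^sub>R tower_heights n - c' *\<^sub>R e_s \<in> int_vecs" by blast
    have "fib_act (2 * \<kappa> (Suc n)) (\<alpha> *\<^sub>R tower_heights n - c' *\<^sub>R e_s) =
        \<alpha> *\<^sub>R tower_heights (Suc n) - (c' * \<rho> ^ \<kappa> (Suc n)) *\<^sub>R e_s"
      using fib_act_add[of "2 * \<kappa> (Suc n)" "\<alpha> *\<^sub>R tower_heights n - c' *\<^sub>R e_s" "c' *\<^sub>R e_s"]
      by (simp add: fib_act_scaleR fib_act_s tower_heights_Suc[OF step(1)])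
    moreover have "\<rho> ^ \<kappa> (Suc n) \<le> 1 / 2"
      using \<kappa>_pos[of "Suc n"] step(1) \<rho>_bounds power_decreasing[of 1 "\<kappa> (Suc n)" \<rho>] by simp
    then have "\<bar>c' * \<rho> ^ \<kappa> (Suc n)\<bar> \<le> 2 * \<bar>c\<bar> * (1 / 2) ^ n * (1 / 2)"
      unfolding abs_mult using c'(1) \<rho>_bounds by (intro mult_mono) auto
    ultimately show ?case using int_vecs_fib_act[OF c'(2), of "2 * \<kappa> (Suc n)"] by (intro exI[of _ "c' * \<rho> ^ \<kappa> (Suc n)"]) simp
  qed
  then obtain cs where cs: "\<And>n. n \<ge> 1 \<Longrightarrow> \<bar>cs n\<bar> \<le> 2 * \<bar>c\<bar> * (1 / 2) ^ n"
    "\<And>n. n \<ge> 1 \<Longrightarrow> \<alpha> *\<^sub>R tower_heights n - cs n *\<^sub>R e_s \<in> int_vecs" by metis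
  define d where "d n = w n - cs n *\<^sub>R e_s" for n
  have d_int: "d n \<in> int_vecs" if "n \<ge> 1" for n
    using int_vecs_diff[OF cs(2)[OF that] heights_int_vecs[OF that]] by (simp add: d_def)
  have "cs \<longlonglongrightarrow> 0"
  proof (rule Lim_null_comparison)
    show "\<forall>\<^sub>F n in sequentially. norm (cs n) \<le> 2 * \<bar>c\<bar> * (1 / 2) ^ n"
      using cs(1) by (intro eventually_sequentiallyI[of 1]) simp
    show "(\<lambda>n. 2 * \<bar>c\<bar> * (1 / 2) ^ n) \<longlonglongrightarrow> 0"
      by (intro tendsto_mult_right_zero LIMSEQ_power_zero) simp
  qed
  then have d_lim: "(\<lambda>n. d n $ i) \<longlonglongrightarrow> 0" for i
    using tendsto_diff[OF w_tendsto_0 tendsto_mult_left_zero[of cs sequentially "e_s $ i"]] by (simp add: d_def)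
  have "\<forall>\<^sub>F n in sequentially. \<bar>d n $ i\<bar> < 1" for i
    using order_tendstoD(2)[OF tendsto_rabs_zero[OF d_lim], of 1] by simp
  then have "\<forall>\<^sub>F n in sequentially. \<bar>d n $ 1\<bar> < 1 \<and> \<bar>d n $ 2\<bar> < 1 \<and> n \<ge> 1"
    by (intro eventually_conj eventually_ge_at_top) auto
  then obtain n where n: "\<bar>d n $ 1\<bar> < 1" "\<bar>d n $ 2\<bar> < 1" "n \<ge> 1"
    unfolding eventually_sequentially by blast
  have "d n = 0"
    using d_int[OF n(3)] n Ints_nonzero_abs_less1 by (auto simp: vec_eq_iff forall_2 int_vecs_def)
  then have "u n *\<^sub>R e_u + v n *\<^sub>R e_s = 0 *\<^sub>R e_u + cs n *\<^sub>R e_s" by (simp add: d_def w_def)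
  then show False using u_pos[OF n(3)] unfolding coords_eq_iff by simp
qed

lemma w_ratio:
  assumes n: "n \<ge> 1"
  shows "\<bar>w n $ 1\<bar> / \<bar>w n $ 2\<bar> < real (M (n + 1) $ j $ 2) / real (M (n + 1) $ j $ 1)"
proof -
  have "0 < real (M (Suc n) $ j $ 1) * w n $ 1 + real (M (Suc n) $ j $ 2) * w n $ 2"
    using fib_act_w(2)[OF n, of j] by (simp add: fib_act_M)
  then show ?thesis
    using w_1_neg[OF n] w_2_bounds(3)[OF n] M_pos[of "Suc n" j 1] n
    by (simp add: divide_less_eq less_divide_eq field_simps)
qed

lemma uniquely_ergodic_B: "uniquely_ergodic (path_space B) (vershik B)"
  unfolding uniquely_ergodic_def
proof (rule ex_ex1I)
  show "\<exists>\<mu>. invariant_probability (path_space B) (vershik B) \<mu>"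
    by (rule invariant_probability_exists[OF cantor_space_word continuous_vershik])
  \<comment> \<open>Pair the weights with \<open>e_s\<close>. By \<open>weight_rec\<close> the
    matrix moves over to \<open>e_s\<close>, so the pairing at level \<open>n\<close> is
    \<open>\<rho> ^ \<kappa> (Suc n)\<close> times the one at \<open>Suc n\<close>; being bounded,
    it is \<open>0\<close>. The weights are then proportional to \<open>(\<phi>, 1)\<close>, and
    total mass one fixes the factor.\<close>
  have weights: "invariant_measure.weight W m n 1 = \<phi> * invariant_measure.weight W m n 2"
    if m: "invariant_measure W 2 1 m" and n: "n \<ge> 1" for m n
  proof -
    interpret m: invariant_measure W 2 1 m by (rule m)
    define S where "S n = m.weight n 1 * e_s $ 1 + m.weight n 2 * e_s $ 2" for n
    have S_rec: "S n = \<rho> ^ \<kappa> (Suc n) * S (Suc n)" if "n \<ge> 1" for n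
    proof -
      have "S n = m.weight (Suc n) 1 * fib_act (2 * \<kappa> (Suc n)) e_s $ 1 +
          m.weight (Suc n) 2 * fib_act (2 * \<kappa> (Suc n)) e_s $ 2"
        unfolding S_def m.weight_rec[OF that] fib_act_M
        by (simp add: sum_2 count_W[OF that] algebra_simps)
      then show ?thesis by (simp add: fib_act_s S_def algebra_simps)
    qed
    have S_bound: "\<bar>S n\<bar> \<le> 2" for n
    proof -
      have "\<bar>m.weight n i * e_s $ i\<bar> \<le> 1 * 1" for i
        unfolding abs_mult using component_le_norm_cart[of e_s i] norm_s
        by (intro mult_mono) (auto simp: m.weight_def)
      from this[of 1] this[of 2] show ?thesis unfolding S_def by linarith
    qed
    have half: "\<bar>S n\<bar> \<le> 2 * (1 / 2) ^ i" if "n \<ge> 1" for n i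
      using that
    proof (induction i arbitrary: n)
      case 0
      then show ?case using S_bound by simp
    next
      case (Suc i)
      have "\<rho> ^ \<kappa> (Suc n) \<le> 1 / 2"
        using \<kappa>_pos[of "Suc n"] Suc.prems \<rho>_bounds power_decreasing[of 1 "\<kappa> (Suc n)" \<rho>] by simp
      then have "\<bar>S n\<bar> \<le> (1 / 2) * (2 * (1 / 2) ^ i)"
        unfolding S_rec[OF Suc.prems] abs_mult using Suc.IH[of "Suc n"] \<rho>_bounds by (intro mult_mono) auto
      then show ?case by simp
    qed
    have "(\<lambda>i. 2 * (1 / 2) ^ i :: real) \<longlonglongrightarrow> 0"
      by (intro tendsto_mult_right_zero LIMSEQ_power_zero) simp
    then have "\<bar>S n\<bar> \<le> 0" by (rule LIMSEQ_le_const) (intro exI allI impI half n)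
    then have "s * (\<phi> * m.weight n 2 - m.weight n 1) = 0"
      by (simp add: S_def e_s_nth algebra_simps)
    then show ?thesis using s_pos by simp
  qed
  fix m m' assume "invariant_probability (path_space B) (vershik B) m"
    "invariant_probability (path_space B) (vershik B) m'"
  then interpret m: invariant_measure W 2 1 m + m': invariant_measure W 2 1 m'
    by unfold_locales auto
  show "m = m'"
  proof (rule invariant_measure_eqI)
    show "invariant_measure W 2 1 m" "invariant_measure W 2 1 m'" by unfold_locales
    fix n :: nat and j :: 2 assume n: "n \<ge> 1"
    let ?h = "real (height n 1) * \<phi> + real (height n 2)"
    have "?h * m.weight n 2 = 1" "?h * m'.weight n 2 = 1"
      using m.weight_total[OF n] m'.weight_total[OF n] weights[OF m.invariant_measure_axioms n]
        weights[OF m'.invariant_measure_axioms n] by (simp_all add: sum_2 algebra_simps)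
    then have "m.weight n 2 = m'.weight n 2" by (metis mult_cancel_left zero_neq_one mult_zero_left)
    then show "m.weight n j = m'.weight n j"
      using weights[OF m.invariant_measure_axioms n] weights[OF m'.invariant_measure_axioms n]
        exhaust_2[of j] by auto
  qed
qed

text \<open>The run has about \<open>target / w n $ 2\<close> letters, so this bounds its proportion
  of the word by \<open>3 * \<delta> n\<close>. Both \<open>u n\<close> times the expansion and the
  contracting part are of order \<open>\<delta> n * v n * ?E\<close>. Moreover \<open>?E\<close> is
  at most the length of the word, since \<open>e_u\<close> is entrywise below \<open>(1, 1)\<close>,
  and \<open>v n\<close> is at most \<open>4/3\<close> of \<open>w n $ 2\<close>.\<close>

lemma target_le:
  assumes n: "n \<ge> 1"
  shows "fib_act (2 * \<kappa> (Suc n)) (w n) $ j \<le> 3 * \<delta> n * w n $ 2 * real (length (W (Suc n) j))"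
proof -
  let ?k = "\<kappa> (Suc n)"
  let ?E = "\<sigma> ^ ?k * e_u $ j"
  have s1: "1 \<le> \<sigma> ^ ?k" using \<sigma>_bounds by (intro one_le_power) simp
  have "s \<le> e_u $ j"
    using exhaust_2[of j] s_pos golden_ratio_bounds by (auto simp: e_u_nth)
  then have e: "1 / 2 \<le> e_u $ j" using s_bounds by linarith
  have E: "1 \<le> 2 * ?E" using mult_mono[OF s1 e] e s1 by simp
  have "\<sigma> ^ ?k * e_u $ j = fib_act (2 * ?k) e_u $ j" by (simp add: fib_act_u)
  also have "\<dots> \<le> fib_act (2 * ?k) (vector [1, 1]) $ j"
    using component_le_norm_cart[of e_u 1] component_le_norm_cart[of e_u 2] norm_u
    by (intro fib_act_mono) auto
  also have "\<dots> = real (length (W (Suc n) j))" using length_W[OF n] by (simp add: fib_act_M)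
  finally have len: "?E \<le> real (length (W (Suc n) j))" .
  have "fib_act (2 * ?k) (w n) $ j = u n * \<sigma> ^ ?k * e_u $ j + v n * \<rho> ^ ?k * e_s $ j"
    unfolding w_def fib_act_coords by simp
  moreover have "u n * \<sigma> ^ ?k * e_u $ j \<le> \<delta> n * v n / 4 * ?E"
    using mult_right_mono[OF u_le[OF n], of ?E] E by (simp add: mult.assoc)
  moreover have "v n * \<rho> ^ ?k * e_s $ j \<le> \<delta> n * v n * (2 * ?E)"
  proof -
    have "v n * \<rho> ^ ?k * e_s $ j \<le> v n * \<rho> ^ ?k * 1"
      using component_le_norm_cart[of e_s j] norm_s v_pos[OF n] \<rho>_bounds by (intro mult_left_mono) auto
    also have "\<dots> \<le> v n * \<delta> n" using contraction[OF n] v_pos[OF n] by simp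
    also have "\<dots> \<le> v n * \<delta> n * (2 * ?E)"
      using mult_left_mono[OF E, of "v n * \<delta> n"] v_pos[OF n] \<delta>_pos[OF n] by simp
    finally show ?thesis by (simp only: mult.commute[of "v n" "\<delta> n"])
  qed
  moreover have "\<delta> n * v n / 4 * ?E + \<delta> n * v n * (2 * ?E) = 9 / 4 * (\<delta> n * v n) * ?E"
    by (simp add: field_simps)
  ultimately have "fib_act (2 * ?k) (w n) $ j \<le> 9 / 4 * (\<delta> n * v n) * ?E" by linarith
  also have "\<dots> = 3 * \<delta> n * (3 / 4 * v n) * ?E" by simp
  also have "\<dots> \<le> 3 * \<delta> n * w n $ 2 * ?E"
    using w_2_bounds(1)[OF n] \<delta>_pos[OF n] E by (intro mult_right_mono mult_left_mono) auto
  also have "\<dots> \<le> 3 * \<delta> n * w n $ 2 * real (length (W (Suc n) j))"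
    using len \<delta>_pos[OF n] w_2_bounds(3)[OF n] by (intro mult_left_mono) auto
  finally show ?thesis .
qed

lemma measurable_eigenvalue_B:
  assumes "invariant_probability (path_space B) (vershik B) m"
  shows "measurable_eigenvalue (vershik B) m (turn \<alpha>)"
proof -
  interpret m: invariant_measure W 2 1 m by unfold_locales (rule assms)
  let ?T = "\<lambda>n j. fib_act (2 * \<kappa> (Suc n)) (w n) $ j"
  \<comment> \<open>The index is \<open>Suc q\<close> because an exit time involves the letters
    strictly after position \<open>q\<close>, that is, the remainder after \<open>Suc q\<close>
    letters.\<close>
  let ?bad = "\<lambda>n j q. real (Suc q) * w n $ 2 \<le> ?T n j"
  show ?thesis
  proof (rule m.measurable_eigenvalueI[where g = "\<lambda>n i. w n $ i" and c = "\<lambda>n. w n $ 2"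
        and d = "\<lambda>n. 3 * \<delta> n" and bad = ?bad])
    fix n :: nat and j :: 2 and q :: nat assume n: "n \<ge> 1"
    show "\<bar>sum_list (map (($) (w n)) (drop (Suc q) (W (Suc n) j)))\<bar> \<le> w n $ 2"
      if "q < length (W (Suc n) j)" "\<not> ?bad n j q"
      using best_word.sum_drop_best_ordering[OF best_word_w[OF n, of j], of q] that length_W[OF n]
      by (simp add: W_Suc target_eq[OF n])
    let ?Q = "{q. q < length (W (Suc n) j) \<and> ?bad n j q}"
    have Q: "?Q \<subseteq> {..<nat \<lfloor>?T n j / w n $ 2\<rfloor>}"
    proof
      fix q assume "q \<in> ?Q"
      then have "real (Suc q) \<le> ?T n j / w n $ 2" using w_2_bounds(3)[OF n] by (simp add: pos_le_divide_eq)
      then show "q \<in> {..<nat \<lfloor>?T n j / w n $ 2\<rfloor>}" by (simp add: le_nat_floor Suc_le_eq[symmetric])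
    qed
    have "0 \<le> ?T n j / w n $ 2"
      using fib_act_w(2)[OF n, of j] w_2_bounds(3)[OF n] by simp
    then have card: "real (card ?Q) \<le> ?T n j / w n $ 2"
      using card_mono[OF _ Q] by (simp add: le_floor_iff) linarith
    have "(\<Sum>q\<in>?Q. real (height n (W (Suc n) j ! q))) = (\<Sum>q\<in>?Q. real (height n 2))"
    proof (rule sum.cong[OF refl])
      fix q assume q: "q \<in> ?Q"
      then have "real q * w n $ 2 \<le> ?T n j" using w_2_bounds(3)[OF n] by (simp add: algebra_simps)
      then have "W (Suc n) j ! q = 2"
        using best_word.nth_best_ordering[OF best_word_w[OF n, of j], of q] q length_W[OF n]
          best_word.letter_before_crossing[OF best_word_w[OF n, of j], of q]
        by (simp add: W_Suc target_eq[OF n])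
      then show "real (height n (W (Suc n) j ! q)) = real (height n 2)" by simp
    qed
    also have "\<dots> = real (card ?Q) * real (height n 2)" by simp
    also have "\<dots> \<le> ?T n j / w n $ 2 * real (height n 2)" by (intro mult_right_mono card) simp
    also have "\<dots> \<le> 3 * \<delta> n * real (length (W (Suc n) j)) * real (height n 2)"
      using target_le[OF n, of j] w_2_bounds(3)[OF n]
      by (intro mult_right_mono) (auto simp: pos_divide_le_eq algebra_simps)
    also have "\<dots> \<le> 3 * \<delta> n * real (height (Suc n) j)"
    proof -
      have "height n 2 \<le> height n i" for i using height_le[OF n] exhaust_2[of i] by auto
      then have "(\<Sum>i\<leftarrow>W (Suc n) j. height n 2) \<le> (\<Sum>i\<leftarrow>W (Suc n) j. height n i)"
        by (intro sum_list_mono)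
      then have "length (W (Suc n) j) * height n 2 \<le> height (Suc n) j"
        using n by (simp add: height.simps sum_list_triv)
      then have "real (length (W (Suc n) j)) * real (height n 2) \<le> real (height (Suc n) j)"
        by (metis of_nat_le_iff of_nat_mult)
      then show ?thesis using mult_left_mono[of _ _ "3 * \<delta> n"] \<delta>_pos[OF n] by (simp add: mult.assoc)
    qed
    finally show "(\<Sum>q\<in>?Q. real (height n (W (Suc n) j ! q))) \<le> 3 * \<delta> n * real (height (Suc n) j)" .
  qed (use phase_Ints summable_w_2 w_tendsto_0 summable_mult[OF summable_\<delta>] in auto)
qed

lemma not_continuous_eigenvalue_B: "\<not> continuous_eigenvalue (path_space B) (vershik B) (turn \<alpha>)"
proof
  assume ev: "continuous_eigenvalue (path_space B) (vershik B) (turn \<alpha>)"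
  \<comment> \<open>\<open>3/20 = 2/5 - 1/4\<close>: steps this small cannot jump over the interval
    \<open>[1/4, 2/5]\<close>.\<close>
  have "\<forall>\<^sub>F n in sequentially. w n $ 2 < 3 / 20 \<and> n \<ge> 1"
    by (intro eventually_conj eventually_ge_at_top order_tendstoD(2)[OF w_tendsto_0]) simp
  then obtain N where N: "\<And>n. n \<ge> N \<Longrightarrow> w n $ 2 < 3 / 20 \<and> n \<ge> 1"
    unfolding eventually_sequentially by blast
  \<comment> \<open>The least number of letters \<open>2\<close> with total phase at least
    \<open>1/4\<close>. As \<open>target\<close> is at least \<open>2/5\<close> for
    \<open>j = 1\<close>, the run is not over at this position, so the letter there is again
    \<open>2\<close>, the common first letter of the words.\<close>
  define q where "q n = nat \<lceil>1 / 4 / w n $ 2\<rceil>" for n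
  have q: "1 / 4 \<le> real (q n) * w n $ 2" "real (q n) * w n $ 2 \<le> 2 / 5" if "n \<ge> N" for n
  proof -
    have w: "0 < w n $ 2" "w n $ 2 < 3 / 20" using N[OF that] w_2_bounds(3) by auto
    have "0 \<le> 1 / 4 / w n $ 2" using w by simp
    then have "1 / 4 / w n $ 2 \<le> real (q n)" "real (q n) < 1 / 4 / w n $ 2 + 1"
      unfolding q_def by linarith+
    then have "1 / 4 \<le> real (q n) * w n $ 2" "real (q n) * w n $ 2 \<le> 1 / 4 + w n $ 2"
      using w by (simp_all add: field_simps)
    then show "1 / 4 \<le> real (q n) * w n $ 2" "real (q n) * w n $ 2 \<le> 2 / 5" using w by linarith+
  qed
  have word: "q n < length (W (Suc n) 1)" "W (Suc n) 1 ! q n = 2"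
    "take (q n) (W (Suc n) 1) = replicate (q n) 2" if "n \<ge> N" for n
  proof -
    have n: "n \<ge> 1" and w2: "0 < w n $ 2" using N[OF that] w_2_bounds(3) by auto
    interpret bw: best_word "w n" "M (Suc n) $ 1" by (rule best_word_w[OF n])
    have t: "real (q n) * w n $ 2 \<le> bw.target"
      using q[OF that] fib_act_w(1)[OF n] target_eq[OF n, of 1] by simp
    have "bw.target < real (M (Suc n) $ 1 $ 2) * w n $ 2"
      using bw.h1 w_1_neg[OF n] by (simp add: bw.target_def mult_pos_neg)
    with t have "real (q n) * w n $ 2 < real (M (Suc n) $ 1 $ 2) * w n $ 2" by linarith
    then have lt: "q n < M (Suc n) $ 1 $ 2" using w2 by simp
    then show "q n < length (W (Suc n) 1)" using length_W[OF n] by simp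
    show "W (Suc n) 1 ! q n = 2"
      using bw.nth_best_ordering[of "q n"] bw.letter_before_crossing[OF t] lt by (simp add: W_Suc)
    show "take (q n) (W (Suc n) 1) = replicate (q n) 2"
      unfolding W_Suc using t w2 lt by (intro bw.take_best_ordering) auto
  qed
  have "(\<lambda>n. turn \<alpha> ^ sum_list (map (height n) (take (q n) (W (Suc n) 1)))) \<longlonglongrightarrow> 1"
    by (rule continuous_eigenvalue_return_times[OF ev norm_turn, of N]) (use word(1,2) in blast)
  then have "(\<lambda>n. Re (turn \<alpha> ^ sum_list (map (height n) (take (q n) (W (Suc n) 1))))) \<longlonglongrightarrow> 1"
    by (drule_tac tendsto_Re) simp
  \<comment> \<open>Modulo \<open>1\<close>, each of the \<open>q n\<close> heights contributes the
    phase \<open>w n $ 2\<close>. The sum lies in \<open>[1/4, 2/5]\<close>, inside the half-circle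
    \<open>[1/4, 3/4]\<close> on which the cosine is not positive.\<close>
  moreover have "Re (turn \<alpha> ^ sum_list (map (height n) (take (q n) (W (Suc n) 1)))) \<le> 0" if n: "n \<ge> N" for n
  proof -
    have n1: "n \<ge> 1" using N[OF n] by simp
    have "turn \<alpha> ^ sum_list (map (height n) (take (q n) (W (Suc n) 1))) = turn (real (q n * height n 2) * \<alpha>)"
      unfolding word(3)[OF n] turn_of_nat_mult by (simp add: sum_list_replicate)
    also have "\<dots> = turn (real (q n) * w n $ 2)"
    proof (rule turn_cong)
      have "real (q n) * (\<alpha> * real (height n 2) - w n $ 2) \<in> \<int>" using phase_Ints[OF n1] by simp
      then show "real (q n * height n 2) * \<alpha> - real (q n) * w n $ 2 \<in> \<int>" by (simp add: algebra_simps)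
    qed
    finally have eq: "Re (turn \<alpha> ^ sum_list (map (height n) (take (q n) (W (Suc n) 1)))) =
        - cos (2 * pi * (real (q n) * w n $ 2) - pi)"
      by (simp add: turn_def)
    have "pi * (1 / 4) \<le> pi * (real (q n) * w n $ 2)" "pi * (real (q n) * w n $ 2) \<le> pi * (2 / 5)"
      using q[OF n] by (intro mult_left_mono; simp)+
    then have "0 \<le> cos (2 * pi * (real (q n) * w n $ 2) - pi)"
      using pi_gt_zero by (intro cos_ge_zero) (simp_all add: algebra_simps)
    then show ?thesis using eq by simp
  qed
  ultimately have "(1::real) \<le> 0" by (intro LIMSEQ_le_const2) auto
  then show False by simp
qed

end

theorem theorem25:
  fixes e_u e_s :: "real^2" and \<epsilon> \<delta> :: "nat \<Rightarrow> real"
  assumes "norm e_u = 1" and "norm e_s = 1" and "e_u \<bullet> e_s = 0"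
    and "fib_mat *v e_u = golden_ratio *\<^sub>R e_u" and "\<forall>i. e_u $ i > 0"
    and "\<exists>c. c \<noteq> golden_ratio \<and> fib_mat *v e_s = c *\<^sub>R e_s" and "e_s $ 2 > 0"
    and "\<forall>n\<ge>1. 0 < \<epsilon> n \<and> \<epsilon> n \<le> inverse golden_ratio"
    and "\<forall>n\<ge>1. 0 < \<delta> n \<and> \<delta> n \<le> inverse golden_ratio"
    and "\<forall>m\<ge>1. \<forall>n\<ge>m. \<epsilon> n \<le> \<epsilon> m"
    and "\<forall>m\<ge>1. \<forall>n\<ge>m. \<delta> n \<le> \<delta> m"
    and "\<forall>n\<ge>1. \<delta> n \<le> \<epsilon> n"
    and "summable (\<lambda>n. \<epsilon> (Suc n))"
  shows "\<exists>(k :: nat \<Rightarrow> nat) (\<alpha> :: real) (z :: nat \<Rightarrow> int^2) (w :: nat \<Rightarrow> real^2)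
          (u :: nat \<Rightarrow> real) (v :: nat \<Rightarrow> real).
    let M = (\<lambda>n. mat_power (fib_mat :: nat^2^2) (k n));
        H1 = (vector [1, 1] :: real^2);
        B = best_ordering_diagram M w;
        X = path_space B;
        T = vershik B
    in (\<forall>n\<ge>2. k n \<ge> 2) \<and> \<alpha> > 0 \<and>
       (\<forall>n\<ge>1. w n = u n *\<^sub>R e_u + v n *\<^sub>R e_s) \<and>
       (\<forall>n\<ge>1. \<alpha> *\<^sub>R (map_matrix real (mat_product M n) *v H1) = w n + real_ivec (z n)) \<and>
       (\<forall>n\<ge>1. 0 < u n \<and> u n \<le> \<delta> n * v n) \<and>
       (\<forall>n\<ge>2. infnorm (w n) \<le> 4 * \<epsilon> n) \<and>
       \<alpha> *\<^sub>R H1 \<notin> {real_ivec y + s |y s. s \<in> span {e_s}} \<and>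
       (\<forall>n\<ge>1. \<forall>j. \<bar>w n $ 1\<bar> / \<bar>w n $ 2\<bar> < real (M (n + 1) $ j $ 2) / real (M (n + 1) $ j $ 1)) \<and>
       ordered_bratteli_diagram B \<and>
       (\<forall>n\<ge>2. \<forall>i j. incidence B n (Some i) (Some j) = M n $ i $ j) \<and>
       properly_ordered B \<and>
       cantor_minimal_system X T \<and>
       uniquely_ergodic X T \<and>
       (\<forall>\<mu>. invariant_probability X T \<mu> \<longrightarrow>
            measurable_eigenvalue T \<mu> (exp (2 * \<i> * of_real pi * of_real \<alpha>))) \<and>
       \<not> continuous_eigenvalue X T (exp (2 * \<i> * of_real pi * of_real \<alpha>))"
proof -
  note [simp del] = One_nat_def
  interpret golden_basis e_u e_s
    using assms(1-7) by unfold_locales auto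
  have inv: "inverse golden_ratio \<le> 1"
    using golden_ratio_bounds by (simp add: inverse_le_1_iff)
  have sum_\<epsilon>: "summable \<epsilon>" using assms(13) by (simp add: summable_Suc_iff)
  have sum_\<delta>: "summable \<delta>"
    by (rule summable_comparison_test_ev[OF _ sum_\<epsilon>])
      (use assms(9,12) in \<open>auto intro!: eventually_sequentiallyI[of 1] simp: less_imp_le\<close>)
  obtain \<kappa> \<mu> \<alpha> u v where gs: "golden_sequences e_u e_s \<kappa> \<mu> \<alpha> u v \<delta>"
    and \<mu>: "\<forall>n\<ge>2. \<rho> ^ \<mu> n \<le> \<epsilon> n"
    using golden_sequences_exist[OF _ sum_\<epsilon> _ _ sum_\<delta>] assms(8,9) inv by force
  interpret g: golden_sequences e_u e_s \<kappa> \<mu> \<alpha> u v \<delta> by (rule gs)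
  have "\<forall>n. \<exists>z. n \<ge> 1 \<longrightarrow> \<alpha> *\<^sub>R g.tower_heights n - g.w n = real_ivec z"
    using g.heights_int_vecs int_vecs_real_ivec by blast
  then obtain z where z: "\<And>n. n \<ge> 1 \<Longrightarrow> \<alpha> *\<^sub>R g.tower_heights n - g.w n = real_ivec (z n)" by metis
  have turn: "exp (2 * \<i> * of_real pi * of_real \<alpha>) = turn \<alpha>"
    by (simp add: turn_def cis_conv_exp mult_ac)
  show ?thesis
    unfolding Let_def
  \<comment> \<open>The exponents are \<open>k n = 2 * \<kappa> n\<close>, so
    \<open>k n \<ge> 2\<close> amounts to \<open>\<kappa> n \<ge> 1\<close>.\<close>
  proof (rule exI[of _ "\<lambda>n. 2 * \<kappa> n"], rule exI[of _ \<alpha>], rule exI[of _ z], rule exI[of _ g.w],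
      rule exI[of _ u], rule exI[of _ v], unfold turn g.M_def[symmetric] g.best_ordering_diagram_eq, intro conjI allI impI)
    fix n :: nat
    show "2 \<le> 2 * \<kappa> n" if "2 \<le> n" using g.\<kappa>_pos[OF that] by simp
    show "g.w n = u n *\<^sub>R e_u + v n *\<^sub>R e_s" by (rule g.w_def)
    show "\<alpha> *\<^sub>R (map_matrix real (mat_product g.M n) *v vector [1, 1]) = g.w n + real_ivec (z n)"
      if "1 \<le> n" using z[OF that] by (simp add: g.tower_heights_def algebra_simps)
    show "0 < u n" if "1 \<le> n" using g.u_pos[OF that] .
    show "u n \<le> \<delta> n * v n" if "1 \<le> n" using g.u_le[OF that] g.u_pos[OF that] by linarith
    show "infnorm (g.w n) \<le> 4 * \<epsilon> n" if n: "2 \<le> n"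
    proof -
      have "infnorm (g.w n) \<le> 2 * \<rho> ^ \<mu> n" using n by (intro g.infnorm_w_le) simp
      also have "\<dots> \<le> 2 * \<epsilon> n" using \<mu> n by simp
      finally show ?thesis using assms(8) n by (smt (verit) one_le_numeral order_trans)
    qed
    show "incidence (word_diagram g.W) n (Some i) (Some j) = g.M n $ i $ j" if "2 \<le> n" for i j
      using g.incidence_word[OF that] g.count_W[of "n - 1"] that by (cases n) auto
    show "\<bar>g.w n $ 1\<bar> / \<bar>g.w n $ 2\<bar> < real (g.M (n + 1) $ j $ 2) / real (g.M (n + 1) $ j $ 1)"
      if "1 \<le> n" for j using that by (rule g.w_ratio)
    show "measurable_eigenvalue (vershik (word_diagram g.W)) m (turn \<alpha>)"
      if "invariant_probability (path_space (word_diagram g.W)) (vershik (word_diagram g.W)) m" for m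
      using that by (rule g.measurable_eigenvalue_B)
  qed (fact g.\<alpha>_pos g.start_not_stable g.ordered_bratteli_diagram_word g.properly_ordered_word
      g.cantor_minimal_word g.uniquely_ergodic_B g.not_continuous_eigenvalue_B)+
qed

end
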